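(* Let $r\ge1$, $s\ge 1$, let $\mu=(\mu_1\ge\dots\ge\mu_s\ge0)$ be a partition with $s$ parts (zero parts allowed) and $\eta=(\eta_1,\dots,\eta_s)\in\mathbb{Z}_{>0}^s$. With $$Y=\sum_{i=0}^{r-1}t_{i,i+1}t_{i+1,i+2}\cdots t_{r-2,r-1}\,X^{(i)}$$ (the coefficient of $X^{(r-1)}$ being $1$), one has $$\mathcal{H}_{\mu,\eta,i_1=0}[X^\bullet;t_{Q_1}]=\mathcal{H}_{\mu,\eta}[Y;\,t_{0,1}t_{1,2}\cdots t_{r-1,0}],$$ where the left side is the cyclic quiver parabolic Hall–Littlewood function and the right side is the plethystic substitution $X\mapsto Y$, $t\mapsto t_{0,1}t_{1,2}\cdots t_{r-1,0}$ in the ordinary (single loop) parabolic Hall–Littlewood function $\mathcal{H}_{\mu,\eta}[X;t]$.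
   Context: **Cyclic quiver symmetric functions.** $Q_0=\mathbb{Z}/r\mathbb{Z}$, with representatives $0,\dots,r-1$; node indices are read modulo $r$. There is an invertible variable $t_{i,i+1}$ for each arrow $(i,i+1)$, $i\in Q_0$ (for $r=1$ a single variable $t_{0,0}$). Let $\Lambda$ be the ring of symmetric functions and $\Lambda^Q=\bigotimes_{i\in Q_0}\Lambda^{(i)}$, $\Lambda^{(i)}\cong\Lambda$, with coefficients in $\mathbb{Z}[t_{i,i+1}^{\pm1}: i\in Q_0]$. For $f\in\Lambda$, $f[X^{(i)}]$ is the tensor with $f$ in factor $i$ and $1$ elsewhere; $f[X^{(i)}]^\perp$ is the operator on $\Lambda^Q$ adjoint, with respect to the Hall inner product on factor $i$, to multiplication by $f[X^{(i)}]$. **Operators.** For $i\in Q_0$, $a\ge1$, $Z=(z_1,\dots,z_a)$ define operators $H^{(i,a)}_\beta$ ($\beta\in\mathbb{Z}^a$) on $\Lambda^Q$ by $$\sum_{\beta\in\mathbb{Z}^a} z^\beta H^{(i,a)}_\beta=\prod_{1\le k<\ell\le a}(1-z_\ell/z_k)\;\prod_{k=1}^a\Omega[z_kX^{(i)}]\;\prod_{k=1}^a\Omega[-z_k^{-1}(X^{(i)}-t_{i,i+1}X^{(i+1)})]^\perp,$$ where $\Omega[zX^{(i)}]=\sum_{m\ge0}z^mh_m[X^{(i)}]$ acts by multiplication and $\Omega[-z^{-1}(X^{(i)}-t_{i,i+1}X^{(i+1)})]^\perp=\big(\sum_{m\ge0}(-z)^{-m}e_m[X^{(i)}]^\perp\big)\big(\sum_{m\ge0}(t_{i,i+1}/z)^{m}h_m[X^{(i+1)}]^\perp\big)$.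 **Cyclic quiver Hall–Littlewood function $\mathcal{H}_{\mu,\eta,i_1=0}$.** Form a sequence of triples (node, $a$, weight in $\mathbb{Z}^a$) in $s$ passes: pass $k$ for $1\le k\le s$ visits nodes $0,1,\dots,r-1$ in order with $a=\eta_k$, with weight $(0^{\eta_k})$ at each node $\ne r-1$ and $(\mu_k^{\eta_k})$ (i.e. $\eta_k$ entries equal to $\mu_k$) at node $r-1$. If the sequence is $(i_1,a_1,\mu(1)),\dots,(i_m,a_m,\mu(m))$ with $m=rs$, then $\mathcal{H}_{\mu,\eta,i_1=0}[X^\bullet;t_{Q_1}]=H^{(i_1,a_1)}_{\mu(1)}\cdots H^{(i_m,a_m)}_{\mu(m)}\cdot1$. **Single loop version.** $\mathcal{H}_{\mu,\eta}[X;t]\in\Lambda\otimes\mathbb{Z}[t]$ is the parabolic Hall–Littlewood function of the sequence of rectangles $(\mu_k^{\eta_k})$, $1\le k\le s$: it is the cyclic quiver Hall–Littlewood function $\mathcal{H}_{\mu,\eta,i_1=0}$ for $r=1$ (one node $0$ with a single loop) with $X=X^{(0)}$, $t=t_{0,0}$, i.e. $\mathcal{H}_{\mu,\eta}[X;t]=H^{(0,\eta_1)}_{(\mu_1^{\eta_1})}\cdots H^{(0,\eta_s)}_{(\mu_s^{\eta_s})}\cdot1$, where here, for $a\ge1$, the operators $H^{(0,a)}_\beta$ ($\beta\in\mathbb{Z}^a$) act on symmetric functions in $X$ and are defined by $$\sum_{\beta\in\mathbb{Z}^a} z^\beta H^{(0,a)}_\beta=\prod_{1\le k<\ell\le a}(1-z_\ell/z_k)\;\prod_{k=1}^a\Omega[z_kX]\;\prod_{k=1}^a\Omega[-z_k^{-1}(X-tX)]^\perp,$$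 with $\Omega[zX]=\sum_{m\ge0}z^mh_m[X]$ acting by multiplication and $\Omega[-z^{-1}(X-tX)]^\perp=\big(\sum_{m\ge0}(-z)^{-m}e_m[X]^\perp\big)\big(\sum_{m\ge0}(t/z)^{m}h_m[X]^\perp\big)$. **Plethysm.** Substituting $X\mapsto Y$ is the ring homomorphism on $\Lambda$ with $p_k[Y]=\sum_{i=0}^{r-1}(t_{i,i+1}t_{i+1,i+2}\cdots t_{r-2,r-1})^k\,p_k[X^{(i)}]$ for $k\ge1$. *)

theory Defs
  imports
    "HOL-Library.FuncSet"
    "HOL-Library.Poly_Mapping"
    "HOL-Library.Multiset"
    "HOL-Computational_Algebra.Polynomial"
begin

section \<open>Tensor products of rings of symmetric functions\<close>

text \<open>
  Variables are pairs \<open>(i, j)\<close>: the \<open>j\<close>-th variable of the alphabet \<open>X\<^sup>(\<^sup>i\<^sup>)\<close> at node \<open>i\<close>. A monomial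
  is its finitely supported exponent function.
\<close>

type_synonym 'i mon = "('i \<times> nat) \<Rightarrow>\<^sub>0 nat"

definition mdeg :: "'i mon \<Rightarrow> nat" where
  "mdeg m = sum (Poly_Mapping.lookup m) (Poly_Mapping.keys m)"

definition at_node :: "'i \<Rightarrow> (nat \<Rightarrow> nat) \<Rightarrow> 'i \<times> nat \<Rightarrow> 'i \<times> nat" where
  "at_node i \<pi> = (\<lambda>(j, k). (j, if j = i then \<pi> k else k))"

definition splits :: "'i mon \<Rightarrow> ('i mon \<times> 'i mon) set" where
  "splits m = {(p, q). p + q = m}"

text \<open>
  An element of the tensor product over all nodes \<open>i\<close> of copies of the ring of symmetric functions
  with coefficients in \<open>'a\<close> is a formal power series (given by its coefficient function) of bounded
  degree, involving the alphabets of finitely many nodes only, and symmetric in each alphabet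
  separately. For \<open>'i = unit\<close> this is the ring of symmetric functions itself. For \<open>'i = nat\<close> the
  tensor product over the nodes \<open>0, \<dots>, r - 1\<close> is the subring of series not involving the other
  nodes.
\<close>

definition is_msym :: "('i mon \<Rightarrow> 'a::zero) \<Rightarrow> bool" where
  "is_msym f \<longleftrightarrow>
     (\<exists>d. \<forall>m. f m \<noteq> 0 \<longrightarrow> mdeg m \<le> d) \<and>
     (\<exists>S. finite S \<and> (\<forall>m. f m \<noteq> 0 \<longrightarrow> fst ` Poly_Mapping.keys m \<subseteq> S)) \<and>
     (\<forall>i \<pi> m. bij \<pi> \<longrightarrow> f (Poly_Mapping.map_key (at_node i \<pi>) m) = f m)"

lemma at_node_inv:
  assumes "bij \<pi>"
  shows "at_node i \<pi> (at_node i (inv \<pi>) x) = x" and "at_node i (inv \<pi>) (at_node i \<pi> x) = x"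
  using assms by (cases x; simp add: at_node_def bij_is_surj bij_is_inj surj_f_inv_f)+

lemma inj_at_node: "bij \<pi> \<Longrightarrow> inj (at_node i \<pi>)"
  by (metis at_node_inv(2) injI)

lemma lookup_map_key_at_node:
  "bij \<pi> \<Longrightarrow>
    Poly_Mapping.lookup (Poly_Mapping.map_key (at_node i \<pi>) m) x = Poly_Mapping.lookup m (at_node i \<pi> x)"
  by (simp add: map_key.rep_eq inj_at_node)

lemma map_key_at_node_inv:
  assumes "bij \<pi>"
  shows "Poly_Mapping.map_key (at_node i \<pi>) (Poly_Mapping.map_key (at_node i (inv \<pi>)) m) = m"
    and "Poly_Mapping.map_key (at_node i (inv \<pi>)) (Poly_Mapping.map_key (at_node i \<pi>) m) = m"
  by (rule poly_mapping_eqI,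
      simp only: lookup_map_key_at_node[OF assms] at_node_inv[OF assms]
        lookup_map_key_at_node[OF bij_imp_bij_inv[OF assms]])+

lemma keys_add_nat: "Poly_Mapping.keys (p + q) = Poly_Mapping.keys p \<union> Poly_Mapping.keys q"
  for p q :: "'k \<Rightarrow>\<^sub>0 nat"
  by (auto simp: in_keys_iff lookup_add)

lemma mdeg_superset:
  "finite A \<Longrightarrow> Poly_Mapping.keys m \<subseteq> A \<Longrightarrow> mdeg m = sum (Poly_Mapping.lookup m) A"
  unfolding mdeg_def by (rule sum.mono_neutral_left) (auto simp: in_keys_iff)

lemma mdeg_add: "mdeg (p + q) = mdeg p + mdeg q"
proof -
  let ?A = "Poly_Mapping.keys p \<union> Poly_Mapping.keys q"
  have "mdeg (p + q) = sum (Poly_Mapping.lookup (p + q)) ?A"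
    by (rule mdeg_superset) (auto simp: keys_add_nat)
  also have "\<dots> = sum (Poly_Mapping.lookup p) ?A + sum (Poly_Mapping.lookup q) ?A"
    by (simp add: lookup_add sum.distrib)
  also have "\<dots> = mdeg p + mdeg q"
    by (subst (1 2) mdeg_superset[of ?A]) auto
  finally show ?thesis .
qed

lemma finite_bounded_mon: "finite {p :: 'i mon. \<forall>k. Poly_Mapping.lookup p k \<le> Poly_Mapping.lookup m k}"
proof -
  let ?K = "Poly_Mapping.keys m"
  let ?S = "{p :: 'i mon. \<forall>k. Poly_Mapping.lookup p k \<le> Poly_Mapping.lookup m k}"
  let ?F = "PiE ?K (\<lambda>k. {..Poly_Mapping.lookup m k})"
  have "finite ?F"
    by (intro finite_PiE) auto
  moreover have "(\<lambda>p. restrict (Poly_Mapping.lookup p) ?K) ` ?S \<subseteq> ?F"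
    by auto
  moreover have "inj_on (\<lambda>p. restrict (Poly_Mapping.lookup p) ?K) ?S"
  proof (rule inj_onI, rule poly_mapping_eqI)
    fix p q k
    assume pq: "p \<in> ?S" "q \<in> ?S"
      "restrict (Poly_Mapping.lookup p) ?K = restrict (Poly_Mapping.lookup q) ?K"
    show "Poly_Mapping.lookup p k = Poly_Mapping.lookup q k"
    proof (cases "k \<in> ?K")
      case True
      then show ?thesis using fun_cong[OF pq(3), of k] by simp
    next
      case False
      then have "Poly_Mapping.lookup m k = 0" by (simp add: in_keys_iff)
      then show ?thesis using pq(1,2) by (metis (mono_tags, lifting) le_zero_eq mem_Collect_eq)
    qed
  qed
  ultimately show ?thesis
    by (meson finite_imageD finite_subset)
qed

lemma finite_splits: "finite (splits m)"
proof (rule finite_subset)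
  let ?S = "{p. \<forall>k. Poly_Mapping.lookup p k \<le> Poly_Mapping.lookup m k}"
  show "splits m \<subseteq> ?S \<times> ?S"
    by (auto simp: splits_def lookup_add)
  show "finite (?S \<times> ?S)"
    by (intro finite_cartesian_product finite_bounded_mon)
qed

lemma splits_0: "splits 0 = {(0, 0)}"
proof -
  have "p = 0 \<and> q = 0" if "p + q = 0" for p q :: "'k mon"
  proof -
    have "Poly_Mapping.keys p \<union> Poly_Mapping.keys q = {}"
      using that keys_add_nat[of p q] by simp
    then show ?thesis by auto
  qed
  then show ?thesis by (auto simp: splits_def)
qed

definition conv :: "('i mon \<Rightarrow> 'a) \<Rightarrow> ('i mon \<Rightarrow> 'a) \<Rightarrow> 'i mon \<Rightarrow> 'a::comm_semiring_0" where
  "conv f g m = (\<Sum>(p, q)\<in>splits m. f p * g q)"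

lemma conv_nonzeroE:
  assumes "conv f g m \<noteq> 0"
  obtains p q where "m = p + q" "f p \<noteq> 0" "g q \<noteq> 0"
proof -
  obtain z where "z \<in> splits m" "(case z of (p, q) \<Rightarrow> f p * g q) \<noteq> 0"
    using assms sum.not_neutral_contains_not_neutral unfolding conv_def by blast
  then show ?thesis
    using that[of "fst z" "snd z"] by (cases z) (auto simp: splits_def dest: mult_not_zero)
qed

lemma conv_commute: "conv f g = conv g f"
proof
  fix m
  show "conv f g m = conv g f m"
    unfolding conv_def
    by (rule sum.reindex_bij_witness[of _ prod.swap prod.swap])
      (auto simp: splits_def add.commute mult.commute)
qed

lemma conv_assoc: "conv (conv f g) h = conv f (conv g h)"
proof
  fix m
  have "conv (conv f g) h m =
      (\<Sum>(z, z')\<in>Sigma (splits m) (\<lambda>z. splits (fst z)). f (fst z') * g (snd z') * h (snd z))"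
    unfolding conv_def
    by (subst sum.Sigma[symmetric])
      (auto simp: finite_splits sum_distrib_right intro!: sum.cong)
  also have "\<dots> =
      (\<Sum>(z, z')\<in>Sigma (splits m) (\<lambda>z. splits (snd z)). f (fst z) * (g (fst z') * h (snd z')))"
    by (rule sum.reindex_bij_witness[of _
          "\<lambda>((a, b), (c, d)). ((a + c, d), (a, c))" "\<lambda>((a, b), (c, d)). ((c, d + b), (d, b))"])
      (auto simp: splits_def add.assoc mult.assoc)
  also have "\<dots> = conv f (conv g h) m"
    unfolding conv_def
    by (subst sum.Sigma[symmetric])
      (auto simp: finite_splits sum_distrib_left intro!: sum.cong)
  finally show "conv (conv f g) h m = conv f (conv g h) m" .
qed

lemma conv_add_left: "conv (\<lambda>m. f m + g m) h = (\<lambda>m. conv f h m + conv g h m)"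
  by (auto simp: conv_def fun_eq_iff sum.distrib[symmetric] distrib_right intro!: sum.cong)

lemma conv_one_left: "conv (\<lambda>m. if m = 0 then 1 else 0) f = (f :: 'i mon \<Rightarrow> 'a::comm_semiring_1)"
proof
  fix m :: "'i mon"
  have "conv (\<lambda>m. if m = 0 then 1 else 0) f m =
      (\<Sum>z\<in>{(0 :: 'i mon, m)}. (if fst z = 0 then 1 else 0) * f (snd z))"
    unfolding conv_def case_prod_unfold
    by (rule sum.mono_neutral_cong_right[OF finite_splits]) (auto simp: splits_def split: if_splits)
  then show "conv (\<lambda>m. if m = 0 then 1 else 0) f m = f m" by simp
qed

lemma is_msym_conv:
  fixes f g :: "'i mon \<Rightarrow> 'a::comm_semiring_0"
  assumes f: "is_msym f" and g: "is_msym g"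
  shows "is_msym (conv f g)"
  unfolding is_msym_def
proof (intro conjI allI impI)
  from f g obtain d d' where
    "\<forall>m. f m \<noteq> 0 \<longrightarrow> mdeg m \<le> d" "\<forall>m. g m \<noteq> 0 \<longrightarrow> mdeg m \<le> d'"
    by (auto simp: is_msym_def)
  then show "\<exists>d. \<forall>m. conv f g m \<noteq> 0 \<longrightarrow> mdeg m \<le> d"
    by (intro exI[of _ "d + d'"]) (auto elim!: conv_nonzeroE simp: mdeg_add add_mono)
next
  from f g obtain S S' where
    "finite S" "\<forall>m. f m \<noteq> 0 \<longrightarrow> fst ` Poly_Mapping.keys m \<subseteq> S"
    "finite S'" "\<forall>m. g m \<noteq> 0 \<longrightarrow> fst ` Poly_Mapping.keys m \<subseteq> S'"
    by (auto simp: is_msym_def)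
  then show "\<exists>S. finite S \<and> (\<forall>m. conv f g m \<noteq> 0 \<longrightarrow> fst ` Poly_Mapping.keys m \<subseteq> S)"
    by (intro exI[of _ "S \<union> S'"]) (fastforce elim!: conv_nonzeroE simp: keys_add_nat)
next
  fix i and \<pi> :: "nat \<Rightarrow> nat" and m
  assume \<pi>: "bij \<pi>"
  let ?s = "Poly_Mapping.map_key (at_node i \<pi>) :: 'i mon \<Rightarrow> 'i mon"
  let ?t = "Poly_Mapping.map_key (at_node i (inv \<pi>)) :: 'i mon \<Rightarrow> 'i mon"
  have inj: "inj (at_node i \<pi>)" "inj (at_node i (inv \<pi>))"
    using \<pi> by (auto intro!: inj_at_node bij_imp_bij_inv)
  have fg: "f (?s p) = f p" "g (?s p) = g p" for p
    using f g \<pi> by (auto simp: is_msym_def)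
  show "conv f g (?s m) = conv f g m"
    unfolding conv_def
  proof (rule sum.reindex_bij_witness[of _ "map_prod ?s ?s" "map_prod ?t ?t"])
    fix z assume "z \<in> splits (?s m)"
    then show "map_prod ?t ?t z \<in> splits m"
      by (auto simp: splits_def map_key_plus[OF inj(2), symmetric] map_key_at_node_inv[OF \<pi>])
  next
    fix z assume "z \<in> splits (?s m)"
    show "(case map_prod ?t ?t z of (p, q) \<Rightarrow> f p * g q) = (case z of (p, q) \<Rightarrow> f p * g q)"
      using fg[of "?t (fst z)"] fg[of "?t (snd z)"]
      by (cases z) (simp add: map_key_at_node_inv[OF \<pi>])
  qed (auto simp: splits_def map_key_plus[OF inj(1), symmetric] map_key_at_node_inv[OF \<pi>])
qed

lemma is_msym_zero: "is_msym (\<lambda>_. 0)"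
  by (auto simp: is_msym_def)

lemma map_key_at_node_eq_0_iff:
  assumes "bij \<pi>"
  shows "Poly_Mapping.map_key (at_node i \<pi>) m = 0 \<longleftrightarrow> m = 0"
  using map_key_at_node_inv(2)[OF assms, of i m]
  by (metis map_key_zero inj_at_node assms bij_imp_bij_inv)

lemma is_msym_const: "is_msym (\<lambda>m. if m = 0 then c else 0)"
  unfolding is_msym_def
  by (auto simp: mdeg_def map_key_at_node_eq_0_iff)

lemma is_msym_add:
  fixes f g :: "'i mon \<Rightarrow> 'a::comm_monoid_add"
  assumes f: "is_msym f" and g: "is_msym g"
  shows "is_msym (\<lambda>m. f m + g m)"
  unfolding is_msym_def
proof (intro conjI allI impI)
  from f g obtain d d' where
    *: "\<forall>m. f m \<noteq> 0 \<longrightarrow> mdeg m \<le> d" "\<forall>m. g m \<noteq> 0 \<longrightarrow> mdeg m \<le> d'"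
    by (auto simp: is_msym_def)
  show "\<exists>d. \<forall>m. f m + g m \<noteq> 0 \<longrightarrow> mdeg m \<le> d"
  proof (intro exI[of _ "max d d'"] allI impI)
    fix m assume "f m + g m \<noteq> 0"
    then have "f m \<noteq> 0 \<or> g m \<noteq> 0" by auto
    then show "mdeg m \<le> max d d'" using * by (auto simp: le_max_iff_disj)
  qed
next
  from f g obtain S S' where
    *: "finite S" "\<forall>m. f m \<noteq> 0 \<longrightarrow> fst ` Poly_Mapping.keys m \<subseteq> S"
    "finite S'" "\<forall>m. g m \<noteq> 0 \<longrightarrow> fst ` Poly_Mapping.keys m \<subseteq> S'"
    by (auto simp: is_msym_def)
  show "\<exists>S. finite S \<and> (\<forall>m. f m + g m \<noteq> 0 \<longrightarrow> fst ` Poly_Mapping.keys m \<subseteq> S)"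
  proof (intro exI[of _ "S \<union> S'"] conjI allI impI)
    fix m assume "f m + g m \<noteq> 0"
    then have "f m \<noteq> 0 \<or> g m \<noteq> 0" by auto
    then show "fst ` Poly_Mapping.keys m \<subseteq> S \<union> S'" using * by blast
  qed (use * in auto)
qed (use f g in \<open>auto simp: is_msym_def\<close>)

typedef (overloaded) ('i, 'a::zero) msym = "{f :: 'i mon \<Rightarrow> 'a::zero. is_msym f}"
  morphisms coef Abs_msym
  by (rule exI[of _ "\<lambda>_. 0"]) (simp add: is_msym_zero)

setup_lifting type_definition_msym

instantiation msym :: (type, comm_ring_1) comm_ring_1
begin

lift_definition zero_msym :: "('a, 'b) msym" is "\<lambda>_::'a mon. 0::'b"
  by (rule is_msym_zero)

lift_definition one_msym :: "('a, 'b) msym" is "\<lambda>m::'a mon. if m = 0 then 1 else 0::'b"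
  by (rule is_msym_const)

lift_definition plus_msym :: "('a, 'b) msym \<Rightarrow> ('a, 'b) msym \<Rightarrow> ('a, 'b) msym"
  is "\<lambda>(f::'a mon \<Rightarrow> 'b) g m. f m + g m"
  by (rule is_msym_add)

lift_definition uminus_msym :: "('a, 'b) msym \<Rightarrow> ('a, 'b) msym" is "\<lambda>(f::'a mon \<Rightarrow> 'b) m. - f m"
  by (simp add: is_msym_def)

lift_definition minus_msym :: "('a, 'b) msym \<Rightarrow> ('a, 'b) msym \<Rightarrow> ('a, 'b) msym"
  is "\<lambda>(f::'a mon \<Rightarrow> 'b) g m. f m - g m"
  subgoal for f g
    using is_msym_add[of f "\<lambda>m. - g m"] by (simp add: is_msym_def)
  done

lift_definition times_msym :: "('a, 'b) msym \<Rightarrow> ('a, 'b) msym \<Rightarrow> ('a, 'b) msym"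
  is "conv :: ('a mon \<Rightarrow> 'b) \<Rightarrow> _"
  by (rule is_msym_conv)

instance
proof
  fix F G H :: "('a, 'b) msym"
  show "F * G = G * F"
    by transfer (rule conv_commute)
  show "F * G * H = F * (G * H)"
    by transfer (rule conv_assoc)
  show "1 * F = F"
    by transfer (rule conv_one_left)
  show "(F + G) * H = F * H + G * H"
    by transfer (rule conv_add_left)
  show "(0::('a, 'b) msym) \<noteq> 1"
    by transfer (auto simp: fun_eq_iff)
qed (transfer; simp add: fun_eq_iff algebra_simps)+

end

lift_definition const :: "'a::comm_ring_1 \<Rightarrow> ('i, 'a) msym"
  is "\<lambda>(c::'a) (m::'i mon). if m = 0 then c else 0"
  by (rule is_msym_const)

definition exponents :: "'i mon \<Rightarrow> nat multiset" where
  "exponents m = image_mset (Poly_Mapping.lookup m) (mset_set (Poly_Mapping.keys m))"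

lemma mdeg_exponents: "mdeg m = sum_mset (exponents m)"
  by (simp add: mdeg_def exponents_def sum_unfold_sum_mset)

lemma map_key_at_node:
  assumes "bij \<pi>"
  shows "exponents (Poly_Mapping.map_key (at_node i \<pi>) m) = exponents m"
    and "fst ` Poly_Mapping.keys (Poly_Mapping.map_key (at_node i \<pi>) m) = fst ` Poly_Mapping.keys m"
proof -
  let ?g = "at_node i \<pi>"
  let ?m' = "Poly_Mapping.map_key ?g m"
  have inj: "inj ?g" by (rule inj_at_node[OF assms])
  have lookup: "Poly_Mapping.lookup ?m' = Poly_Mapping.lookup m \<circ> ?g"
    using inj by (simp add: map_key.rep_eq)
  have surj: "x = ?g (at_node i (inv \<pi>) x)" for x
    using at_node_inv(1)[OF assms, of i x] by simp
  have keys: "Poly_Mapping.keys m = ?g ` Poly_Mapping.keys ?m'"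
  proof (intro equalityI subsetI)
    fix x assume "x \<in> Poly_Mapping.keys m"
    then have "at_node i (inv \<pi>) x \<in> Poly_Mapping.keys ?m'"
      by (simp add: in_keys_iff lookup surj[symmetric])
    then show "x \<in> ?g ` Poly_Mapping.keys ?m'"
      using surj[of x] by (metis image_eqI)
  qed (auto simp: in_keys_iff lookup)
  have "mset_set (Poly_Mapping.keys m) = image_mset ?g (mset_set (Poly_Mapping.keys ?m'))"
    unfolding keys by (rule image_mset_mset_set[symmetric]) (rule inj_on_subset[OF inj], simp)
  then show "exponents ?m' = exponents m"
    by (simp add: exponents_def lookup image_mset.compositionality)
  have "fst (?g x) = fst x" for x by (simp add: at_node_def split: prod.split)
  then show "fst ` Poly_Mapping.keys ?m' = fst ` Poly_Mapping.keys m"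
    unfolding keys by (simp add: image_image)
qed

text \<open>The monomial symmetric function \<open>m\<^sub>\<lambda>[X\<^sup>(\<^sup>i\<^sup>)]\<close>, where the partition \<open>\<lambda>\<close> is the multiset of its
  (nonzero) parts.\<close>

lift_definition msf :: "'i \<Rightarrow> nat multiset \<Rightarrow> ('i, 'a::comm_ring_1) msym"
  is "\<lambda>(i::'i) l (m::'i mon). if fst ` Poly_Mapping.keys m \<subseteq> {i} \<and> exponents m = l then (1::'a) else 0"
  subgoal for i l
    unfolding is_msym_def
    by (intro conjI exI[of _ "sum_mset l"] exI[of _ "{i}"])
      (auto simp: map_key_at_node mdeg_exponents split: if_splits)
  done

lift_definition hsf :: "'i \<Rightarrow> nat \<Rightarrow> ('i, 'a::comm_ring_1) msym"
  is "\<lambda>(i::'i) n (m::'i mon). if fst ` Poly_Mapping.keys m \<subseteq> {i} \<and> mdeg m = n then (1::'a) else 0"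
  subgoal for i n
    unfolding is_msym_def
    by (intro conjI exI[of _ n] exI[of _ "{i}"])
      (auto simp: map_key_at_node mdeg_exponents split: if_splits)
  done

definition esf :: "'i \<Rightarrow> nat \<Rightarrow> ('i, 'a::comm_ring_1) msym" where
  "esf i n = msf i (replicate_mset n 1)"

definition psf :: "'i \<Rightarrow> nat \<Rightarrow> ('i, 'a::comm_ring_1) msym" where
  "psf i k = msf i {#k#}"

text \<open>
  The Hall inner product on factor \<open>i\<close> is linear over the tensor product of the other factors, which
  consists of the elements that do not involve the alphabet of node \<open>i\<close>, and takes values there.
  It is determined by the duality of the bases of complete and monomial symmetric functions.
\<close>

definition free_of :: "'i \<Rightarrow> ('i, 'a::comm_ring_1) msym \<Rightarrow> bool" where
  "free_of i C \<longleftrightarrow> (\<forall>m. coef C m \<noteq> 0 \<longrightarrow> i \<notin> fst ` Poly_Mapping.keys m)"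

definition is_hall ::
  "'i \<Rightarrow> (('i, 'a::comm_ring_1) msym \<Rightarrow> ('i, 'a) msym \<Rightarrow> ('i, 'a) msym) \<Rightarrow> bool" where
  "is_hall i B \<longleftrightarrow>
     (\<forall>F F' G. B (F + F') G = B F G + B F' G) \<and>
     (\<forall>F G G'. B F (G + G') = B F G + B F G') \<and>
     (\<forall>C F G. free_of i C \<longrightarrow> B (C * F) G = C * B F G \<and> B F (C * G) = C * B F G) \<and>
     (\<forall>l l'. 0 \<notin># l \<longrightarrow> 0 \<notin># l' \<longrightarrow>
        B (\<Prod>k\<in>#l. hsf i k) (msf i l') = (if l = l' then 1 else 0))"

definition hall :: "'i \<Rightarrow> ('i, 'a::comm_ring_1) msym \<Rightarrow> ('i, 'a) msym \<Rightarrow> ('i, 'a) msym" where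
  "hall i = (THE B. is_hall i B)"

definition perp :: "'i \<Rightarrow> ('i, 'a::comm_ring_1) msym \<Rightarrow> ('i, 'a) msym \<Rightarrow> ('i, 'a) msym" where
  "perp i f F = (THE G. \<forall>K. hall i K G = hall i (f * K) F)"

section \<open>Formal series of operators\<close>

text \<open>
  A series \<open>\<Sum>\<^sub>\<beta> z\<^sup>\<beta> A\<^sub>\<beta>\<close> in the variables \<open>z\<^sub>0, z\<^sub>1, \<dots>\<close> and their inverses whose coefficients are
  operators is the function mapping \<open>\<beta>\<close> to \<open>A\<^sub>\<beta>\<close>. In the products formed below, for each
  argument \<open>F\<close> only finitely many summands of the convolution are nonzero, so that \<open>Sum_any\<close> is
  the actual sum.
\<close>

type_synonym 'm opseries = "(nat \<Rightarrow>\<^sub>0 int) \<Rightarrow> 'm \<Rightarrow> 'm"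

definition op_one :: "'m::comm_monoid_add opseries" where
  "op_one = (\<lambda>\<beta> F. if \<beta> = 0 then F else 0)"

definition op_mult :: "'m::comm_monoid_add opseries \<Rightarrow> 'm opseries \<Rightarrow> 'm opseries" where
  "op_mult A B = (\<lambda>\<beta> F. Sum_any (\<lambda>\<gamma>. A \<gamma> (B (\<beta> - \<gamma>) F)))"

definition op_prod :: "nat \<Rightarrow> (nat \<Rightarrow> 'm::comm_monoid_add opseries) \<Rightarrow> 'm opseries" where
  "op_prod a A = foldr (\<lambda>k. op_mult (A k)) [0..<a] op_one"

text \<open>\<open>\<Sum>\<^sub>n z\<^sub>k\<^sup>n c\<^sub>n\<close> and \<open>\<Sum>\<^sub>n z\<^sub>k\<^sup>-\<^sup>n c\<^sub>n\<close>, with \<open>n\<close> ranging over the natural numbers\<close>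

definition up_series :: "nat \<Rightarrow> (nat \<Rightarrow> 'm \<Rightarrow> 'm) \<Rightarrow> 'm::comm_monoid_add opseries" where
  "up_series k c = (\<lambda>\<beta> F. \<Sum>n | Poly_Mapping.single k (int n) = \<beta>. c n F)"

definition down_series :: "nat \<Rightarrow> (nat \<Rightarrow> 'm \<Rightarrow> 'm) \<Rightarrow> 'm::comm_monoid_add opseries" where
  "down_series k c = (\<lambda>\<beta> F. \<Sum>n | Poly_Mapping.single k (- int n) = \<beta>. c n F)"

text \<open>\<open>\<Prod> (1 - z\<^sub>l/z\<^sub>k)\<close> over \<open>k < l < a\<close>, first as a Laurent polynomial\<close>

definition root_prod :: "nat \<Rightarrow> (nat \<Rightarrow>\<^sub>0 int) \<Rightarrow>\<^sub>0 int" where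
  "root_prod a = (\<Prod>(k, l)\<in>{(k, l). k < l \<and> l < a}.
     1 - Poly_Mapping.single (Poly_Mapping.single l 1 - Poly_Mapping.single k 1) 1)"

definition root_series :: "nat \<Rightarrow> 'm::comm_ring_1 opseries" where
  "root_series a = (\<lambda>\<beta> F. of_int (Poly_Mapping.lookup (root_prod a) \<beta>) * F)"

text \<open>\<open>\<Omega>[z\<^sub>k X\<^sup>(\<^sup>i\<^sup>)]\<close>\<close>

definition Omega :: "'i \<Rightarrow> nat \<Rightarrow> ('i, 'a::comm_ring_1) msym opseries" where
  "Omega i k = up_series k (\<lambda>n F. hsf i n * F)"

text \<open>\<open>\<Omega>[-z\<^sub>k\<^sup>-\<^sup>1 (X\<^sup>(\<^sup>i\<^sup>) - t X\<^sup>(\<^sup>j\<^sup>))]\<^sup>\<bottom>\<close>\<close>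

definition Omega_perp :: "'a \<Rightarrow> 'i \<Rightarrow> 'i \<Rightarrow> nat \<Rightarrow> ('i, 'a::comm_ring_1) msym opseries" where
  "Omega_perp t i j k =
     op_mult (down_series k (\<lambda>n F. const ((-1) ^ n) * perp i (esf i n) F))
             (down_series k (\<lambda>n F. const (t ^ n) * perp j (hsf j n) F))"

text \<open>
  The operator \<open>H\<^sub>\<beta>\<close> in \<open>a\<close> variables at a node \<open>i\<close>, where \<open>t\<close> is the variable of the arrow from
  \<open>i\<close> to \<open>j\<close>; the weight \<open>\<beta>\<close> is a list of length \<open>a\<close>.
\<close>

definition Hop ::
  "'a \<Rightarrow> 'i \<Rightarrow> 'i \<Rightarrow> nat \<Rightarrow> int list \<Rightarrow> ('i, 'a::comm_ring_1) msym \<Rightarrow> ('i, 'a) msym" where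
  "Hop t i j a \<beta> =
     op_mult (root_series a) (op_mult (op_prod a (Omega i)) (op_prod a (Omega_perp t i j)))
       (Poly_Mapping.nth \<beta>)"

section \<open>Parabolic Hall--Littlewood functions\<close>

text \<open>
  The coefficient ring consists of Laurent polynomials; \<open>tvar i\<close>, for a node \<open>i < r\<close>, is the variable
  of the arrow \<open>(i, i + 1 mod r)\<close>. Only the variables with index below \<open>r\<close> are used.
\<close>

type_synonym laurent = "(nat \<Rightarrow>\<^sub>0 int) \<Rightarrow>\<^sub>0 int"

definition tvar :: "nat \<Rightarrow> laurent" where
  "tvar i = Poly_Mapping.single (Poly_Mapping.single i 1) 1"

definition quiver_seq :: "nat \<Rightarrow> nat list \<Rightarrow> nat list \<Rightarrow> (nat \<times> nat \<times> int list) list" where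
  "quiver_seq r \<mu> \<eta> = concat (map (\<lambda>k.
     map (\<lambda>i. (i, \<eta> ! k, replicate (\<eta> ! k) (if i = r - 1 then int (\<mu> ! k) else 0))) [0..<r])
     [0..<length \<eta>])"

definition quiver_HL :: "nat \<Rightarrow> nat list \<Rightarrow> nat list \<Rightarrow> (nat, laurent) msym" where
  "quiver_HL r \<mu> \<eta> =
     foldr (\<lambda>(i, a, \<beta>). Hop (tvar i) i ((i + 1) mod r) a \<beta>) (quiver_seq r \<mu> \<eta>) 1"

text \<open>The ordinary symmetric functions in \<open>X\<close> are the case of a one-element node type; the
  indeterminate \<open>t\<close> is \<open>[:0, 1:]\<close>.\<close>

definition loop_HL :: "nat list \<Rightarrow> nat list \<Rightarrow> (unit, int poly) msym" where
  "loop_HL \<mu> \<eta> =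
     foldr (\<lambda>k. Hop [:0, 1:] () () (\<eta> ! k) (replicate (\<eta> ! k) (int (\<mu> ! k)))) [0..<length \<eta>] 1"

definition is_subst :: "nat \<Rightarrow> ((unit, int poly) msym \<Rightarrow> (nat, laurent) msym) \<Rightarrow> bool" where
  "is_subst r \<phi> \<longleftrightarrow>
     \<phi> 1 = 1 \<and> (\<forall>f g. \<phi> (f + g) = \<phi> f + \<phi> g) \<and> (\<forall>f g. \<phi> (f * g) = \<phi> f * \<phi> g) \<and>
     \<phi> (const [:0, 1:]) = const (\<Prod>i<r. tvar i) \<and>
     (\<forall>k\<ge>1. \<phi> (psf () k) = (\<Sum>i<r. const ((\<Prod>j\<in>{i..<r - 1}. tvar j) ^ k) * psf i k))"

text \<open>
  The plethystic substitution \<open>X \<mapsto> Y\<close>, \<open>t \<mapsto> t\<^sub>0\<^sub>,\<^sub>1 \<dots> t\<^sub>r\<^sub>-\<^sub>1\<^sub>,\<^sub>0\<close>. It is unique because, together with \<open>t\<close>,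
  the power sums generate the symmetric functions over the rationals and the target is torsion-free.
\<close>

definition plethysm :: "nat \<Rightarrow> (unit, int poly) msym \<Rightarrow> (nat, laurent) msym" where
  "plethysm r = (THE \<phi>. is_subst r \<phi>)"

end

theory Submission
  imports Defs "Jordan_Normal_Form.Determinant" "HOL-Computational_Algebra.Formal_Power_Series"
begin

text \<open>Put \<open>y\<^sub>i = t\<^sub>i\<^sub>,\<^sub>i\<^sub>+\<^sub>1 \<dots> t\<^sub>r\<^sub>-\<^sub>2\<^sub>,\<^sub>r\<^sub>-\<^sub>1\<close>, so that \<open>Y = \<Sum>\<^sub>i y\<^sub>i X\<^sup>(\<^sup>i\<^sup>)\<close>, and let \<open>s\<^sub>\<nu>[A]\<close> be the Jacobi-Trudi determinant in the
  complete symmetric functions of an alphabet \<open>A\<close>, for an arbitrary integer vector \<open>\<nu>\<close>. The root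
  product and the series \<open>\<Omega>[z\<^sub>k X\<^sup>(\<^sup>i\<^sup>)]\<close> combine to determinants, which gives the operator the form
  \<open>H\<^sub>\<beta> F = \<Sum>\<^sub>\<delta> s\<^sub>\<beta>\<^sub>+\<^sub>\<delta>[X\<^sup>(\<^sup>i\<^sup>)] P\<^sub>\<delta> F\<close> (\<open>Hop_eq\<close>), where the operators \<open>P\<^sub>\<delta>\<close> are the coefficients of the translation
  that subtracts \<open>1/z\<^sub>k\<close> from \<open>X\<^sup>(\<^sup>i\<^sup>)\<close> and adds \<open>t/z\<^sub>k\<close> to \<open>X\<^sup>(\<^sup>i\<^sup>+\<^sup>1\<^sup>)\<close>, for all \<open>k\<close>.

  At the node \<open>r - 1\<close> this translation changes \<open>Y\<close> by \<open>(t\<^sub>0\<^sub>,\<^sub>1 \<dots> t\<^sub>r\<^sub>-\<^sub>1\<^sub>,\<^sub>0 - 1)/z\<close>, exactly as the loop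
  changes \<open>X\<close>; at every other node it leaves \<open>Y\<close> unchanged, because \<open>y\<^sub>i = t\<^sub>i\<^sub>,\<^sub>i\<^sub>+\<^sub>1 y\<^sub>i\<^sub>+\<^sub>1\<close>. In one pass,
  the operator of the node \<open>r - 1\<close>, which acts first, therefore turns \<open>f[Y]\<close> into
  \<open>\<Sum>\<^sub>\<delta> s\<^sub>\<mu>\<^sub>+\<^sub>\<delta>[X\<^sup>(\<^sup>r\<^sup>-\<^sup>1\<^sup>)] (L\<^sub>\<delta> f)[Y]\<close>, where \<open>L\<^sub>\<delta>\<close> belongs to the loop. The operators of weight \<open>0\<close> at the nodes
  \<open>i = r - 2, \<dots>, 0\<close> act on the determinants only, and enlarge their alphabet from
  \<open>\<Sum>\<^sub>j\<^sub>>\<^sub>i y\<^sub>j X\<^sup>(\<^sup>j\<^sup>)\<close> to \<open>\<Sum>\<^sub>j\<^sub>\<ge>\<^sub>i y\<^sub>j X\<^sup>(\<^sup>j\<^sup>)\<close> (\<open>Hop_schur\<close>). At the end the alphabet is \<open>Y\<close>, and the result is the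
  substitution \<open>X \<mapsto> Y\<close> in the image of \<open>f\<close> under the loop operator (\<open>quiver_pass\<close>). The theorem follows
  by induction on the number of passes.

  The enlargement of the alphabet is the Cauchy identity (\<open>schur_cauchy\<close>): the sum over \<open>\<delta>\<close> of
  \<open>s\<^sub>\<delta>[A]\<close> times the coefficient of \<open>u\<^sup>\<delta>\<close> in \<open>s\<^sub>\<nu>[B + u\<^sub>1 + \<dots> + u\<^sub>a]\<close> is \<open>s\<^sub>\<nu>[A + B]\<close>. It comes from the
  bialternant formula for determinants of complete symmetric polynomials in \<open>a\<close> variables and
  holds for every integer vector \<open>\<nu>\<close>.

  The Hall inner product, the adjoints and the substitution are given by unique descriptions.
  The inner product exists and is unique because the complete symmetric functions generate and
  their Gram matrix is symmetric (\<open>hspan_all\<close>, \<open>gram_symmetric\<close>); the adjoints of \<open>h\<^sub>n\<close> and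
  \<open>(-1)\<^sup>n e\<^sub>n\<close> are the coefficients of \<open>F[X + u]\<close> and \<open>F[X - u]\<close>. The substitution exists because
  \<open>f[Y]\<close> is the value of \<open>f\<close> at the variables of all nodes, scaled and listed in one sequence, and
  it is unique by Newton's identities.\<close>

abbreviation lookup where "lookup \<equiv> Poly_Mapping.lookup"
abbreviation keys where "keys \<equiv> Poly_Mapping.keys"
abbreviation single where "single \<equiv> Poly_Mapping.single"
abbreviation map_key where "map_key \<equiv> Poly_Mapping.map_key"

section \<open>Sums over all arguments\<close>

text \<open>A sum over all arguments is \<open>0\<close> by convention when its support is infinite. Hence every exchange
  of summations below needs a finiteness condition.\<close>

lemma Sum_any_sum:
  fixes g :: "'i \<Rightarrow> 'b \<Rightarrow> 'c::comm_monoid_add"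
  assumes "finite I" and "\<And>i. i \<in> I \<Longrightarrow> finite {x. g i x \<noteq> 0}"
  shows "Sum_any (\<lambda>x. \<Sum>i\<in>I. g i x) = (\<Sum>i\<in>I. Sum_any (g i))"
proof -
  let ?S = "\<Union>i\<in>I. {x. g i x \<noteq> 0}"
  have fin: "finite ?S" using assms by blast
  have "Sum_any (\<lambda>x. \<Sum>i\<in>I. g i x) = (\<Sum>x\<in>?S. \<Sum>i\<in>I. g i x)"
    by (rule Sum_any.expand_superset[OF fin]) (auto elim: sum.not_neutral_contains_not_neutral)
  also have "\<dots> = (\<Sum>i\<in>I. \<Sum>x\<in>?S. g i x)" by (rule sum.swap)
  also have "\<dots> = (\<Sum>i\<in>I. Sum_any (g i))"
    by (intro sum.cong refl Sum_any.expand_superset[OF fin, symmetric]) auto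
  finally show ?thesis .
qed

lemma Sum_any_reindex: "bij l \<Longrightarrow> Sum_any (\<lambda>x. g (l x)) = Sum_any g"
  by (rule sym, rule Sum_any.reindex_cong) (auto simp: comp_def)

lemma Sum_any_shift: "Sum_any (\<lambda>x. g (x + c)) = Sum_any g" for c :: "'b::group_add"
  by (rule Sum_any_reindex[of "\<lambda>x. x + c"])
    (rule o_bij[of "\<lambda>x. x - c"]; auto simp: fun_eq_iff)

lemma finite_support_mult: "finite {x. f x \<noteq> 0} \<Longrightarrow> finite {x. c x * f x \<noteq> 0}"
  for f :: "'b \<Rightarrow> 'c::mult_zero"
  by (rule rev_finite_subset) auto

section \<open>Laurent polynomials and their monomials\<close>

type_synonym expo = "nat \<Rightarrow>\<^sub>0 int"

definition lmon :: "expo \<Rightarrow> laurent" where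
  "lmon \<gamma> = single \<gamma> 1"

definition expo_of :: "nat \<Rightarrow> (nat \<Rightarrow> int) \<Rightarrow> expo" where
  "expo_of a e = (\<Sum>i<a. single i (e i))"

lemma lookup_expo_of: "lookup (expo_of a e) k = (if k < a then e k else 0)"
  by (simp add: expo_of_def lookup_sum lookup_single when_def)

lemma keys_expo_of: "keys (expo_of a e) \<subseteq> {..<a}"
  by (auto simp: in_keys_iff lookup_expo_of split: if_splits)

lemma lmon_add: "lmon (\<gamma> + \<kappa>) = lmon \<gamma> * lmon \<kappa>"
  by (simp add: lmon_def mult_single)

lemma lmon_0 [simp]: "lmon 0 = 1"
  by (simp add: lmon_def)

lemma lmon_sum: "lmon (\<Sum>i\<in>I. g i) = (\<Prod>i\<in>I. lmon (g i))"
  by (induction I rule: infinite_finite_induct) (auto simp: lmon_add)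

lemma lmon_single_power: "lmon (single k e) ^ n = lmon (single k (int n * e))"
  by (induction n) (simp_all add: lmon_add[symmetric] single_add[symmetric] algebra_simps)

text \<open>The additive functional with \<open>w\<^sup>\<gamma> \<mapsto> u \<gamma>\<close>. It lets multiplication of Laurent polynomials do the
  bookkeeping for sums over shifted indices.\<close>

definition lin_ext :: "(expo \<Rightarrow> 'r) \<Rightarrow> laurent \<Rightarrow> 'r::comm_ring_1" where
  "lin_ext u f = (\<Sum>\<gamma>\<in>keys f. of_int (lookup f \<gamma>) * u \<gamma>)"

lemma lin_ext_superset:
  assumes "finite S" "keys f \<subseteq> S"
  shows "lin_ext u f = (\<Sum>\<gamma>\<in>S. of_int (lookup f \<gamma>) * u \<gamma>)"
  unfolding lin_ext_def by (rule sum.mono_neutral_left) (use assms in \<open>auto simp: in_keys_iff\<close>)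

lemma lin_ext_add: "lin_ext u (f + g) = lin_ext u f + lin_ext u g"
proof -
  let ?S = "keys f \<union> keys g"
  have "keys (f + g) \<subseteq> ?S" by (rule keys_add)
  then show ?thesis
    by (subst (1 2 3) lin_ext_superset[of ?S])
      (auto simp: lookup_add algebra_simps sum.distrib)
qed

lemma lin_ext_0 [simp]: "lin_ext u 0 = 0"
  by (simp add: lin_ext_def)

lemma lin_ext_sum: "lin_ext u (\<Sum>i\<in>I. g i) = (\<Sum>i\<in>I. lin_ext u (g i))"
  by (induction I rule: infinite_finite_induct) (auto simp: lin_ext_add)

lemma lin_ext_single: "lin_ext u (single \<gamma> c) = of_int c * u \<gamma>"
  by (simp add: lin_ext_def)

lemma lin_ext_uminus: "lin_ext u (- f) = - lin_ext u f"
  using lin_ext_add[of u f "- f"] by (simp add: add_eq_0_iff)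

lemma lin_ext_lmon [simp]: "lin_ext u (lmon \<gamma>) = u \<gamma>"
  by (simp add: lmon_def lin_ext_single)

lemma laurent_expand: "f = (\<Sum>\<gamma>\<in>keys f. single \<gamma> (lookup f \<gamma>))"
  for f :: laurent
  by (rule poly_mapping_eqI) (auto simp: lookup_sum lookup_single when_def in_keys_iff)

lemma lin_ext_mult: "lin_ext u (f * g) = lin_ext (\<lambda>\<gamma>. lin_ext (\<lambda>\<kappa>. u (\<gamma> + \<kappa>)) g) f"
proof -
  have "f * g = (\<Sum>\<gamma>\<in>keys f. \<Sum>\<kappa>\<in>keys g.
      single (\<gamma> + \<kappa>) (lookup f \<gamma> * lookup g \<kappa>))"
    by (subst (1) laurent_expand[of f], subst (1) laurent_expand[of g])
      (simp add: sum_product mult_single)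
  then have "lin_ext u (f * g) = (\<Sum>\<gamma>\<in>keys f. \<Sum>\<kappa>\<in>keys g.
      of_int (lookup f \<gamma> * lookup g \<kappa>) * u (\<gamma> + \<kappa>))"
    by (simp add: lin_ext_sum lin_ext_single)
  then show ?thesis
    by (simp add: lin_ext_def sum_distrib_left mult.assoc)
qed

lemma lin_ext_mult_lmon: "lin_ext u (f * lmon \<kappa>) = lin_ext (\<lambda>\<gamma>. u (\<gamma> + \<kappa>)) f"
  by (simp add: lin_ext_mult)

lemma lin_ext_times: "lin_ext u f * x = lin_ext (\<lambda>\<gamma>. u \<gamma> * x) f" "x * lin_ext u f = lin_ext (\<lambda>\<gamma>. x * u \<gamma>) f"
  by (simp_all add: lin_ext_def sum_distrib_left sum_distrib_right mult_ac)

lemma finite_support_lin_ext: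
  assumes "\<And>\<gamma>. finite {x. g \<gamma> x \<noteq> 0}"
  shows "finite {x. lin_ext (\<lambda>\<gamma>. g \<gamma> x) f \<noteq> 0}"
proof (rule finite_subset)
  show "finite (\<Union>\<gamma>\<in>keys f. {x. g \<gamma> x \<noteq> 0})" using assms by simp
  show "{x. lin_ext (\<lambda>\<gamma>. g \<gamma> x) f \<noteq> 0} \<subseteq> (\<Union>\<gamma>\<in>keys f. {x. g \<gamma> x \<noteq> 0})"
    by (auto simp: lin_ext_def elim!: sum.not_neutral_contains_not_neutral)
qed

lemma Sum_any_lin_ext:
  assumes "\<And>\<gamma>. finite {x. g \<gamma> x \<noteq> 0}"
  shows "Sum_any (\<lambda>x. lin_ext (\<lambda>\<gamma>. g \<gamma> x) f) = lin_ext (\<lambda>\<gamma>. Sum_any (g \<gamma>)) f"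
  unfolding lin_ext_def
  by (subst Sum_any_sum) (auto simp: Sum_any_right_distrib[OF assms] intro: finite_support_mult assms)

lemma lin_ext_signof: "lin_ext u (signof p * f) = signof p * lin_ext u f"
  by (simp add: sign_def lin_ext_uminus)

lemma lin_ext_one [simp]: "lin_ext u 1 = u 0"
  using lin_ext_lmon[of u 0] by simp

section \<open>The Vandermonde determinant\<close>

lemma prod_list_diag_mat: "A \<in> carrier_mat n n \<Longrightarrow> prod_list (diag_mat A) = (\<Prod>i<n. A $$ (i, i))"
  by (simp add: diag_mat_def prod.list_conv_set_nth atLeast0LessThan)

lemma det_mat_expand:
  "det (mat n n (\<lambda>(i, j). f i j)) = (\<Sum>\<tau> | \<tau> permutes {0..<n}. signof \<tau> * (\<Prod>i<n. f i (\<tau> i)))"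
proof -
  have "(\<Prod>i = 0..<n. mat n n (\<lambda>(i, j). f i j) $$ (i, \<tau> i)) = (\<Prod>i<n. f i (\<tau> i))"
    if "\<tau> permutes {0..<n}" for \<tau>
    using permutes_in_image[OF that] by (auto simp: atLeast0LessThan intro!: prod.cong)
  then show ?thesis by (simp add: det_def'[of _ n])
qed

text \<open>The coefficients of the Newton polynomials \<open>\<Prod>\<^sub>m\<^sub><\<^sub>j (X - x\<^sub>m)\<close> form a unitriangular matrix, and
  multiplication by it makes the matrix of powers lower triangular.\<close>

lemma det_vandermonde:
  fixes x :: "nat \<Rightarrow> 'r::comm_ring_1"
  shows "det (mat n n (\<lambda>(i, j). x i ^ j)) = (\<Prod>j<n. \<Prod>i<j. x j - x i)"
proof -
  define N where "N j = (\<Prod>m<j. [:- x m, 1:])" for j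
  have N: "Polynomial.degree (N j) \<le> j \<and> Polynomial.coeff (N j) j = 1" for j
  proof (induction j)
    case (Suc j)
    have S: "N (Suc j) = pCons 0 (N j) - Polynomial.smult (x j) (N j)"
      by (simp add: N_def algebra_simps)
    show ?case unfolding S using Suc
      by (auto intro!: degree_diff_le degree_smult_le[THEN order_trans] degree_pCons_le[THEN order_trans]
          simp: coeff_eq_0)
  qed (simp add: N_def)
  let ?V = "mat n n (\<lambda>(i, j). x i ^ j)"
  let ?U = "mat n n (\<lambda>(k, j). Polynomial.coeff (N j) k)"
  let ?L = "mat n n (\<lambda>(i, j). \<Prod>m<j. x i - x m)"
  have "?V * ?U = ?L"
  proof (rule eq_matI)
    fix i j assume ij: "i < dim_row ?L" "j < dim_col ?L"
    have "(?V * ?U) $$ (i, j) = (\<Sum>k<n. x i ^ k * Polynomial.coeff (N j) k)"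
      using ij by (simp add: scalar_prod_def atLeast0LessThan)
    also have "\<dots> = poly (N j) (x i)"
      using N[of j] ij
      by (subst poly_altdef, subst mult.commute)
        (auto intro!: sum.mono_neutral_right intro: le_degree)
    also have "\<dots> = ?L $$ (i, j)"
      using ij by (simp add: N_def poly_prod)
    finally show "(?V * ?U) $$ (i, j) = ?L $$ (i, j)" .
  qed auto
  then have "det ?V * det ?U = det ?L"
    by (metis det_mult mat_carrier)
  moreover have "det ?U = 1"
    using N by (subst det_upper_triangular[of _ n])
      (auto simp: upper_triangular_def prod_list_diag_mat[of _ n] intro!: coeff_eq_0 intro: le_less_trans)
  moreover have "det ?L = (\<Prod>j<n. \<Prod>i<j. x j - x i)"
    by (subst det_lower_triangular[of n]) (auto simp: prod_list_diag_mat[of _ n] intro!: prod.cong prod_zero)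
  ultimately show ?thesis by simp
qed

section \<open>The root product\<close>

abbreviation wvar :: "nat \<Rightarrow> laurent" where
  "wvar k \<equiv> lmon (single k 1)"

abbreviation wvar_inv :: "nat \<Rightarrow> laurent" where
  "wvar_inv k \<equiv> lmon (single k (-1))"

lemma wvar_inv [simp]: "wvar k * wvar_inv k = 1"
  by (simp add: lmon_add[symmetric] single_add[symmetric])

lemma root_prod_alt: "root_prod a = (\<Prod>l<a. \<Prod>k<l. 1 - wvar l * wvar_inv k)"
proof -
  have "root_prod a = (\<Prod>(l, k)\<in>Sigma {..<a} (\<lambda>l. {..<l}). 1 - wvar l * wvar_inv k)"
    unfolding root_prod_def
    by (rule prod.reindex_bij_witness[of _ prod.swap prod.swap])
      (auto simp: lmon_def mult_single single_uminus)
  then show ?thesis by (simp add: prod.Sigma)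
qed

lemma det_wvar_powers:
  "det (mat a a (\<lambda>(i, j). wvar i ^ j)) = (\<Prod>l<a. \<Prod>k<l. - wvar k) * root_prod a"
  unfolding root_prod_alt det_vandermonde prod.distrib[symmetric]
  by (intro prod.cong refl) (simp add: algebra_simps mult.assoc[symmetric])

text \<open>Since \<open>1 - w\<^sub>l/w\<^sub>k = w\<^sub>l (1/w\<^sub>l - 1/w\<^sub>k)\<close>, this is the Vandermonde determinant of the inverse
  variables, times a monomial.\<close>

lemma root_prod_expand:
  "root_prod a = (\<Sum>\<tau> | \<tau> permutes {0..<a}. signof \<tau> * lmon (expo_of a (\<lambda>i. int i - int (\<tau> i))))"
proof -
  have "root_prod a = (\<Prod>l<a. wvar l ^ l * (\<Prod>k<l. wvar_inv l - wvar_inv k))"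
    unfolding root_prod_alt
  proof (intro prod.cong refl)
    fix l
    have "(\<Prod>k<l. 1 - wvar l * wvar_inv k) = (\<Prod>k<l. wvar l * (wvar_inv l - wvar_inv k))"
      by (simp add: right_diff_distrib)
    then show "(\<Prod>k<l. 1 - wvar l * wvar_inv k) = wvar l ^ l * (\<Prod>k<l. wvar_inv l - wvar_inv k)"
      by (simp add: prod.distrib)
  qed
  also have "\<dots> = (\<Prod>l<a. wvar l ^ l) * det (mat a a (\<lambda>(i, j). wvar_inv i ^ j))"
    by (simp add: prod.distrib det_vandermonde)
  also have "\<dots> = (\<Sum>\<tau> | \<tau> permutes {0..<a}. signof \<tau> *
      ((\<Prod>l<a. wvar l ^ l) * (\<Prod>i<a. wvar_inv i ^ \<tau> i)))"
    by (simp add: det_mat_expand sum_distrib_left mult.left_commute)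
  also have "\<dots> = (\<Sum>\<tau> | \<tau> permutes {0..<a}. signof \<tau> * lmon (expo_of a (\<lambda>i. int i - int (\<tau> i))))"
    by (intro sum.cong refl arg_cong2[where f = "(*)"])
      (simp add: expo_of_def lmon_sum lmon_single_power lmon_add[symmetric]
        single_add[symmetric] flip: prod.distrib)
  finally show ?thesis .
qed

section \<open>Monomials in the entries of a sequence\<close>

definition int_nth :: "(nat \<Rightarrow> 'r::zero) \<Rightarrow> int \<Rightarrow> 'r" where
  "int_nth q n = (if n < 0 then 0 else q (nat n))"

definition seq_mon :: "nat \<Rightarrow> (nat \<Rightarrow> 'r) \<Rightarrow> expo \<Rightarrow> 'r::comm_ring_1" where
  "seq_mon a q \<kappa> = (if keys \<kappa> \<subseteq> {..<a} then \<Prod>k<a. int_nth q (lookup \<kappa> k) else 0)"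

definition seq_conv :: "(nat \<Rightarrow> 'r) \<Rightarrow> (nat \<Rightarrow> 'r) \<Rightarrow> nat \<Rightarrow> 'r::comm_ring_1" where
  "seq_conv p q n = (\<Sum>k\<le>n. p k * q (n - k))"

lemma seq_mon_nonzeroD:
  assumes "seq_mon a q \<kappa> \<noteq> 0"
  shows "keys \<kappa> \<subseteq> {..<a}" and "0 \<le> lookup \<kappa> k"
proof -
  show *: "keys \<kappa> \<subseteq> {..<a}" using assms by (auto simp: seq_mon_def split: if_splits)
  show "0 \<le> lookup \<kappa> k"
  proof (cases "k < a")
    case True
    then have "int_nth q (lookup \<kappa> k) \<noteq> 0"
      using assms * by (auto simp: seq_mon_def intro: prod_zero)
    then show ?thesis by (auto simp: int_nth_def split: if_splits)
  next
    case False
    then have "k \<notin> keys \<kappa>" using * by auto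
    then show ?thesis by (simp add: in_keys_iff)
  qed
qed

lemma finite_expo_box:
  "finite {\<kappa> :: expo. keys \<kappa> \<subseteq> {..<a} \<and>
    (\<forall>k. 0 \<le> lookup \<kappa> k \<and> lookup \<kappa> k \<le> m k)}" (is "finite ?S")
proof (rule finite_subset)
  show "?S \<subseteq> expo_of a ` PiE {..<a} (\<lambda>k. {0..m k})"
  proof
    fix \<kappa> assume \<kappa>: "\<kappa> \<in> ?S"
    then have "\<kappa> = expo_of a (restrict (lookup \<kappa>) {..<a})"
      by (intro poly_mapping_eqI) (auto simp: lookup_expo_of in_keys_iff)
    then show "\<kappa> \<in> expo_of a ` PiE {..<a} (\<lambda>k. {0..m k})"
      by (rule image_eqI[where f = "expo_of a"]) (use \<kappa> in auto)
  qed
qed (intro finite_imageI finite_PiE, auto)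

lemma finite_support_seq_mon: "finite {\<kappa>. seq_mon a p \<kappa> * seq_mon a q (\<mu> - \<kappa>) \<noteq> 0}"
proof (rule finite_subset[OF _ finite_expo_box[of a "lookup \<mu>"]], rule subsetI, clarify)
  fix \<kappa> assume "seq_mon a p \<kappa> * seq_mon a q (\<mu> - \<kappa>) \<noteq> 0"
  then have "seq_mon a p \<kappa> \<noteq> 0" "seq_mon a q (\<mu> - \<kappa>) \<noteq> 0" by auto
  from seq_mon_nonzeroD[OF this(1)] seq_mon_nonzeroD[OF this(2)]
  show "keys \<kappa> \<subseteq> {..<a} \<and>
      (\<forall>k. 0 \<le> lookup \<kappa> k \<and> lookup \<kappa> k \<le> lookup \<mu> k)"
    by (auto simp: lookup_minus)
qed

lemma int_nth_seq_conv: "int_nth (seq_conv p q) m = (\<Sum>n\<in>{0..m}. int_nth p n * int_nth q (m - n))"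
proof (cases "m < 0")
  case False
  have "(\<Sum>n\<in>{0..m}. int_nth p n * int_nth q (m - n)) = (\<Sum>k\<le>nat m. p k * q (nat m - k))"
    by (rule sum.reindex_bij_witness[of _ int nat])
      (use False in \<open>auto simp: int_nth_def nat_diff_distrib\<close>)
  with False show ?thesis by (simp add: int_nth_def seq_conv_def)
qed (simp add: int_nth_def)

text \<open>The product of \<open>a\<close> Cauchy products, expanded into a single sum over exponent vectors.\<close>

lemma seq_mon_conv: "seq_mon a (seq_conv p q) \<mu> = Sum_any (\<lambda>\<kappa>. seq_mon a p \<kappa> * seq_mon a q (\<mu> - \<kappa>))"
proof (cases "keys \<mu> \<subseteq> {..<a}")
  case False
  then have "\<not> keys (\<mu> - \<kappa>) \<subseteq> {..<a}" if "keys \<kappa> \<subseteq> {..<a}" for \<kappa>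
    using that keys_add[of "\<mu> - \<kappa>" \<kappa>] by auto
  then have "seq_mon a p \<kappa> * seq_mon a q (\<mu> - \<kappa>) = 0" for \<kappa>
    by (auto simp: seq_mon_def)
  with False show ?thesis by (simp add: seq_mon_def)
next
  case True
  let ?B = "PiE {..<a} (\<lambda>k. {0..lookup \<mu> k})"
  let ?f = "\<lambda>\<kappa>. seq_mon a p \<kappa> * seq_mon a q (\<mu> - \<kappa>)"
  have inj: "inj_on (expo_of a) ?B"
  proof (rule inj_onI)
    fix g h assume gh: "g \<in> ?B" "h \<in> ?B" "expo_of a g = expo_of a h"
    show "g = h"
    proof (rule PiE_ext[OF gh(1,2)])
      fix k assume "k \<in> {..<a}"
      then show "g k = h k"
        using arg_cong[OF gh(3), of "\<lambda>x. lookup x k"] by (simp add: lookup_expo_of)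
    qed
  qed
  have "seq_mon a (seq_conv p q) \<mu> = (\<Sum>g\<in>?B. \<Prod>k<a. int_nth p (g k) * int_nth q (lookup \<mu> k - g k))"
    using True by (simp add: seq_mon_def int_nth_seq_conv prod_sum_PiE)
  also have "\<dots> = (\<Sum>g\<in>?B. ?f (expo_of a g))"
  proof (intro sum.cong refl)
    fix g
    have "keys (\<mu> - expo_of a g) \<subseteq> {..<a}"
      using True keys_expo_of[of a g] keys_diff[of \<mu> "expo_of a g"] by blast
    then show "(\<Prod>k<a. int_nth p (g k) * int_nth q (lookup \<mu> k - g k)) = ?f (expo_of a g)"
      using keys_expo_of[of a g] by (simp add: seq_mon_def lookup_expo_of lookup_minus prod.distrib)
  qed
  also have "\<dots> = (\<Sum>\<kappa>\<in>expo_of a ` ?B. ?f \<kappa>)"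
    by (simp add: sum.reindex[OF inj])
  also have "\<dots> = Sum_any ?f"
  proof (rule Sum_any.expand_superset[symmetric])
    show "finite (expo_of a ` ?B)" by (intro finite_imageI finite_PiE) auto
    show "{\<kappa>. ?f \<kappa> \<noteq> 0} \<subseteq> expo_of a ` ?B"
    proof
      fix \<kappa> assume "\<kappa> \<in> {\<kappa>. ?f \<kappa> \<noteq> 0}"
      then have nz: "seq_mon a p \<kappa> \<noteq> 0" "seq_mon a q (\<mu> - \<kappa>) \<noteq> 0" by auto
      have "\<kappa> = expo_of a (restrict (lookup \<kappa>) {..<a})"
        using seq_mon_nonzeroD(1)[OF nz(1)]
        by (intro poly_mapping_eqI) (auto simp: lookup_expo_of in_keys_iff)
      then show "\<kappa> \<in> expo_of a ` ?B"
        by (rule image_eqI[where f = "expo_of a"]) (use seq_mon_nonzeroD(2)[OF nz(1)] seq_mon_nonzeroD(2)[OF nz(2)] in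
            \<open>auto simp: lookup_minus\<close>)
    qed
  qed
  finally show ?thesis .
qed

section \<open>Jacobi-Trudi determinants\<close>

text \<open>The Jacobi-Trudi determinant \<open>det (q\<^bsub>\<nu>\<^sub>i - i + j\<^esub>)\<close>, written as the raising operators of the root product
  applied to the monomial \<open>q\<^sub>\<nu>\<close>. For \<open>q\<^sub>n = h\<^sub>n\<close> and a partition \<open>\<nu>\<close> it is the Schur function \<open>s\<^sub>\<nu>\<close>.\<close>

definition schur :: "nat \<Rightarrow> (nat \<Rightarrow> 'r) \<Rightarrow> expo \<Rightarrow> 'r::comm_ring_1" where
  "schur a q \<nu> = lin_ext (\<lambda>\<gamma>. seq_mon a q (\<nu> - \<gamma>)) (root_prod a)"

lemma lin_ext_root_prod:
  "lin_ext u (root_prod a) =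
    (\<Sum>\<tau> | \<tau> permutes {0..<a}. signof \<tau> * u (expo_of a (\<lambda>i. int i - int (\<tau> i))))"
  by (simp add: root_prod_expand lin_ext_sum lin_ext_signof)

lemma keys_add_subset: "keys f \<subseteq> A \<Longrightarrow> keys g \<subseteq> A \<Longrightarrow> keys (f + g) \<subseteq> A"
  using keys_add[of f g] by blast

lemma lin_ext_root_prod_det:
  assumes "keys \<kappa> \<subseteq> {..<a}"
  shows "lin_ext (\<lambda>\<gamma>. seq_mon a q (\<kappa> + \<gamma>)) (root_prod a) =
    det (mat a a (\<lambda>(k, l). int_nth q (lookup \<kappa> k + int k - int l)))"
proof -
  have "seq_mon a q (\<kappa> + expo_of a e) = (\<Prod>k<a. int_nth q (lookup \<kappa> k + e k))" for e
    using keys_add_subset[OF assms keys_expo_of[of a e]]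
    by (simp add: seq_mon_def lookup_add lookup_expo_of)
  then show ?thesis
    by (simp add: det_mat_expand lin_ext_root_prod add_diff_eq)
qed

section \<open>Complete homogeneous symmetric polynomials\<close>

definition geom_fps :: "'r \<Rightarrow> 'r::comm_ring_1 fps" where
  "geom_fps x = Abs_fps (\<lambda>n. x ^ n)"

definition complete_fps :: "nat \<Rightarrow> laurent fps" where
  "complete_fps a = (\<Prod>k<a. geom_fps (wvar k))"

definition complete_sym :: "nat \<Rightarrow> nat \<Rightarrow> laurent" where
  "complete_sym a n = fps_nth (complete_fps a) n"

lemma complete_sym_0: "complete_sym a 0 = 1"
  by (induction a) (simp_all add: complete_sym_def complete_fps_def geom_fps_def)

lemma geom_fps_inverse: "geom_fps x * (1 - fps_const x * fps_X) = 1"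
proof (rule fps_ext)
  fix n
  have "geom_fps x * (1 - fps_const x * fps_X) = geom_fps x - fps_const x * (geom_fps x * fps_X)"
    by (simp add: algebra_simps)
  then show "fps_nth (geom_fps x * (1 - fps_const x * fps_X)) n = fps_nth 1 n"
    by (cases n) (simp_all add: geom_fps_def)
qed

lemma linear_prod_nth_eq_0:
  fixes x :: "'k \<Rightarrow> 'r::comm_ring_1"
  shows "finite K \<Longrightarrow> card K < l \<Longrightarrow> fps_nth (\<Prod>k\<in>K. 1 - fps_const (x k) * fps_X) l = 0"
proof (induction K arbitrary: l rule: finite_induct)
  case (insert k K)
  let ?G = "\<Prod>k\<in>K. 1 - fps_const (x k) * fps_X"
  have *: "(\<Prod>k\<in>insert k K. 1 - fps_const (x k) * fps_X) = ?G - fps_const (x k) * (fps_X * ?G)"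
    using insert.hyps by (simp add: algebra_simps)
  obtain l' where "l = Suc l'" using insert.prems by (cases l) auto
  then show ?case unfolding * using insert by simp
qed auto

text \<open>Multiplying \<open>\<Prod>\<^sub>k 1/(1 - w\<^sub>k x)\<close> by all factors \<open>1 - w\<^sub>k x\<close> with \<open>k \<noteq> i\<close> leaves a geometric series, so
  the coefficients of these numerators turn complete symmetric polynomials into powers.\<close>

lemma complete_numerator:
  assumes "i < a"
  defines "g \<equiv> \<lambda>l. fps_nth (\<Prod>k\<in>{..<a} - {i}. 1 - fps_const (wvar k) * fps_X) l"
  shows "(\<Sum>l<a. int_nth (complete_sym a) (int m - int l) * g l) = wvar i ^ m"
proof -
  let ?G = "\<Prod>k\<in>{..<a} - {i}. 1 - fps_const (wvar k) * fps_X"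
  have "complete_fps a = geom_fps (wvar i) * (\<Prod>k\<in>{..<a} - {i}. geom_fps (wvar k))"
    unfolding complete_fps_def using assms(1) by (subst prod.remove[of _ i]) auto
  then have "complete_fps a * ?G =
      geom_fps (wvar i) * (\<Prod>k\<in>{..<a} - {i}. geom_fps (wvar k) * (1 - fps_const (wvar k) * fps_X))"
    by (simp add: prod.distrib mult.assoc)
  then have "complete_fps a * ?G = geom_fps (wvar i)"
    by (simp add: geom_fps_inverse)
  then have "wvar i ^ m = fps_nth (?G * complete_fps a) m"
    by (simp add: geom_fps_def mult.commute)
  also have "\<dots> = (\<Sum>l=0..m. g l * complete_sym a (m - l))"
    by (simp add: fps_mult_nth g_def complete_sym_def)
  also have "\<dots> = (\<Sum>l\<in>{..<a} \<inter> {..m}. int_nth (complete_sym a) (int m - int l) * g l)"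
  proof (rule sum.mono_neutral_cong_right)
    show "\<forall>l\<in>{0..m} - {..<a} \<inter> {..m}. g l * complete_sym a (m - l) = 0"
    proof
      fix l assume "l \<in> {0..m} - {..<a} \<inter> {..m}"
      then have "card ({..<a} - {i}) < l" using assms(1) by auto
      then have "g l = 0" unfolding g_def by (intro linear_prod_nth_eq_0) auto
      then show "g l * complete_sym a (m - l) = 0" by simp
    qed
  qed (auto simp: int_nth_def nat_diff_distrib)
  also have "\<dots> = (\<Sum>l<a. int_nth (complete_sym a) (int m - int l) * g l)"
    by (rule sum.mono_neutral_left) (auto simp: int_nth_def)
  finally show ?thesis by simp
qed

text \<open>The bialternant formula. The coefficients of the numerators form a matrix whose product with the
  matrix of complete symmetric polynomials is the matrix of powers. For \<open>e = 0\<close> the complete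
  symmetric polynomials form a unitriangular matrix, which identifies the determinant of the
  coefficient matrix with the Vandermonde determinant.\<close>

lemma det_complete:
  fixes e :: "nat \<Rightarrow> nat"
  shows "det (mat a a (\<lambda>(k, l). int_nth (complete_sym a) (int (e k) + int k - int l))) *
      det (mat a a (\<lambda>(k, i). wvar i ^ k)) = det (mat a a (\<lambda>(k, i). wvar i ^ (e k + k)))"
proof -
  let ?E = "mat a a (\<lambda>(l, i). fps_nth (\<Prod>k\<in>{..<a} - {i}. 1 - fps_const (wvar k) * fps_X) l)"
  let ?H = "\<lambda>e. mat a a (\<lambda>(k, l). int_nth (complete_sym a) (int (e k) + int k - int l))"
  have HE: "?H e * ?E = mat a a (\<lambda>(k, i). wvar i ^ (e k + k))" for e :: "nat \<Rightarrow> nat"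
  proof (rule eq_matI)
    fix k i assume "k < dim_row (mat a a (\<lambda>(k, i). wvar i ^ (e k + k)))"
      "i < dim_col (mat a a (\<lambda>(k, i). wvar i ^ (e k + k)))"
    then show "(?H e * ?E) $$ (k, i) = mat a a (\<lambda>(k, i). wvar i ^ (e k + k)) $$ (k, i)"
      using complete_numerator[of i a "e k + k"] by (simp add: scalar_prod_def atLeast0LessThan)
  qed auto
  have *: "det (?H e) * det ?E = det (mat a a (\<lambda>(k, i). wvar i ^ (e k + k)))" for e :: "nat \<Rightarrow> nat"
    unfolding HE[symmetric] by (rule det_mult[symmetric]) (rule mat_carrier)+
  have "det (?H (\<lambda>_. 0)) = 1"
    by (subst det_lower_triangular[of a])
      (auto simp: prod_list_diag_mat[of _ a] int_nth_def complete_sym_0)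
  with *[of "\<lambda>_. 0"] have "det ?E = det (mat a a (\<lambda>(k, i). wvar i ^ k))" by simp
  with *[of e] show ?thesis by simp
qed

section \<open>The Cauchy identity\<close>

lemma lin_ext_of_int_mult: "lin_ext u (of_int n * f) = of_int n * lin_ext u f"
  by (simp add: lin_ext_mult lin_ext_single flip: single_of_int)

lemma lin_ext_compose: "lin_ext u (f * lin_ext v g) = lin_ext (\<lambda>\<gamma>. lin_ext u (f * v \<gamma>)) g"
  by (simp add: lin_ext_def[of v] lin_ext_def[of "\<lambda>\<gamma>. lin_ext u (f * v \<gamma>)"] sum_distrib_left
      lin_ext_sum mult.left_commute[of f] lin_ext_of_int_mult)

text \<open>The signed monomial by which the root product differs from the Vandermonde determinant.\<close>

definition staircase :: "nat \<Rightarrow> laurent" where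
  "staircase a = (\<Prod>l<a. \<Prod>k<l. - wvar_inv k)"

lemma root_prod_staircase: "root_prod a = staircase a * det (mat a a (\<lambda>(k, i). wvar i ^ k))"
proof -
  have "mat a a (\<lambda>(k, i). wvar i ^ k) = transpose_mat (mat a a (\<lambda>(i, j). wvar i ^ j))"
    by (intro eq_matI) auto
  then have "det (mat a a (\<lambda>(k, i). wvar i ^ k)) = (\<Prod>l<a. \<Prod>k<l. - wvar k) * root_prod a"
    by (simp add: det_transpose[of _ a] det_wvar_powers)
  moreover have "staircase a * (\<Prod>l<a. \<Prod>k<l. - wvar k) = 1"
    by (simp add: staircase_def mult.commute flip: prod.distrib)
  ultimately show ?thesis by (simp flip: mult.assoc)
qed

text \<open>The bialternant formula with the Vandermonde denominator replaced by the root product, as an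
  identity of Laurent polynomials.\<close>

lemma root_prod_complete:
  assumes "keys \<kappa> \<subseteq> {..<a}" and "\<And>k. 0 \<le> lookup \<kappa> k"
  shows "root_prod a * lin_ext (\<lambda>\<gamma>. seq_mon a (complete_sym a) (\<kappa> + \<gamma>)) (root_prod a) =
    (\<Sum>\<sigma> | \<sigma> permutes {0..<a}. signof \<sigma> * (staircase a * (\<Prod>k<a. wvar (\<sigma> k) ^ k) *
      (\<Prod>k<a. lmon (single (\<sigma> k) (lookup \<kappa> k)))))"
proof -
  let ?e = "\<lambda>k. nat (lookup \<kappa> k)"
  have e: "lookup \<kappa> k = int (?e k)" for k using assms(2) by simp
  have "root_prod a * lin_ext (\<lambda>\<gamma>. seq_mon a (complete_sym a) (\<kappa> + \<gamma>)) (root_prod a) =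
      staircase a * det (mat a a (\<lambda>(k, i). wvar i ^ (?e k + k)))"
    unfolding lin_ext_root_prod_det[OF assms(1)] det_complete[symmetric]
    by (subst root_prod_staircase, subst e) (simp add: mult_ac)
  also have "\<dots> = (\<Sum>\<sigma> | \<sigma> permutes {0..<a}. signof \<sigma> * (staircase a * (\<Prod>k<a. wvar (\<sigma> k) ^ k) *
      (\<Prod>k<a. wvar (\<sigma> k) ^ ?e k)))"
    by (simp add: det_mat_expand sum_distrib_left power_add prod.distrib mult_ac)
  finally show ?thesis using assms(2) by (simp add: lmon_single_power)
qed

lemma seq_mon_permute:
  assumes "\<sigma> permutes {0..<a}"
  shows "seq_mon a p (map_key \<sigma> \<kappa>) = seq_mon a p \<kappa>"
proof -
  have inj: "inj \<sigma>" using assms by (rule permutes_inj)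
  have lk: "lookup (map_key \<sigma> \<kappa>) k = lookup \<kappa> (\<sigma> k)" for k
    using inj by (simp add: map_key.rep_eq)
  have im: "\<sigma> k < a \<longleftrightarrow> k < a" for k using permutes_in_image[OF assms, of k] by simp
  have "keys (map_key \<sigma> \<kappa>) \<subseteq> {..<a} \<longleftrightarrow> keys \<kappa> \<subseteq> {..<a}"
  proof
    assume *: "keys (map_key \<sigma> \<kappa>) \<subseteq> {..<a}"
    show "keys \<kappa> \<subseteq> {..<a}"
    proof
      fix k assume "k \<in> keys \<kappa>"
      moreover obtain j where "k = \<sigma> j" using permutes_surj[OF assms] by blast
      ultimately have "j \<in> keys (map_key \<sigma> \<kappa>)" by (simp add: in_keys_iff lk)
      then show "k \<in> {..<a}" using * im \<open>k = \<sigma> j\<close> by auto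
    qed
  next
    assume "keys \<kappa> \<subseteq> {..<a}"
    then show "keys (map_key \<sigma> \<kappa>) \<subseteq> {..<a}"
      using im by (auto simp: in_keys_iff lk subset_iff)
  qed
  moreover have "(\<Prod>k<a. int_nth p (lookup \<kappa> (\<sigma> k))) = (\<Prod>k<a. int_nth p (lookup \<kappa> k))"
    using prod.permute[OF assms, of "\<lambda>k. int_nth p (lookup \<kappa> k)"]
    by (simp add: atLeast0LessThan comp_def)
  ultimately show ?thesis by (simp add: seq_mon_def lk)
qed

lemma lmon_permute:
  assumes "\<sigma> permutes {0..<a}" and "keys \<kappa> \<subseteq> {..<a}"
  shows "(\<Prod>k<a. lmon (single (\<sigma> k) (lookup \<kappa> (\<sigma> k)))) = lmon \<kappa>"
proof -
  have "(\<Prod>k<a. lmon (single (\<sigma> k) (lookup \<kappa> (\<sigma> k)))) =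
      lmon (expo_of a (lookup \<kappa>))"
    using prod.permute[OF assms(1), of "\<lambda>k. lmon (single k (lookup \<kappa> k))"]
    by (simp add: atLeast0LessThan comp_def expo_of_def lmon_sum)
  also have "expo_of a (lookup \<kappa>) = \<kappa>"
    using assms(2) by (intro poly_mapping_eqI) (auto simp: lookup_expo_of in_keys_iff)
  finally show ?thesis .
qed

lemma bij_map_key: "bij (map_key \<sigma> :: expo \<Rightarrow> expo)" if "\<sigma> permutes S"
proof (rule o_bij[of "map_key (inv_into UNIV \<sigma>)"])
  have inj: "inj \<sigma>" "inj (inv_into UNIV \<sigma>)"
    using that by (auto intro: permutes_inj permutes_inv)
  show "map_key (inv_into UNIV \<sigma>) \<circ> map_key \<sigma> = (id :: expo \<Rightarrow> expo)"
    "map_key \<sigma> \<circ> map_key (inv_into UNIV \<sigma>) = (id :: expo \<Rightarrow> expo)"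
    using that by (auto simp: fun_eq_iff poly_mapping_eq_iff map_key.rep_eq inj permutes_inverses)
qed

text \<open>Let the determinant in \<open>q\<close> stand for \<open>s\<^sub>\<nu>[B]\<close> and the one in \<open>p\<close> for \<open>s\<^sub>\<delta>[A]\<close>. Multiplication by
  complete symmetric polynomials in the auxiliary variables \<open>w\<close> produces the coefficients of
  \<open>s\<^sub>\<nu>[B + u\<^sub>1 + \<dots> + u\<^sub>a]\<close>. Moving the root product of \<open>s\<^sub>\<delta>[A]\<close> over to these polynomials turns them
  into determinants, which the bialternant formula replaces by alternating sums of monomials,
  for the root product of \<open>s\<^sub>\<nu>[B]\<close> is available as denominator. Because \<open>p\<^sub>\<kappa>\<close> is symmetric in the entries
  of \<open>\<kappa>\<close>, the alternating sum can be moved off the exponents \<open>\<kappa>\<close>, where it collects to the root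
  product again. What remains is \<open>\<Sum>\<^sub>\<kappa> p\<^sub>\<kappa> w\<^sup>\<kappa>\<close> acting on \<open>q\<close>, that is, the product of the generating
  series of \<open>p\<close> and \<open>q\<close>.\<close>

lemma schur_cauchy:
  fixes p q :: "nat \<Rightarrow> 'r::comm_ring_1" and a :: nat
  defines "u \<equiv> \<lambda>\<nu> \<gamma>. seq_mon a q (\<nu> - \<gamma>)"
  assumes fin: "finite {\<delta>. lin_ext (u \<nu>) (root_prod a * seq_mon a (complete_sym a) \<delta>) \<noteq> 0}"
  shows "Sum_any (\<lambda>\<delta>. schur a p \<delta> * lin_ext (u \<nu>) (root_prod a * seq_mon a (complete_sym a) \<delta>)) =
    schur a (seq_conv p q) \<nu>"
proof -
  let ?c = "root_prod a" and ?R = "seq_mon a p"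
  let ?S = "{\<sigma>. \<sigma> permutes {0..<a}}"
  define L where "L \<delta> = lin_ext (u \<nu>) (?c * seq_mon a (complete_sym a) \<delta>)" for \<delta>
  define J where "J \<kappa> = lin_ext (\<lambda>\<gamma>. seq_mon a (complete_sym a) (\<kappa> + \<gamma>)) ?c" for \<kappa>
  define D where "D \<sigma> = staircase a * (\<Prod>k<a. wvar (\<sigma> k) ^ k)" for \<sigma>
  define B where "B \<sigma> \<kappa> = ?R \<kappa> * lin_ext (u \<nu>) (D \<sigma> *
    (\<Prod>k<a. lmon (single (\<sigma> k) (lookup \<kappa> k))))" for \<sigma> \<kappa>
  have fS: "finite ?S" by (rule finite_permutations) simp
  have finL: "finite {\<kappa>. L (\<kappa> + \<gamma>) \<noteq> 0}" for \<gamma>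
    using finite_imageI[OF fin[folded L_def], of "\<lambda>\<delta>. \<delta> - \<gamma>"]
    by (rule rev_finite_subset) (force intro: image_eqI[of _ "\<lambda>\<delta>. \<delta> - \<gamma>" "_ + \<gamma>"])
  have finR: "finite {\<kappa>. ?R \<kappa> * lin_ext (u \<nu>) (f * lmon \<kappa>) \<noteq> 0}" for f
    unfolding lin_ext_mult_lmon lin_ext_times
    by (rule finite_support_lin_ext) (use finite_support_seq_mon in \<open>simp add: u_def diff_diff_add[symmetric]\<close>)
  \<comment> \<open>Moving the root product of the first determinant to the complete symmetric polynomials: the
    substitution \<open>\<delta> = \<kappa> + \<gamma>\<close> in the sum over \<open>\<delta>\<close>, for each exponent \<open>\<gamma>\<close> of the root product.\<close>
  have "Sum_any (\<lambda>\<delta>. schur a p \<delta> * L \<delta>) = lin_ext (\<lambda>\<gamma>. Sum_any (\<lambda>\<delta>. ?R (\<delta> - \<gamma>) * L \<delta>)) ?c"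
    unfolding schur_def lin_ext_times
    by (rule Sum_any_lin_ext, rule finite_support_mult) (use finL[of 0] in simp)
  also have "\<dots> = lin_ext (\<lambda>\<gamma>. Sum_any (\<lambda>\<kappa>. ?R \<kappa> * L (\<kappa> + \<gamma>))) ?c"
  proof -
    have "Sum_any (\<lambda>\<delta>. ?R (\<delta> - \<gamma>) * L \<delta>) = Sum_any (\<lambda>\<kappa>. ?R \<kappa> * L (\<kappa> + \<gamma>))" for \<gamma>
      by (subst Sum_any_shift[of _ \<gamma>, symmetric]) simp
    then show ?thesis by simp
  qed
  also have "\<dots> = Sum_any (\<lambda>\<kappa>. ?R \<kappa> * lin_ext (\<lambda>\<gamma>. L (\<kappa> + \<gamma>)) ?c)"
    unfolding lin_ext_times by (rule Sum_any_lin_ext[symmetric], rule finite_support_mult, rule finL)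
  also have "\<dots> = Sum_any (\<lambda>\<kappa>. ?R \<kappa> * lin_ext (u \<nu>) (?c * J \<kappa>))"
    by (simp add: J_def L_def lin_ext_compose)
  also have "\<dots> = Sum_any (\<lambda>\<kappa>. \<Sum>\<sigma>\<in>?S. signof \<sigma> * B \<sigma> \<kappa>)"
  proof (rule Sum_any.cong)
    fix \<kappa>
    show "?R \<kappa> * lin_ext (u \<nu>) (?c * J \<kappa>) = (\<Sum>\<sigma>\<in>?S. signof \<sigma> * B \<sigma> \<kappa>)"
    proof (cases "?R \<kappa> = 0")
      case False
      show ?thesis
        unfolding J_def root_prod_complete[OF seq_mon_nonzeroD[OF False]]
        by (simp add: B_def D_def lin_ext_sum lin_ext_signof sum_distrib_left mult.left_commute)
    qed (simp add: B_def)
  qed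
  also have "\<dots> = (\<Sum>\<sigma>\<in>?S. signof \<sigma> * Sum_any (\<lambda>\<kappa>. ?R \<kappa> * lin_ext (u \<nu>) (D \<sigma> * lmon \<kappa>)))"
  proof -
    \<comment> \<open>Relabelling \<open>\<kappa>\<close> by \<open>\<sigma>\<close> leaves the monomial in \<open>p\<close> unchanged and takes \<open>\<sigma>\<close> off the exponents.\<close>
    have BR: "B \<sigma> (map_key \<sigma> \<kappa>) = ?R \<kappa> * lin_ext (u \<nu>) (D \<sigma> * lmon \<kappa>)"
      if "\<sigma> \<in> ?S" for \<sigma> \<kappa>
    proof (cases "?R \<kappa> = 0")
      case False
      have \<sigma>: "\<sigma> permutes {0..<a}" using that by simp
      show ?thesis
        using lmon_permute[OF \<sigma> seq_mon_nonzeroD(1)[OF False]]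
        by (simp add: B_def seq_mon_permute[OF \<sigma>] map_key.rep_eq permutes_inj[OF \<sigma>])
    qed (use that in \<open>simp add: B_def seq_mon_permute\<close>)
    have finB: "finite {\<kappa>. B \<sigma> \<kappa> \<noteq> 0}" if "\<sigma> \<in> ?S" for \<sigma>
    proof (rule rev_finite_subset[OF finite_imageI[OF finR[of "D \<sigma>"], of "map_key \<sigma>"]], rule subsetI)
      fix \<kappa> assume \<kappa>: "\<kappa> \<in> {\<kappa>. B \<sigma> \<kappa> \<noteq> 0}"
      have "surj (map_key \<sigma> :: expo \<Rightarrow> expo)"
        using that by (intro bij_is_surj bij_map_key) simp
      then obtain \<kappa>' where "\<kappa> = map_key \<sigma> \<kappa>'"
        by (metis surjD)
      then show "\<kappa> \<in> map_key \<sigma> ` {\<kappa>. ?R \<kappa> * lin_ext (u \<nu>) (D \<sigma> * lmon \<kappa>) \<noteq> 0}"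
        using \<kappa> BR[OF that] by auto
    qed
    have "Sum_any (\<lambda>\<kappa>. \<Sum>\<sigma>\<in>?S. signof \<sigma> * B \<sigma> \<kappa>) = (\<Sum>\<sigma>\<in>?S. Sum_any (\<lambda>\<kappa>. signof \<sigma> * B \<sigma> \<kappa>))"
      by (rule Sum_any_sum[OF fS]) (rule finite_support_mult[OF finB])
    also have "\<dots> = (\<Sum>\<sigma>\<in>?S. signof \<sigma> * Sum_any (B \<sigma>))"
      by (intro sum.cong refl Sum_any_right_distrib[symmetric] finB)
    also have "\<dots> = (\<Sum>\<sigma>\<in>?S. signof \<sigma> * Sum_any (\<lambda>\<kappa>. B \<sigma> (map_key \<sigma> \<kappa>)))"
      by (intro sum.cong refl arg_cong2[where f = "(*)"] Sum_any_reindex[symmetric] bij_map_key[of _ "{0..<a}"]) simp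
    also have "\<dots> = (\<Sum>\<sigma>\<in>?S. signof \<sigma> * Sum_any (\<lambda>\<kappa>. ?R \<kappa> * lin_ext (u \<nu>) (D \<sigma> * lmon \<kappa>)))"
      by (intro sum.cong refl arg_cong2[where f = "(*)"] Sum_any.cong BR)
    finally show ?thesis .
  qed
  also have "\<dots> = Sum_any (\<lambda>\<kappa>. \<Sum>\<sigma>\<in>?S. signof \<sigma> * (?R \<kappa> * lin_ext (u \<nu>) (D \<sigma> * lmon \<kappa>)))"
    by (subst Sum_any_sum[OF fS])
      (simp_all only: Sum_any_right_distrib[OF finR] finite_support_mult[OF finR])
  also have "\<dots> = Sum_any (\<lambda>\<kappa>. ?R \<kappa> * lin_ext (u \<nu>) (?c * lmon \<kappa>))"
  proof (rule Sum_any.cong)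
    fix \<kappa>
    have "?c = (\<Sum>\<sigma>\<in>?S. signof \<sigma> * D \<sigma>)"
      by (simp add: root_prod_staircase det_mat_expand D_def sum_distrib_left mult.left_commute)
    then have "lin_ext (u \<nu>) (?c * lmon \<kappa>) = (\<Sum>\<sigma>\<in>?S. signof \<sigma> * lin_ext (u \<nu>) (D \<sigma> * lmon \<kappa>))"
      by (simp only: sum_distrib_right lin_ext_sum mult.assoc lin_ext_signof)
    then show "(\<Sum>\<sigma>\<in>?S. signof \<sigma> * (?R \<kappa> * lin_ext (u \<nu>) (D \<sigma> * lmon \<kappa>))) =
        ?R \<kappa> * lin_ext (u \<nu>) (?c * lmon \<kappa>)"
      by (simp add: sum_distrib_left mult.left_commute)
  qed
  also have "\<dots> = lin_ext (\<lambda>\<gamma>. Sum_any (\<lambda>\<kappa>. ?R \<kappa> * seq_mon a q (\<nu> - \<gamma> - \<kappa>))) ?c"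
    unfolding lin_ext_mult_lmon lin_ext_times u_def diff_diff_add[symmetric]
    by (rule Sum_any_lin_ext) (rule finite_support_seq_mon)
  also have "\<dots> = schur a (seq_conv p q) \<nu>"
    by (simp only: schur_def seq_mon_conv)
  finally show ?thesis by (simp add: L_def)
qed

lemma keys_subset_lessThan:
  "keys \<kappa> \<subseteq> {..<a} \<longleftrightarrow> (\<forall>k\<ge>a. lookup \<kappa> k = 0)" for a :: nat
  unfolding subset_iff in_keys_iff lessThan_iff by (metis not_le)

text \<open>Induction on the number of variables, taking the variable \<open>a\<close> out of the product of geometric
  series. The factor \<open>v\<close> carries whatever depends on the remaining variables; in the induction step
  it absorbs the factor of the variable \<open>a\<close>.\<close>

lemma lin_ext_complete_sym_aux:
  fixes f :: "nat \<Rightarrow> int \<Rightarrow> 'r::comm_ring_1"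
  assumes "\<And>\<gamma> k e. k < a \<Longrightarrow> v (\<gamma> + single k e) = v \<gamma>"
  shows "lin_ext (\<lambda>\<gamma>. (\<Prod>k<a. f k (lookup \<gamma> k)) * v \<gamma>) (complete_sym a n) =
    fps_nth (\<Prod>k<a. Abs_fps (\<lambda>n. f k (int n))) n * v 0"
  using assms
proof (induction a arbitrary: v n)
  case 0
  have "complete_sym 0 n = (if n = 0 then lmon 0 else 0)"
    by (simp add: complete_sym_def complete_fps_def)
  then show ?case by simp
next
  case (Suc a)
  let ?w = "\<lambda>m \<gamma>. f a (lookup \<gamma> a + int m) * v (\<gamma> + single a (int m))"
  have w: "?w m (\<gamma> + single k e) = ?w m \<gamma>" if "k < a" for m \<gamma> k e
    using Suc.prems[of k "\<gamma> + single a (int m)" e] that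
    by (simp add: lookup_add lookup_single add_ac)
  have "complete_sym (Suc a) n =
      (\<Sum>m=0..n. complete_sym a m * lmon (single a (int (n - m))))"
    by (simp add: complete_sym_def complete_fps_def fps_mult_nth geom_fps_def lmon_single_power)
  then have "lin_ext (\<lambda>\<gamma>. (\<Prod>k<Suc a. f k (lookup \<gamma> k)) * v \<gamma>) (complete_sym (Suc a) n) =
      (\<Sum>m=0..n. lin_ext (\<lambda>\<gamma>. (\<Prod>k<a. f k (lookup \<gamma> k)) * ?w (n - m) \<gamma>) (complete_sym a m))"
    by (simp add: lin_ext_sum lin_ext_mult_lmon lookup_add lookup_single mult.assoc)
  also have "\<dots> = (\<Sum>m=0..n. fps_nth (\<Prod>k<a. Abs_fps (\<lambda>n. f k (int n))) m * ?w (n - m) 0)"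
    by (intro sum.cong refl Suc.IH w)
  also have "\<dots> = (\<Sum>m=0..n. fps_nth (\<Prod>k<a. Abs_fps (\<lambda>n. f k (int n))) m * f a (int (n - m)) * v 0)"
    using Suc.prems[of a 0] by (simp add: mult.assoc)
  finally show ?case by (simp add: fps_mult_nth sum_distrib_right)
qed

text \<open>Multiplication by a complete symmetric polynomial amounts to multiplying the generating series of
  \<open>q\<close> by a geometric series, in each of the \<open>a\<close> factors.\<close>

lemma lin_ext_complete_sym:
  fixes q :: "nat \<Rightarrow> 'r::comm_ring_1"
  shows "lin_ext (\<lambda>\<gamma>. seq_mon a q (\<mu> - \<gamma>)) (complete_sym a n) = (if keys \<mu> \<subseteq> {..<a}
    then fps_nth (\<Prod>k<a. Abs_fps (\<lambda>n. int_nth q (lookup \<mu> k - int n))) n else 0)"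
proof -
  define v :: "expo \<Rightarrow> 'r" where
    "v \<gamma> = (if \<forall>k\<ge>a. lookup (\<mu> - \<gamma>) k = 0 then 1 else 0)" for \<gamma>
  have "v (\<gamma> + single k e) = v \<gamma>" if "k < a" for \<gamma> k e
    using that by (auto simp: v_def lookup_minus lookup_add lookup_single)
  from lin_ext_complete_sym_aux[of a v "\<lambda>k e. int_nth q (lookup \<mu> k - e)", OF this]
  have "lin_ext (\<lambda>\<gamma>. (\<Prod>k<a. int_nth q (lookup \<mu> k - lookup \<gamma> k)) * v \<gamma>) (complete_sym a n) =
    fps_nth (\<Prod>k<a. Abs_fps (\<lambda>n. int_nth q (lookup \<mu> k - int n))) n * v 0" .
  moreover have "v 0 = (if keys \<mu> \<subseteq> {..<a} then 1 else 0)"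
    unfolding keys_subset_lessThan by (simp add: v_def)
  moreover have "seq_mon a q (\<mu> - \<gamma>) = (\<Prod>k<a. int_nth q (lookup \<mu> k - lookup \<gamma> k)) * v \<gamma>" for \<gamma>
    unfolding seq_mon_def v_def keys_subset_lessThan by (auto simp: lookup_minus)
  ultimately show ?thesis by simp
qed

section \<open>Coefficients and monomials\<close>

lemma coef_msym: "is_msym (coef F)"
  using coef[of F] by simp

lemma msym_eqI: "(\<And>m. coef F m = coef G m) \<Longrightarrow> F = G"
  by (metis coef_inject ext)

lemma is_msymD:
  assumes "is_msym f"
  shows "\<exists>d. \<forall>m. f m \<noteq> 0 \<longrightarrow> mdeg m \<le> d"
    and "\<exists>S. finite S \<and> (\<forall>m. f m \<noteq> 0 \<longrightarrow> fst ` keys m \<subseteq> S)"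
    and "bij \<pi> \<Longrightarrow> f (map_key (at_node i \<pi>) m) = f m"
  using assms by (simp_all only: is_msym_def)

lemma coef_sum: "coef (\<Sum>i\<in>I. F i) m = (\<Sum>i\<in>I. coef (F i) m)"
  by (induction I rule: infinite_finite_induct) (auto simp: zero_msym.rep_eq plus_msym.rep_eq)

lemma coef_const: "coef (const c) m = (if m = 0 then c else 0)"
  by (simp add: const.rep_eq)

lemma ex_fresh: "\<exists>k. (i, k) \<notin> keys m" for i :: 'i and m :: "'i mon"
proof -
  have "finite (snd ` keys m)" by simp
  then obtain k where "k \<notin> snd ` keys m" using ex_new_if_finite[OF infinite_UNIV_nat] by blast
  then show ?thesis by force
qed

lemma fst_at_node: "fst (at_node i \<pi> x) = fst x"
  by (simp add: at_node_def split: prod.split)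

lemma in_keys_map_key_at_node:
  "bij \<pi> \<Longrightarrow> x \<in> keys (map_key (at_node i \<pi>) m) \<longleftrightarrow> at_node i \<pi> x \<in> keys m"
  by (simp add: in_keys_iff lookup_map_key_at_node)

text \<open>The transposition of the two variables fixes \<open>m\<close>, in which neither of them occurs.\<close>

lemma is_msym_fresh:
  fixes m :: "'i mon"
  assumes f: "is_msym f" and "(i, k) \<notin> keys m" "(i, k') \<notin> keys m"
  shows "f (m + single (i, k) n) = f (m + single (i, k') n)"
proof -
  let ?\<pi> = "\<lambda>j. if j = k then k' else if j = k' then k else j"
  have bij: "bij ?\<pi>" by (rule o_bij[of ?\<pi>]) auto
  have 0: "lookup m (i, k) = 0" "lookup m (i, k') = 0"
    using assms(2,3) by (simp_all add: in_keys_iff)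
  have "map_key (at_node i ?\<pi>) (m + single (i, k) n) = m + single (i, k') n"
  proof (rule poly_mapping_eqI)
    fix x :: "'i \<times> nat"
    obtain a b where x: "x = (a, b)" by (cases x)
    show "lookup (map_key (at_node i ?\<pi>) (m + single (i, k) n)) x =
        lookup (m + single (i, k') n) x"
      unfolding lookup_map_key_at_node[OF bij] x
      by (cases "a = i"; cases "b = k"; cases "b = k'")
        (simp_all add: at_node_def lookup_add lookup_single 0)
  qed
  moreover have "f (map_key (at_node i ?\<pi>) (m + single (i, k) n)) =
      f (m + single (i, k) n)"
    by (rule is_msymD(3)[OF f bij])
  ultimately show ?thesis by simp
qed

section \<open>Adjoints of multiplication by complete symmetric functions\<close>

definition fresh_shift :: "'i \<Rightarrow> nat \<Rightarrow> 'i mon \<Rightarrow> 'i mon" where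
  "fresh_shift i n m = m + single (i, LEAST k. (i, k) \<notin> keys m) n"

lemma is_msym_fresh_shift:
  assumes "is_msym f" "(i, k) \<notin> keys m"
  shows "f (fresh_shift i n m) = f (m + single (i, k) n)"
  unfolding fresh_shift_def
  by (rule is_msym_fresh[OF assms(1) _ assms(2)]) (rule LeastI_ex[OF ex_fresh])

lemma mdeg_single: "mdeg (single x n) = n"
  by (simp add: mdeg_def)

text \<open>The coefficient of \<open>u\<^sup>n\<close> in \<open>F[X\<^sup>(\<^sup>i\<^sup>) + u]\<close>, the new variable \<open>u\<close> being any variable of the alphabet that
  does not occur in the monomial at hand. It turns out to be the adjoint of multiplication by \<open>h\<^sub>n\<close>.\<close>

lift_definition hperp :: "'i \<Rightarrow> nat \<Rightarrow> ('i, 'a::comm_ring_1) msym \<Rightarrow> ('i, 'a) msym"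
  is "\<lambda>(i::'i) n (f::'i mon \<Rightarrow> 'a) m. f (fresh_shift i n m)"
proof -
  fix i :: 'i and n and f :: "'i mon \<Rightarrow> 'a"
  assume f: "is_msym f"
  obtain d where d: "\<forall>m. f m \<noteq> 0 \<longrightarrow> mdeg m \<le> d" using is_msymD(1)[OF f] ..
  obtain S where S: "finite S" "\<forall>m. f m \<noteq> 0 \<longrightarrow> fst ` keys m \<subseteq> S"
    using is_msymD(2)[OF f] by (elim exE conjE)
  show "is_msym (\<lambda>m. f (fresh_shift i n m))"
    unfolding is_msym_def
  proof (intro conjI exI[of _ d] exI[of _ S] allI impI)
    fix m assume nz: "f (fresh_shift i n m) \<noteq> 0"
    then have "mdeg (fresh_shift i n m) \<le> d" by (rule d[rule_format])
    then show "mdeg m \<le> d" by (simp add: fresh_shift_def mdeg_add)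
    have "fst ` keys (fresh_shift i n m) \<subseteq> S" by (rule S(2)[rule_format, OF nz])
    then show "fst ` keys m \<subseteq> S" by (simp add: fresh_shift_def keys_add_nat image_Un)
  next
    show "finite S" by (rule S(1))
  next
    fix j and \<pi> :: "nat \<Rightarrow> nat" and m :: "'i mon"
    assume \<pi>: "bij \<pi>"
    let ?g = "at_node j \<pi>" and ?m = "map_key (at_node j \<pi>) m"
    obtain k where k: "(i, k) \<notin> keys ?m" using ex_fresh[of i ?m] ..
    define k' where "k' = (if i = j then \<pi> k else k)"
    have k': "?g (i, k) = (i, k')" by (simp add: at_node_def k'_def)
    have fr: "(i, k') \<notin> keys m"
      using k by (simp add: in_keys_map_key_at_node[OF \<pi>] k')
    have "f (fresh_shift i n ?m) = f (?m + single (i, k) n)"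
      by (rule is_msym_fresh_shift[OF f k])
    also have "?m + single (i, k) n =
        map_key ?g (m + single (?g (i, k)) n)"
      unfolding map_key_plus[OF inj_at_node[OF \<pi>]] map_key_single[OF inj_at_node[OF \<pi>]] ..
    also have "f \<dots> = f (m + single (?g (i, k)) n)"
      by (rule is_msymD(3)[OF f \<pi>])
    also have "\<dots> = f (fresh_shift i n m)"
      unfolding k' by (rule is_msym_fresh_shift[OF f fr, symmetric])
    finally show "f (fresh_shift i n ?m) = f (fresh_shift i n m)" .
  qed
qed

lemma coef_hperp:
  "(i, k) \<notin> keys m \<Longrightarrow> coef (hperp i n F) m = coef F (m + single (i, k) n)"
  by (simp add: hperp.rep_eq is_msym_fresh_shift[OF coef_msym])

lemma hperp_add: "hperp i n (F + G) = hperp i n F + hperp i n G"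
  by (rule msym_eqI) (simp add: hperp.rep_eq plus_msym.rep_eq)

lemma hperp_0 [simp]: "hperp i n 0 = 0"
  by (rule msym_eqI) (simp add: hperp.rep_eq zero_msym.rep_eq)

lemma hperp_sum: "hperp i n (\<Sum>x\<in>I. F x) = (\<Sum>x\<in>I. hperp i n (F x))"
  by (induction I rule: infinite_finite_induct) (auto simp: hperp_add)

lemma hperp_uminus: "hperp i n (- F) = - hperp i n F"
  using hperp_add[of i n F "- F"] by (simp add: add_eq_0_iff)

lemma hperp_diff: "hperp i n (F - G) = hperp i n F - hperp i n G"
  using hperp_add[of i n F "- G"] by (simp add: hperp_uminus)

lemma hperp_zero [simp]: "hperp i 0 F = F"
  by (rule msym_eqI) (simp add: hperp.rep_eq fresh_shift_def)

text \<open>In a factorization of \<open>m x\<^sup>n\<close> the power of \<open>x\<close> is distributed between the two factors.\<close>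

lemma splits_single:
  assumes "x \<notin> keys m"
  shows "(\<Sum>(p, q)\<in>splits (m + single x n). g p q) =
    (\<Sum>k\<le>n. \<Sum>(p, q)\<in>splits m. g (p + single x k) (q + single x (n - k)))"
proof -
  have m: "lookup m x = 0" using assms by (simp add: in_keys_iff)
  have m0: "lookup p x = 0 \<and> lookup q x = 0" if "p + q = m" for p q
    using m that by (metis add_is_0 lookup_add)
  have r: "p - single x (lookup p x) + single x (lookup p x) = p"
    for p :: "'a mon"
    by (rule poly_mapping_eqI) (auto simp: lookup_add lookup_minus lookup_single when_def)
  have "(\<Sum>(p, q)\<in>splits (m + single x n). g p q) =
      (\<Sum>(k, p, q)\<in>{..n} \<times> splits m. g (p + single x k) (q + single x (n - k)))"
  proof (rule sum.reindex_bij_witness[of _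
        "\<lambda>(k, p, q). (p + single x k, q + single x (n - k))"
        "\<lambda>(p, q). (lookup p x, p - single x (lookup p x),
          q - single x (lookup q x))"], goal_cases)
    case (1 a)
    then obtain p q where a: "a = (p, q)" "p + q = m + single x n" by (auto simp: splits_def)
    have "lookup p x + lookup q x = n"
      using arg_cong[OF a(2), of "\<lambda>f. lookup f x"] m by (simp add: lookup_add)
    then have "n - lookup p x = lookup q x" by simp
    then show ?case using a r by simp
  next
    case (2 a)
    then obtain p q where a: "a = (p, q)" "p + q = m + single x n" by (auto simp: splits_def)
    have l: "lookup p y + lookup q y = lookup m y + (n when y = x)" for y
      using arg_cong[OF a(2), of "\<lambda>f. lookup f y"] by (simp add: lookup_add lookup_single when_def)
    have "p - single x (lookup p x) + (q - single x (lookup q x)) = m"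
      using l m by (intro poly_mapping_eqI) (auto simp: lookup_add lookup_minus lookup_single when_def split: if_splits)
    moreover have "lookup p x \<le> n" using l[of x] m by simp
    ultimately show ?case using a by (simp add: splits_def)
  next
    case (3 b)
    then obtain k p q where b: "b = (k, p, q)" "k \<le> n" "p + q = m" by (auto simp: splits_def)
    show ?case using b m0[OF b(3)] by (simp add: lookup_add)
  next
    case (4 b)
    then obtain k p q where b: "b = (k, p, q)" "k \<le> n" "p + q = m" by (auto simp: splits_def)
    have "p + single x k + (q + single x (n - k)) =
        (p + q) + (single x k + single x (n - k))"
      by (simp only: add.assoc add.left_commute)
    also have "\<dots> = m + single x n"
      using b(2,3) by (simp flip: single_add)
    finally show ?case using b(1) by (simp add: splits_def)
  next
    case (5 a)
    then obtain p q where a: "a = (p, q)" "p + q = m + single x n" by (auto simp: splits_def)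
    have "lookup p x + lookup q x = n"
      using arg_cong[OF a(2), of "\<lambda>f. lookup f x"] m by (simp add: lookup_add)
    then have "n - lookup p x = lookup q x" by simp
    then show ?case using a r by simp
  qed
  also have "\<dots> = (\<Sum>k\<le>n. \<Sum>(p, q)\<in>splits m. g (p + single x k) (q + single x (n - k)))"
    by (simp add: sum.cartesian_product)
  finally show ?thesis .
qed

lemma coef_mult: "coef (F * G) m = (\<Sum>(p, q)\<in>splits m. coef F p * coef G q)"
  by (simp add: times_msym.rep_eq conv_def)

lemma splits_keys: "(p, q) \<in> splits m \<Longrightarrow> keys p \<subseteq> keys m \<and> keys q \<subseteq> keys m"
  by (auto simp: splits_def keys_add_nat)

text \<open>Adding a variable to an alphabet is a ring homomorphism.\<close>

lemma hperp_mult: "hperp i n (F * G) = (\<Sum>k\<le>n. hperp i k F * hperp i (n - k) G)"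
  for F G :: "('i, 'a::comm_ring_1) msym"
proof (rule msym_eqI)
  fix m :: "'i mon"
  obtain k where k: "(i, k) \<notin> keys m" using ex_fresh[of i m] ..
  have *: "coef (hperp i j F) p = coef F (p + single (i, k) j) \<and>
      coef (hperp i j G) q = coef G (q + single (i, k) j)" if "(p, q) \<in> splits m" for p q j
    using splits_keys[OF that] k by (auto intro!: coef_hperp)
  show "coef (hperp i n (F * G)) m = coef (\<Sum>k\<le>n. hperp i k F * hperp i (n - k) G) m"
    unfolding coef_hperp[OF k] coef_sum coef_mult splits_single[OF k]
    by (intro sum.cong refl) (auto simp: *)
qed

section \<open>Dropping a node\<close>

text \<open>The substitution \<open>X\<^sup>(\<^sup>i\<^sup>) = 0\<close>.\<close>

lift_definition drop_node :: "'i \<Rightarrow> ('i, 'a::comm_ring_1) msym \<Rightarrow> ('i, 'a) msym"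
  is "\<lambda>(i::'i) (f::'i mon \<Rightarrow> 'a) m. if i \<in> fst ` keys m then 0 else f m"
proof -
  fix i :: 'i and f :: "'i mon \<Rightarrow> 'a"
  assume f: "is_msym f"
  obtain d where d: "\<forall>m. f m \<noteq> 0 \<longrightarrow> mdeg m \<le> d" using is_msymD(1)[OF f] ..
  obtain S where S: "finite S" "\<forall>m. f m \<noteq> 0 \<longrightarrow> fst ` keys m \<subseteq> S"
    using is_msymD(2)[OF f] by (elim exE conjE)
  show "is_msym (\<lambda>m. if i \<in> fst ` keys m then 0 else f m)"
    unfolding is_msym_def
  proof (intro conjI exI[of _ d] exI[of _ S] allI impI)
    fix j \<pi> and m :: "'i mon"
    assume "bij (\<pi> :: nat \<Rightarrow> nat)"
    then show "(if i \<in> fst ` keys (map_key (at_node j \<pi>) m) then 0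
        else f (map_key (at_node j \<pi>) m)) = (if i \<in> fst ` keys m then 0 else f m)"
      by (simp add: map_key_at_node is_msymD(3)[OF f])
  qed (use d S in \<open>auto split: if_splits\<close>)
qed

lemma drop_node_add: "drop_node i (F + G) = drop_node i F + drop_node i G"
  by (rule msym_eqI) (simp add: drop_node.rep_eq plus_msym.rep_eq)

lemma drop_node_0 [simp]: "drop_node i 0 = 0"
  by (rule msym_eqI) (simp add: drop_node.rep_eq zero_msym.rep_eq)

lemma drop_node_sum: "drop_node i (\<Sum>x\<in>I. F x) = (\<Sum>x\<in>I. drop_node i (F x))"
  by (induction I rule: infinite_finite_induct) (auto simp: drop_node_add)

lemma drop_node_mult: "drop_node i (F * G) = drop_node i F * drop_node i G"
proof (rule msym_eqI)
  fix m
  show "coef (drop_node i (F * G)) m = coef (drop_node i F * drop_node i G) m"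
  proof (cases "i \<in> fst ` keys m")
    case True
    have "coef (drop_node i F) p * coef (drop_node i G) q = 0" if "(p, q) \<in> splits m" for p q
    proof -
      have m: "m = p + q" using that by (simp add: splits_def)
      have "i \<in> fst ` keys p \<or> i \<in> fst ` keys q"
        using True unfolding m keys_add_nat image_Un by simp
      then show ?thesis by (elim disjE) (simp_all add: drop_node.rep_eq)
    qed
    with True show ?thesis
      by (auto simp: drop_node.rep_eq coef_mult intro!: sum.neutral)
  next
    case False
    then have "i \<notin> fst ` keys p \<and> i \<notin> fst ` keys q" if "(p, q) \<in> splits m" for p q
      using splits_keys[OF that] by auto
    with False show ?thesis
      by (auto simp: drop_node.rep_eq coef_mult intro!: sum.cong)
  qed
qed

lemma drop_node_free: "free_of i C \<Longrightarrow> drop_node i C = C"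
  by (rule msym_eqI) (auto simp: drop_node.rep_eq free_of_def)

lemma free_of_drop_node: "free_of i (drop_node i F)"
  by (auto simp: free_of_def drop_node.rep_eq)

lemma free_of_iff: "free_of i C \<longleftrightarrow> drop_node i C = C"
  using drop_node_free free_of_drop_node by metis

lemma free_of_mult: "free_of i C \<Longrightarrow> free_of i D \<Longrightarrow> free_of i (C * D)"
  by (simp add: free_of_iff drop_node_mult)

lemma free_of_add: "free_of i C \<Longrightarrow> free_of i D \<Longrightarrow> free_of i (C + D)"
  by (simp add: free_of_iff drop_node_add)

lemma drop_node_uminus: "drop_node i (- F) = - drop_node i F"
  by (rule msym_eqI) (simp add: drop_node.rep_eq uminus_msym.rep_eq)

lemma free_of_uminus: "free_of i C \<Longrightarrow> free_of i (- C)"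
  by (simp add: free_of_iff drop_node_uminus)

lemma free_of_0 [simp]: "free_of i 0"
  by (simp add: free_of_iff)

lemma free_of_const [simp]: "free_of i (const c)"
  by (auto simp: free_of_def coef_const)

lemma const_1: "const 1 = 1"
  by (rule msym_eqI) (simp add: coef_const one_msym.rep_eq)

lemma const_0 [simp]: "const 0 = 0"
  by (rule msym_eqI) (simp add: coef_const zero_msym.rep_eq)

lemma const_add: "const (c + d) = const c + const d"
  by (rule msym_eqI) (simp add: coef_const plus_msym.rep_eq)

lemma const_mult: "const (c * d) = const c * const d"
proof (rule msym_eqI)
  fix m :: "'a mon"
  have "coef (const c * const d) m = (\<Sum>z\<in>splits m. if z = (0, 0) then c * d else 0)"
    unfolding coef_mult by (intro sum.cong refl) (auto simp: coef_const split: if_splits)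
  also have "\<dots> = (if (0, 0) \<in> splits m then c * d else 0)"
    by (simp add: finite_splits)
  finally show "coef (const (c * d)) m = coef (const c * const d) m"
    by (auto simp: coef_const splits_def)
qed

lemma const_power: "const (c ^ n) = const c ^ n"
  by (induction n) (simp_all add: const_1 const_mult)

lemma free_of_1 [simp]: "free_of i 1"
  using free_of_const[of i 1] by (simp add: const_1)

lemma drop_node_1 [simp]: "drop_node i 1 = 1"
  by (rule drop_node_free) simp

lemma hperp_free: "free_of i C \<Longrightarrow> hperp i n C = (if n = 0 then C else 0)"
  for C :: "('i, 'a::comm_ring_1) msym"
proof (rule msym_eqI)
  fix m :: "'i mon"
  assume C: "free_of i C"
  obtain k where k: "(i, k) \<notin> keys m" using ex_fresh[of i m] ..
  have "coef (hperp i n C) m = 0" if "n > 0"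
  proof (rule ccontr)
    assume "coef (hperp i n C) m \<noteq> 0"
    then have "i \<notin> fst ` keys (m + single (i, k) n)"
      using C unfolding coef_hperp[OF k] by (simp add: free_of_def)
    with that show False by (simp add: keys_add_nat image_Un)
  qed
  then show "coef (hperp i n C) m = coef (if n = 0 then C else 0) m"
    by (auto simp: zero_msym.rep_eq)
qed

lemma hperp_1: "n > 0 \<Longrightarrow> hperp i n 1 = 0"
  by (simp add: hperp_free)

lemma hperp_free_mult: "free_of i C \<Longrightarrow> hperp i n (C * F) = C * hperp i n F"
  by (simp add: hperp_mult hperp_free if_distrib[of "\<lambda>x. x * _"] sum.delta cong: if_cong)

section \<open>Degrees\<close>

text \<open>Bounds are integers because operators lower the degree: only \<open>0\<close> has a negative bound.\<close>

definition degb :: "int \<Rightarrow> ('i, 'a::comm_ring_1) msym \<Rightarrow> bool" where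
  "degb d F \<longleftrightarrow> (\<forall>m. coef F m \<noteq> 0 \<longrightarrow> int (mdeg m) \<le> d)"

lemma ex_degb: "\<exists>d. degb d F"
proof -
  obtain d where "\<forall>m. coef F m \<noteq> 0 \<longrightarrow> mdeg m \<le> d" using is_msymD(1)[OF coef_msym[of F]] ..
  then have "degb (int d) F" by (simp add: degb_def)
  then show ?thesis ..
qed

lemma degb_0 [simp]: "degb d 0"
  by (simp add: degb_def zero_msym.rep_eq)

lemma degbD: "degb d F \<Longrightarrow> coef F m \<noteq> 0 \<Longrightarrow> int (mdeg m) \<le> d"
  by (simp add: degb_def)

lemma degb_neg: "F = 0" if "degb d F" "d < 0"
proof (rule msym_eqI)
  fix m
  show "coef F m = coef 0 m" using degbD[OF that(1), of m] that(2) by (auto simp: zero_msym.rep_eq)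
qed

lemma degb_mono: "degb d F \<Longrightarrow> d \<le> e \<Longrightarrow> degb e F"
  unfolding degb_def by (meson order_trans)

lemma degb_add: "degb d F \<Longrightarrow> degb d G \<Longrightarrow> degb d (F + G)"
  unfolding degb_def plus_msym.rep_eq
proof (intro allI impI)
  fix m
  assume "\<forall>m. coef F m \<noteq> 0 \<longrightarrow> int (mdeg m) \<le> d" "\<forall>m. coef G m \<noteq> 0 \<longrightarrow> int (mdeg m) \<le> d"
    "coef F m + coef G m \<noteq> 0"
  then show "int (mdeg m) \<le> d" by (cases "coef F m = 0") auto
qed

lemma degb_uminus: "degb d F \<Longrightarrow> degb d (- F)"
  by (simp add: degb_def uminus_msym.rep_eq)

lemma degb_diff: "degb d F \<Longrightarrow> degb d G \<Longrightarrow> degb d (F - G)"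
  using degb_add[of d F "- G"] degb_uminus[of d G] by simp

lemma degb_sum: "(\<And>x. x \<in> I \<Longrightarrow> degb d (F x)) \<Longrightarrow> degb d (\<Sum>x\<in>I. F x)"
  by (induction I rule: infinite_finite_induct) (auto intro: degb_add)

lemma degb_mult: "degb d F \<Longrightarrow> degb e G \<Longrightarrow> degb (d + e) (F * G)"
  unfolding degb_def[of "d + e"] times_msym.rep_eq
proof (intro allI impI, elim conv_nonzeroE)
  fix m p q
  assume F: "degb d F" and G: "degb e G" and m: "m = p + q" and nz: "coef F p \<noteq> 0" "coef G q \<noteq> 0"
  show "int (mdeg m) \<le> d + e" using degbD[OF F nz(1)] degbD[OF G nz(2)] by (simp add: m mdeg_add)
qed

lemma degb_const: "degb 0 (const c)"
  by (simp add: degb_def coef_const mdeg_def)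

lemma degb_hperp: "degb d F \<Longrightarrow> degb (d - int n) (hperp i n F)"
  for F :: "('i, 'a::comm_ring_1) msym"
  unfolding degb_def[of "d - int n"]
proof (intro allI impI)
  fix m :: "'i mon"
  assume F: "degb d F" and nz: "coef (hperp i n F) m \<noteq> 0"
  obtain k where "(i, k) \<notin> keys m" using ex_fresh[of i m] ..
  then have "int (mdeg (m + single (i, k) n)) \<le> d"
    using nz by (intro degbD[OF F]) (simp add: coef_hperp)
  then show "int (mdeg m) \<le> d - int n" by (simp add: mdeg_add mdeg_single)
qed

section \<open>Complete, elementary and monomial symmetric functions\<close>

lemma hperp_hsf: "hperp i n (hsf i m) = (if n \<le> m then hsf i (m - n) else 0)"
  for i :: 'i
proof (rule msym_eqI)
  fix p :: "'i mon"
  obtain k where k: "(i, k) \<notin> keys p" using ex_fresh[of i p] ..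
  have "fst ` keys (p + single (i, k) n) \<subseteq> {i} \<longleftrightarrow> fst ` keys p \<subseteq> {i}"
    by (simp add: keys_add_nat image_Un)
  then show "coef (hperp i n (hsf i m)) p = coef (if n \<le> m then hsf i (m - n) else 0) p"
    by (auto simp: coef_hperp[OF k] hsf.rep_eq mdeg_add mdeg_single zero_msym.rep_eq)
qed

lemma exponents_add_single:
  assumes "x \<notin> keys m" "n > 0"
  shows "exponents (m + single x n) = add_mset n (exponents m)"
proof -
  have x: "lookup m x = 0" using assms(1) by (simp add: in_keys_iff)
  have keys: "keys (m + single x n) = insert x (keys m)"
    using assms(2) by (simp add: keys_add_nat)
  have "image_mset (lookup (m + single x n)) (mset_set (keys m)) =
      image_mset (lookup m) (mset_set (keys m))"
    using assms(1) by (intro image_mset_cong) (auto simp: lookup_add lookup_single when_def)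
  then show ?thesis
    using assms(1) x by (simp add: exponents_def keys lookup_add)
qed

lemma zero_notin_exponents: "0 \<notin># exponents m"
  by (auto simp: exponents_def in_keys_iff)

lemma exponents_0 [simp]: "exponents 0 = {#}"
  by (simp add: exponents_def)

lemma exponents_eq_empty [simp]: "exponents m = {#} \<longleftrightarrow> m = 0"
  by (simp add: exponents_def mset_set_empty_iff)

lemma hperp_msf: "n > 0 \<Longrightarrow> hperp i n (msf i l) = (if n \<in># l then msf i (l - {#n#}) else 0)"
  for i :: 'i
proof (rule msym_eqI)
  fix p :: "'i mon"
  assume n: "n > 0"
  obtain k where k: "(i, k) \<notin> keys p" using ex_fresh[of i p] ..
  have f: "fst ` keys (p + single (i, k) n) \<subseteq> {i} \<longleftrightarrow> fst ` keys p \<subseteq> {i}"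
    by (simp add: keys_add_nat image_Un)
  have e: "add_mset n (exponents p) = l \<longleftrightarrow> n \<in># l \<and> exponents p = l - {#n#}"
    by (metis add_mset_remove_trivial insert_DiffM union_single_eq_member)
  show "coef (hperp i n (msf i l)) p = coef (if n \<in># l then msf i (l - {#n#}) else 0) p"
    by (simp add: coef_hperp[OF k] msf.rep_eq f exponents_add_single[OF k n] e zero_msym.rep_eq)
qed

lemma hsf_0 [simp]: "hsf i 0 = 1"
proof (rule msym_eqI)
  fix m :: "'a mon"
  have "mdeg m = 0 \<longleftrightarrow> m = 0" by (auto simp: mdeg_def in_keys_iff poly_mapping_eq_iff fun_eq_iff)
  then show "coef (hsf i 0) m = coef 1 m" by (simp add: hsf.rep_eq one_msym.rep_eq)
qed

lemma msf_empty [simp]: "msf i {#} = 1"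
  by (rule msym_eqI) (auto simp: msf.rep_eq one_msym.rep_eq)

lemma msf_zero: "0 \<in># l \<Longrightarrow> msf i l = 0"
  using zero_notin_exponents by (intro msym_eqI) (auto simp: msf.rep_eq zero_msym.rep_eq)

lemma esf_0 [simp]: "esf i 0 = 1"
  by (simp add: esf_def)

lemma hperp_esf: "hperp i n (esf i m) = (if n = 0 then esf i m else if n = 1 \<and> m > 0 then esf i (m - 1) else 0)"
proof (cases "n = 0")
  case False
  then have "n \<in># replicate_mset m 1 \<longleftrightarrow> n = 1 \<and> m > 0" by auto
  moreover have "replicate_mset m 1 - {#1#} = replicate_mset (m - 1) (1::nat)"
    by (cases m) simp_all
  ultimately show ?thesis using False by (simp add: esf_def hperp_msf)
qed simp

lemma subset_singleton_image: "i \<notin> fst ` K \<Longrightarrow> fst ` K \<subseteq> {i} \<longleftrightarrow> K = {}"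
  by auto

lemma drop_node_hsf [simp]: "drop_node i (hsf i n) = (if n = 0 then 1 else 0)"
proof (rule msym_eqI)
  fix m :: "'a mon"
  show "coef (drop_node i (hsf i n)) m = coef (if n = 0 then 1 else 0) m"
  proof (cases "i \<in> fst ` keys m")
    case True
    then have "m \<noteq> 0" by auto
    then show ?thesis using True by (simp add: drop_node.rep_eq one_msym.rep_eq zero_msym.rep_eq)
  next
    case False
    then show ?thesis
      using subset_singleton_image[OF False]
      by (auto simp: drop_node.rep_eq one_msym.rep_eq zero_msym.rep_eq hsf.rep_eq mdeg_def)
  qed
qed

lemma drop_node_msf: "drop_node i (msf i l) = (if l = {#} then 1 else 0)"
proof (rule msym_eqI)
  fix m :: "'a mon"
  show "coef (drop_node i (msf i l)) m = coef (if l = {#} then 1 else 0) m"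
  proof (cases "i \<in> fst ` keys m")
    case True
    then have "m \<noteq> 0" by auto
    then show ?thesis using True by (simp add: drop_node.rep_eq one_msym.rep_eq zero_msym.rep_eq)
  next
    case False
    then show ?thesis
      using subset_singleton_image[OF False]
      by (auto simp: drop_node.rep_eq one_msym.rep_eq zero_msym.rep_eq msf.rep_eq)
  qed
qed

lemma drop_node_esf [simp]: "drop_node i (esf i n) = (if n = 0 then 1 else 0)"
  by (simp add: esf_def drop_node_msf)

lemma free_of_hsf: "i \<noteq> j \<Longrightarrow> free_of i (hsf j n)"
  unfolding free_of_def hsf.rep_eq by (auto split: if_splits)

lemma degb_msf: "degb (int (sum_mset l)) (msf i l)"
  by (auto simp: degb_def msf.rep_eq mdeg_exponents)

section \<open>Iterated adjoints determine the coefficients\<close>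

abbreviation hperps :: "'i \<Rightarrow> nat list \<Rightarrow> ('i, 'a::comm_ring_1) msym \<Rightarrow> ('i, 'a) msym" where
  "hperps i \<equiv> fold (hperp i)"

lemma hperps_add: "hperps i l (F + G) = hperps i l F + hperps i l G"
  by (induction l arbitrary: F G) (simp_all add: hperp_add)

lemma hperps_0 [simp]: "hperps i l 0 = 0"
  by (induction l) simp_all

lemma hperps_sum: "hperps i l (\<Sum>x\<in>I. F x) = (\<Sum>x\<in>I. hperps i l (F x))"
  by (induction I rule: infinite_finite_induct) (auto simp: hperps_add)

lemma hperps_diff: "hperps i l (F - G) = hperps i l F - hperps i l G"
  by (induction l arbitrary: F G) (simp_all add: hperp_diff)

lemma hperps_free_mult: "free_of i C \<Longrightarrow> hperps i l (C * F) = C * hperps i l F"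
  by (induction l arbitrary: F) (simp_all add: hperp_free_mult)

lemma degb_hperps: "degb d F \<Longrightarrow> degb (d - int (sum_list l)) (hperps i l F)"
proof (induction l arbitrary: F d)
  case (Cons n l)
  from Cons.IH[OF degb_hperp[OF Cons.prems]] show ?case by (simp add: algebra_simps)
qed simp

text \<open>Each adjoint splits one variable of the node \<open>i\<close> off the monomial.\<close>

lemma coef_hperps:
  fixes i :: 'i
  assumes "mset l = exponents m0" "fst ` keys m0 \<subseteq> {i}" "i \<notin> fst ` keys m"
  shows "coef (hperps i l F) m = coef F (m + m0)"
  using assms(1,2)
proof (induction l arbitrary: m0 F)
  case Nil
  then have "m0 = 0" by (metis exponents_eq_empty mset.simps(1))
  then show ?case by simp
next
  case (Cons n l)
  have "n \<in># exponents m0" using Cons.prems(1) by (metis list.set_intros(1) set_mset_mset)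
  then obtain x where x: "x \<in> keys m0" "n = lookup m0 x"
    by (auto simp: exponents_def)
  obtain k where k: "x = (i, k)" using x(1) Cons.prems(2) by (cases x) auto
  have n: "n > 0" using x by (simp add: in_keys_iff)
  define m1 where "m1 = m0 - single x n"
  have m0: "m0 = m1 + single x n"
    by (rule poly_mapping_eqI) (auto simp: m1_def x(2) lookup_add lookup_minus lookup_single when_def)
  have x1: "x \<notin> keys m1" by (simp add: in_keys_iff m1_def x(2) lookup_minus)
  have "mset l = exponents m1"
    using Cons.prems(1) exponents_add_single[OF x1 n] by (simp add: m0)
  moreover have "fst ` keys m1 \<subseteq> {i}"
    using Cons.prems(2) by (simp add: m0 keys_add_nat image_Un)
  ultimately have "coef (hperps i l (hperp i n F)) m = coef (hperp i n F) (m + m1)"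
    by (rule Cons.IH)
  also have "\<dots> = coef F (m + m1 + single (i, k) n)"
  proof (rule coef_hperp)
    have "(i, k) \<notin> keys m" using assms(3) by force
    then show "(i, k) \<notin> keys (m + m1)" using x1 by (simp add: keys_add_nat k)
  qed
  finally show ?case by (simp add: m0 k add.assoc)
qed

definition node_part :: "'i \<Rightarrow> 'i mon \<Rightarrow> 'i mon" where
  "node_part i m = (\<Sum>x\<in>{x \<in> keys m. fst x = i}. single x (lookup m x))"

lemma lookup_node_part: "lookup (node_part i m) x = (if fst x = i then lookup m x else 0)"
  by (simp add: node_part_def lookup_sum lookup_single when_def sum.delta in_keys_iff)

lemma node_part_add: "m - node_part i m + node_part i m = m"
  by (rule poly_mapping_eqI) (simp add: lookup_add lookup_minus lookup_node_part)

lemma keys_node_part: "fst ` keys (node_part i m) \<subseteq> {i}"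
  by (auto simp: in_keys_iff lookup_node_part split: if_splits)

lemma keys_minus_node_part: "i \<notin> fst ` keys (m - node_part i m)"
  by (auto simp: in_keys_iff lookup_minus lookup_node_part)

lemma splits_node_part:
  assumes "(p, q) \<in> splits m" "i \<notin> fst ` keys p" "fst ` keys q \<subseteq> {i}"
  shows "p = m - node_part i m" "q = node_part i m"
proof -
  have m: "m = p + q" using assms(1) by (simp add: splits_def)
  have p: "lookup p x = 0" if "fst x = i" for x
    using assms(2) that by (metis image_eqI in_keys_iff)
  have q: "lookup q x = 0" if "fst x \<noteq> i" for x
    using assms(3) that by (metis image_subset_iff in_keys_iff singletonD)
  show *: "q = node_part i m"
    by (rule poly_mapping_eqI) (auto simp: lookup_node_part m lookup_add p q)
  show "p = m - node_part i m"
    unfolding *[symmetric] by (simp add: m)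
qed

lemma msym_eq_hperps:
  assumes "\<And>l. 0 \<notin> set l \<Longrightarrow> drop_node i (hperps i l F) = drop_node i (hperps i l G)"
  shows "F = G"
proof (rule msym_eqI)
  fix m
  obtain l where l: "mset l = exponents (node_part i m)" using ex_mset by blast
  then have "0 \<notin> set l" using zero_notin_exponents[of "node_part i m"] by (metis set_mset_mset)
  have "coef H m = coef (drop_node i (hperps i l H)) (m - node_part i m)" for H :: "('a, 'b) msym"
    using coef_hperps[OF l keys_node_part keys_minus_node_part, of H] keys_minus_node_part[of i m]
    by (simp add: drop_node.rep_eq node_part_add)
  then show "coef F m = coef G m" using assms[OF \<open>0 \<notin> set l\<close>] by metis
qed

text \<open>The coefficient of \<open>m\<^sub>l[X\<^sup>(\<^sup>i\<^sup>)]\<close> is found by extracting variables with the exponents \<open>l\<close> and setting the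
  others to zero.\<close>

lemma msf_expansion:
  fixes i :: 'i and F :: "('i, 'a::comm_ring_1) msym"
  defines "D \<equiv> \<lambda>l. drop_node i (hperps i (sorted_list_of_multiset l) F)"
  assumes T: "finite T" and "\<And>l. 0 \<notin># l \<Longrightarrow> D l \<noteq> 0 \<Longrightarrow> l \<in> T"
  shows "F = (\<Sum>l\<in>T. D l * msf i l)"
proof (rule msym_eqI)
  fix m
  let ?p = "m - node_part i m" and ?q = "node_part i m"
  have D: "coef (D l * msf i l) m = (if l = exponents ?q then coef (D l) ?p else 0)" for l
  proof -
    have "coef (D l * msf i l) m = (\<Sum>z\<in>splits m. if z = (?p, ?q) then
        (if l = exponents ?q then coef (D l) ?p else 0) else 0)"
      unfolding coef_mult
    proof (intro sum.cong refl, clarify)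
      fix p q assume s: "(p, q) \<in> splits m"
      show "coef (D l) p * coef (msf i l) q =
          (if (p, q) = (?p, ?q) then (if l = exponents ?q then coef (D l) ?p else 0) else 0)"
      proof (cases "(p, q) = (?p, ?q)")
        case True
        then have pq: "p = ?p" "q = ?q" by simp_all
        show ?thesis unfolding pq using keys_node_part[of i m] by (auto simp: msf.rep_eq)
      next
        case False
        then have "i \<in> fst ` keys p \<or> \<not> fst ` keys q \<subseteq> {i}"
          using splits_node_part[OF s] by metis
        then have "coef (D l) p * coef (msf i l) q = 0"
          by (elim disjE) (simp_all add: D_def drop_node.rep_eq msf.rep_eq)
        then show ?thesis by (simp only: False if_False)
      qed
    qed
    also have "\<dots> = (if l = exponents ?q then coef (D l) ?p else 0)"
      by (simp add: finite_splits) (simp add: splits_def node_part_add)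
    finally show ?thesis .
  qed
  have "coef F m = coef (D (exponents ?q)) ?p"
    using coef_hperps[of "sorted_list_of_multiset (exponents ?q)" ?q i ?p F]
      keys_node_part[of i m] keys_minus_node_part[of i m]
    by (simp add: D_def drop_node.rep_eq node_part_add)
  also have "\<dots> = coef (\<Sum>l\<in>T. D l * msf i l) m"
  proof (cases "exponents ?q \<in> T")
    case True
    then show ?thesis using T by (simp add: coef_sum D)
  next
    case False
    then have "D (exponents ?q) = 0" using assms(3) zero_notin_exponents by metis
    moreover have "coef (\<Sum>l\<in>T. D l * msf i l) m = 0"
      unfolding coef_sum D using False by (intro sum.neutral) auto
    ultimately show ?thesis by (simp add: zero_msym.rep_eq)
  qed
  finally show "coef F m = coef (\<Sum>l\<in>T. D l * msf i l) m" .
qed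

section \<open>Complete symmetric functions generate\<close>

text \<open>When a variable \<open>u\<close> is added to the alphabet, \<open>\<Sum>\<^sub>k (-z)\<^sup>k e\<^sub>k\<close> is multiplied by \<open>1 - u z\<close> and \<open>\<Sum>\<^sub>n z\<^sup>n h\<^sub>n\<close>
  by \<open>1/(1 - u z)\<close>, so their product does not change; in terms of coefficients the sum telescopes.\<close>

lemma hperp_esf_hsf:
  assumes "j > 0"
  shows "hperp i j (\<Sum>k\<le>n. (-1) ^ k * esf i k * hsf i (n - k)) = (0 :: ('i, 'a::comm_ring_1) msym)"
proof -
  let ?hh = "\<lambda>j m. hperp i j (hsf i m :: ('i, 'a) msym)"
  have free: "free_of i ((-1) ^ k :: ('i, 'a) msym)" for k
    by (cases "even k") (simp_all add: free_of_uminus)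
  have prod: "hperp i j (esf i k * hsf i m) =
      esf i k * ?hh j m + (if k > 0 then esf i (k - 1) * ?hh (j - 1) m else 0)" for k m
  proof -
    have "hperp i j (esf i k * hsf i m) = (\<Sum>l\<in>{0, 1}. hperp i l (esf i k) * ?hh (j - l) m)"
      unfolding hperp_mult
      by (rule sum.mono_neutral_right) (use assms in \<open>auto simp: hperp_esf\<close>)
    then show ?thesis by (simp add: hperp_esf)
  qed
  have "hperp i j (\<Sum>k\<le>n. (-1) ^ k * esf i k * hsf i (n - k)) =
      (\<Sum>k\<le>n. (-1) ^ k * (esf i k * ?hh j (n - k))) +
      (\<Sum>k\<le>n. (-1) ^ k * (if k > 0 then esf i (k - 1) * ?hh (j - 1) (n - k) else 0))"
    by (simp only: hperp_sum mult.assoc hperp_free_mult[OF free] prod distrib_left sum.distrib)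
  also have "(\<Sum>k\<le>n. (-1) ^ k * (if k > 0 then esf i (k - 1) * ?hh (j - 1) (n - k) else 0)) =
      - (\<Sum>k\<le>n. (-1) ^ k * (esf i k * ?hh j (n - k)))"
  proof (cases n)
    case 0
    then show ?thesis using assms by (simp add: hperp_1)
  next
    case (Suc n')
    have "(\<Sum>k\<le>n. (-1) ^ k * (if k > 0 then esf i (k - 1) * ?hh (j - 1) (n - k) else 0)) =
        (\<Sum>k\<le>n'. - ((-1) ^ k * (esf i k * ?hh (j - 1) (n' - k))))"
      unfolding Suc sum.atMost_Suc_shift by simp
    also have "\<dots> = (\<Sum>k\<le>n'. - ((-1) ^ k * (esf i k * ?hh j (n - k))))"
    proof (intro sum.cong refl)
      fix k assume "k \<in> {..n'}"
      then have "?hh (j - 1) (n' - k) = ?hh j (n - k)"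
        using assms by (auto simp: hperp_hsf Suc Suc_diff_le)
      then show "- ((-1) ^ k * (esf i k * ?hh (j - 1) (n' - k))) = - ((-1) ^ k * (esf i k * ?hh j (n - k)))"
        by simp
    qed
    also have "\<dots> = (\<Sum>k\<le>n. - ((-1) ^ k * (esf i k * ?hh j (n - k))))"
      using assms by (simp add: Suc hperp_1)
    finally show ?thesis by (simp add: sum_negf)
  qed
  finally show ?thesis by simp
qed

lemma esf_hsf: "(\<Sum>k\<le>n. (-1) ^ k * esf i k * hsf i (n - k)) = (if n = 0 then 1 else 0 :: ('i, 'a::comm_ring_1) msym)"
  (is "?S = ?R")
proof (rule msym_eq_hperps)
  have d: "drop_node i ?S = drop_node i ?R"
  proof -
    have "drop_node i ?S = (\<Sum>k\<le>n. if k = 0 then if n = 0 then 1 else 0 else 0)"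
      unfolding drop_node_sum drop_node_mult by (intro sum.cong refl) simp
    then show ?thesis by simp
  qed
  have 1: "hperp i j ?R = 0" if "j > 0" for j
    using that by (simp add: hperp_free)
  fix l :: "nat list"
  assume l: "0 \<notin> set l"
  show "drop_node i (hperps i l ?S) = drop_node i (hperps i l ?R)"
  proof (cases l)
    case Nil
    then show ?thesis using d by simp
  next
    case (Cons a l')
    then have a: "a > 0" using l by auto
    show ?thesis by (simp only: Cons fold.simps comp_apply hperp_esf_hsf[OF a] 1[OF a])
  qed
qed

text \<open>The subring generated by the functions \<open>h\<^sub>n[X\<^sup>(\<^sup>i\<^sup>)]\<close> over the elements free of \<open>i\<close>; in fact this is
  everything.\<close>

inductive hspan :: "'i \<Rightarrow> ('i, 'a::comm_ring_1) msym \<Rightarrow> bool" for i where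
  free: "free_of i C \<Longrightarrow> hspan i C"
| add: "hspan i F \<Longrightarrow> hspan i G \<Longrightarrow> hspan i (F + G)"
| hsf: "hspan i F \<Longrightarrow> hspan i (hsf i n * F)"

lemma hspan_free_mult: "hspan i F \<Longrightarrow> free_of i C \<Longrightarrow> hspan i (C * F)"
proof (induction rule: hspan.induct)
  case (add F G)
  then show ?case by (simp add: distrib_left hspan.add)
next
  case (hsf F n)
  then show ?case using hspan.hsf[of i "C * F" n] by (simp add: mult.left_commute)
qed (auto intro: hspan.free free_of_mult)

lemma hspan_mult: "hspan i F \<Longrightarrow> hspan i G \<Longrightarrow> hspan i (F * G)"
proof (induction rule: hspan.induct)
  case (free C)
  then show ?case by (intro hspan_free_mult)
next
  case (add F F')
  then show ?case by (simp add: distrib_right hspan.add)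
next
  case (hsf F n)
  then show ?case by (simp add: mult.assoc hspan.hsf)
qed

lemma hspan_1 [simp]: "hspan i 1"
  by (intro hspan.free) simp

lemma hspan_uminus: "hspan i F \<Longrightarrow> hspan i (- F)"
  using hspan_free_mult[of i F "-1"] free_of_uminus[of i 1] by simp

lemma hspan_sum: "(\<And>x. x \<in> I \<Longrightarrow> hspan i (F x)) \<Longrightarrow> hspan i (\<Sum>x\<in>I. F x)"
  by (induction I rule: infinite_finite_induct) (auto intro: hspan.add hspan.free)

lemma hspan_hsf: "hspan i (hsf i n)"
  using hspan.hsf[of i 1 n] by simp

lemma esf_rec:
  assumes "n > 0"
  shows "(-1) ^ n * esf i n = - (\<Sum>k<n. (-1) ^ k * esf i k * hsf i (n - k) :: ('i, 'a::comm_ring_1) msym)"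
  using esf_hsf[of i n] assms
  by (simp add: lessThan_Suc_atMost[symmetric] eq_neg_iff_add_eq_0 add.commute)

lemma hspan_esf: "hspan i ((-1) ^ n * esf i n :: ('i, 'a::comm_ring_1) msym)"
proof (induction n rule: less_induct)
  case (less n)
  show ?case
  proof (cases "n = 0")
    case False
    then show ?thesis
      using less by (subst esf_rec) (auto intro!: hspan_uminus hspan_sum hspan_mult[of _ "_ * esf _ _"] hspan_hsf)
  qed simp
qed

text \<open>The partition left after removing the first column of the diagram.\<close>

definition strip :: "nat multiset \<Rightarrow> nat multiset" where
  "strip l = filter_mset (\<lambda>x. x > 0) (image_mset (\<lambda>x. x - 1) l)"

lemma strip_add: "strip (add_mset n l) = (if n > 1 then add_mset (n - 1) (strip l) else strip l)"
  by (simp add: strip_def)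

lemma drop_hperps_msf:
  "0 \<notin> set l \<Longrightarrow> drop_node i (hperps i l (msf i \<kappa>)) = (if mset l = \<kappa> then 1 else 0)"
proof (induction l arbitrary: \<kappa>)
  case Nil
  then show ?case by (auto simp: drop_node_msf)
next
  case (Cons n l)
  then have n: "n > 0" "0 \<notin> set l" by auto
  show ?case
  proof (cases "n \<in># \<kappa>")
    case True
    then have "mset l = \<kappa> - {#n#} \<longleftrightarrow> add_mset n (mset l) = \<kappa>"
      by (metis add_mset_remove_trivial insert_DiffM)
    with True n show ?thesis by (simp add: hperp_msf Cons.IH)
  next
    case False
    then have "add_mset n (mset l) \<noteq> \<kappa>" by auto
    with False n show ?thesis by (simp add: hperp_msf)
  qed
qed

text \<open>The coefficient of \<open>m\<^sub>l\<close> in \<open>e\<^sub>k m\<^sub>\<kappa>\<close>: a monomial in at most \<open>k\<close> variables can only be divided by a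
  squarefree monomial of degree \<open>k\<close> if it has exactly \<open>k\<close> variables, and then in a single way.\<close>

lemma drop_hperps_esf_msf:
  assumes "0 \<notin> set l" "length l \<le> k"
  shows "drop_node i (hperps i l (esf i k * msf i \<kappa>)) =
    (if length l = k \<and> strip (mset l) = \<kappa> then 1 else 0 :: ('i, 'a::comm_ring_1) msym)"
  using assms
proof (induction l arbitrary: k \<kappa>)
  case Nil
  then show ?case by (auto simp: drop_node_msf drop_node_mult strip_def)
next
  case (Cons n l)
  let ?e = "esf i :: nat \<Rightarrow> ('i, 'a) msym" and ?m = "msf i :: nat multiset \<Rightarrow> ('i, 'a) msym"
  have n: "n > 0" "0 \<notin> set l" using Cons.prems(1) by auto
  obtain k' where k: "k = Suc k'" "length l \<le> k'" using Cons.prems(2) by (cases k) auto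
  have "hperp i n (?e k * ?m \<kappa>) = (\<Sum>j\<in>{0, 1}. hperp i j (?e k) * hperp i (n - j) (?m \<kappa>))"
    unfolding hperp_mult
    by (rule sum.mono_neutral_right) (use n in \<open>auto simp: hperp_esf\<close>)
  then have *: "hperp i n (?e k * ?m \<kappa>) =
      ?e k * hperp i n (?m \<kappa>) + ?e k' * hperp i (n - 1) (?m \<kappa>)"
    by (simp add: hperp_esf k)
  have 1: "drop_node i (hperps i l (?e k * hperp i n (?m \<kappa>))) = 0"
    using Cons.IH[of k "\<kappa> - {#n#}"] n k by (simp add: hperp_msf)
  have 2: "drop_node i (hperps i l (?e k' * hperp i (n - 1) (?m \<kappa>))) =
      (if length l = k' \<and> strip (add_mset n (mset l)) = \<kappa> then 1 else 0)"
  proof (cases "n = 1")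
    case True
    then show ?thesis using Cons.IH[of k' \<kappa>] n k by (simp add: strip_add)
  next
    case False
    with n have n': "n - 1 > 0" "n > 1" by auto
    show ?thesis
    proof (cases "n - 1 \<in># \<kappa>")
      case True
      then have "strip (mset l) = \<kappa> - {#n - 1#} \<longleftrightarrow> add_mset (n - 1) (strip (mset l)) = \<kappa>"
        by (metis add_mset_remove_trivial insert_DiffM)
      with True show ?thesis using Cons.IH[of k' "\<kappa> - {#n - 1#}"] n n' k by (simp add: hperp_msf strip_add)
    next
      case False
      then have "add_mset (n - 1) (strip (mset l)) \<noteq> \<kappa>" by auto
      with False show ?thesis using n' by (simp add: hperp_msf strip_add)
    qed
  qed
  show ?case
    by (simp only: fold.simps comp_apply * hperps_add drop_node_add 1 2) (simp add: k)
qed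

lemma strip_inject:
  assumes "strip l = strip l'" "size l = size l'" "0 \<notin># l" "0 \<notin># l'"
  shows "l = l'"
proof -
  have pred: "image_mset (\<lambda>x. x - 1) l = strip l + replicate_mset (size l - size (strip l)) 0" for l :: "nat multiset"
  proof -
    let ?m = "image_mset (\<lambda>x. x - 1) l"
    have "?m = strip l + filter_mset (\<lambda>x. \<not> x > 0) ?m"
      unfolding strip_def by (rule multiset_partition)
    moreover have "filter_mset (\<lambda>x. \<not> x > 0) ?m = replicate_mset (count ?m 0) 0"
      by (rule multiset_eqI) auto
    moreover have "size ?m = size l" by simp
    ultimately show ?thesis by (metis add_diff_cancel_left' size_replicate_mset size_union)
  qed
  have Suc: "image_mset Suc (image_mset (\<lambda>x. x - 1) l) = l" if "0 \<notin># l" for l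
  proof -
    have "image_mset (\<lambda>x. Suc (x - 1)) l = image_mset (\<lambda>x. x) l"
      by (rule image_mset_cong) (use that in \<open>metis Suc_pred' neq0_conv diff_Suc_1 Suc_diff_1\<close>)
    then show ?thesis by (simp add: multiset.map_comp comp_def)
  qed
  show ?thesis using pred[of l] pred[of l'] Suc[OF assms(3)] Suc[OF assms(4)] assms(1,2) by metis
qed

lemma finite_partitions: "finite {l :: nat multiset. 0 \<notin># l \<and> sum_mset l \<le> n}"
proof (rule finite_subset)
  show "finite (mset ` {xs. set xs \<subseteq> {..n} \<and> length xs \<le> n})"
    by (intro finite_imageI finite_lists_length_le) simp
  show "{l :: nat multiset. 0 \<notin># l \<and> sum_mset l \<le> n} \<subseteq> mset ` {xs. set xs \<subseteq> {..n} \<and> length xs \<le> n}"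
  proof clarify
    fix l :: "nat multiset" assume l: "0 \<notin># l" "sum_mset l \<le> n"
    obtain xs where xs: "mset xs = l" using ex_mset by blast
    have "x \<le> n" if "x \<in> set xs" for x
      using member_le_sum_list[OF that] l(2) by (simp flip: xs add: sum_mset_sum_list)
    moreover have "length xs \<le> sum_list xs" using l(1)
      unfolding xs[symmetric] by (induction xs) (auto simp: Suc_le_eq)
    ultimately show "l \<in> mset ` {xs. set xs \<subseteq> {..n} \<and> length xs \<le> n}"
      using xs l(2) by (intro image_eqI[of _ _ xs]) (auto simp flip: xs simp add: sum_mset_sum_list)
  qed
qed

lemma size_le_sum_mset: "0 \<notin># l \<Longrightarrow> size l \<le> sum_mset l" for l :: "nat multiset"
  by (induction l) auto

lemma sum_strip: "0 \<notin># l \<Longrightarrow> sum_mset (strip l) + size l = sum_mset l"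
  by (induction l) (auto simp: strip_add, simp add: strip_def)

lemma hspan_esf': "hspan i (esf i n)"
proof -
  have "esf i n = (-1) ^ n * ((-1) ^ n * esf i n)" by (simp flip: mult.assoc power_mult_distrib)
  moreover have "hspan i ((-1) ^ n)"
    by (cases "even n") (simp_all add: hspan_uminus)
  ultimately show ?thesis using hspan_mult hspan_esf by metis
qed

lemma drop_node_diff: "drop_node i (F - G) = drop_node i F - drop_node i G"
  using drop_node_add[of i F "- G"] by (simp add: drop_node_uminus)

lemma sum_list_sorted: "sum_list (sorted_list_of_multiset l) = sum_mset l"
  by (metis mset_sorted_list_of_multiset sum_mset_sum_list)

text \<open>Let \<open>k\<close> be the number of parts of \<open>l\<close>. Then \<open>e\<^sub>k m\<^bsub>strip l\<^esub>\<close> is \<open>m\<^sub>l\<close> plus a combination of functions \<open>m\<^sub>\<mu>\<close>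
  where \<open>\<mu>\<close> has more parts and no larger size than \<open>l\<close>, while \<open>strip l\<close> has smaller size. This is
  an induction on the size, and for equal size on the number of parts, downwards.\<close>

lemma hspan_msf: "hspan i (msf i l :: ('i, 'a::comm_ring_1) msym)"
proof (induction l rule: wf_induct_rule[OF wf_measures[of "[sum_mset, \<lambda>l. sum_mset l - size l]"]])
  case (1 l)
  let ?e = "esf i :: nat \<Rightarrow> ('i, 'a) msym" and ?m = "msf i :: nat multiset \<Rightarrow> ('i, 'a) msym"
  have IH: "hspan i (?m l')"
    if "sum_mset l' < sum_mset l \<or> sum_mset l' = sum_mset l \<and> sum_mset l' - size l' < sum_mset l - size l" for l'
    by (rule 1) (use that in auto)
  consider "0 \<in># l" | "l = {#}" | "0 \<notin># l" "l \<noteq> {#}" by blast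
  then show ?case
  proof cases
    case 1
    then show ?thesis by (simp add: msf_zero hspan.free)
  next
    case 2
    then show ?thesis by simp
  next
    case 3
    \<comment> \<open>This difference is the combination of functions \<open>m\<^sub>\<mu>\<close> with more parts.\<close>
    define D where "D = ?e (size l) * ?m (strip l) - ?m l"
    let ?D = "\<lambda>\<mu>. drop_node i (hperps i (sorted_list_of_multiset \<mu>) D)"
    let ?T = "{\<mu>. 0 \<notin># \<mu> \<and> sum_mset \<mu> \<le> sum_mset l} \<inter> {\<mu>. size \<mu> > size l}"
    have deg: "degb (int (sum_mset l)) D"
    proof -
      have "degb (int (size l)) (?e (size l))"
        unfolding esf_def using degb_msf[of "replicate_mset (size l) 1" i] by simp
      from degb_mult[OF this degb_msf] have "degb (int (sum_mset l)) (?e (size l) * ?m (strip l))"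
        using sum_strip[OF 3(1)] by (metis add.commute of_nat_add)
      then show ?thesis unfolding D_def by (intro degb_diff degb_msf)
    qed
    have "D = (\<Sum>\<mu>\<in>?T. ?D \<mu> * ?m \<mu>)"
    proof (rule msf_expansion)
      show "finite ?T" by (intro finite_Int disjI1 finite_partitions)
      fix \<mu> :: "nat multiset" assume \<mu>: "0 \<notin># \<mu>" "?D \<mu> \<noteq> 0"
      have "sum_mset \<mu> \<le> sum_mset l"
      proof (rule ccontr)
        assume "\<not> sum_mset \<mu> \<le> sum_mset l"
        then have "int (sum_mset l) - int (sum_list (sorted_list_of_multiset \<mu>)) < 0"
          unfolding sum_list_sorted by linarith
        from degb_neg[OF degb_hperps[OF deg] this] \<mu>(2) show False by simp
      qed
      moreover have "size l < size \<mu>"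
      proof (rule ccontr)
        assume "\<not> size l < size \<mu>"
        then have len: "length (sorted_list_of_multiset \<mu>) \<le> size l"
          by (metis mset_sorted_list_of_multiset not_le size_mset)
        have 0: "0 \<notin> set (sorted_list_of_multiset \<mu>)" using \<mu>(1) by simp
        have "length (sorted_list_of_multiset \<mu>) = size \<mu>"
          by (metis mset_sorted_list_of_multiset size_mset)
        then have "?D \<mu> = (if size \<mu> = size l \<and> strip \<mu> = strip l then 1 else 0) - (if \<mu> = l then 1 else 0)"
          unfolding D_def hperps_diff drop_node_diff drop_hperps_esf_msf[OF 0 len] drop_hperps_msf[OF 0]
          by simp
        also have "\<dots> = 0" using strip_inject[of \<mu> l] \<mu>(1) 3(1) by auto
        finally show False using \<mu>(2) by simp
      qed
      ultimately show "\<mu> \<in> ?T" using \<mu>(1) by simp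
    qed
    moreover have "hspan i (?m \<mu>)" if "\<mu> \<in> ?T" for \<mu>
      using that size_le_sum_mset[of \<mu>] by (intro IH) auto
    ultimately have "hspan i D"
      by (metis (no_types, lifting) hspan_sum hspan_free_mult free_of_drop_node)
    moreover have "hspan i (?e (size l) * ?m (strip l))"
      using sum_strip[OF 3(1)] 3(2) by (intro hspan_mult hspan_esf' IH) (auto simp: nonempty_has_size)
    ultimately have "hspan i (?e (size l) * ?m (strip l) + - D)"
      by (intro hspan.add hspan_uminus)
    then show ?thesis by (simp add: D_def)
  qed
qed

lemma msf_expansion_finite:
  fixes F :: "('i, 'a::comm_ring_1) msym"
  obtains T where "finite T" "\<And>l. l \<in> T \<Longrightarrow> 0 \<notin># l"
    and "F = (\<Sum>l\<in>T. drop_node i (hperps i (sorted_list_of_multiset l) F) * msf i l)"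
proof -
  obtain d where d: "degb d F" using ex_degb by blast
  let ?T = "{\<mu>. 0 \<notin># \<mu> \<and> sum_mset \<mu> \<le> nat d}"
  have "F = (\<Sum>l\<in>?T. drop_node i (hperps i (sorted_list_of_multiset l) F) * msf i l)"
  proof (rule msf_expansion[OF finite_partitions])
    fix l :: "nat multiset"
    assume l: "0 \<notin># l" and nz: "drop_node i (hperps i (sorted_list_of_multiset l) F) \<noteq> 0"
    have "sum_mset l \<le> nat d"
    proof (rule ccontr)
      assume "\<not> sum_mset l \<le> nat d"
      then have "d - int (sum_list (sorted_list_of_multiset l)) < 0"
        unfolding sum_list_sorted by linarith
      from degb_neg[OF degb_hperps[OF d] this] nz show False by simp
    qed
    with l show "l \<in> ?T" by simp
  qed
  with finite_partitions show thesis by (intro that[of ?T]) auto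
qed

lemma hspan_all: "hspan i F"
proof -
  obtain T where "F = (\<Sum>l\<in>T. drop_node i (hperps i (sorted_list_of_multiset l) F) * msf i l)"
    by (rule msf_expansion_finite)
  also have "hspan i \<dots>"
    by (intro hspan_sum hspan_free_mult hspan_msf free_of_drop_node)
  finally show ?thesis .
qed

section \<open>The Hall inner product\<close>

abbreviation hprod :: "'i \<Rightarrow> nat list \<Rightarrow> ('i, 'a::comm_ring_1) msym" where
  "hprod i l \<equiv> prod_list (map (hsf i) l)"

text \<open>The ways to write \<open>l\<close> as a sum of two vectors of natural numbers.\<close>

fun lsplits :: "nat list \<Rightarrow> (nat list \<times> nat list) set" where
  "lsplits [] = {([], [])}"
| "lsplits (n # l) = (\<lambda>(k, p, q). (k # p, (n - k) # q)) ` ({..n} \<times> lsplits l)"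

lemma sum_lsplits_Cons:
  "(\<Sum>(p, q)\<in>lsplits (n # l). f p q) = (\<Sum>k\<le>n. \<Sum>(p, q)\<in>lsplits l. f (k # p) ((n - k) # q))"
proof -
  have "inj_on (\<lambda>(k, p, q). (k # p, (n - k) # q)) ({..n} \<times> lsplits l)"
    by (auto simp: inj_on_def)
  then show ?thesis
    by (simp add: sum.reindex case_prod_unfold sum.cartesian_product)
qed

lemma hperps_mult: "hperps i l (F * G) = (\<Sum>(p, q)\<in>lsplits l. hperps i p F * hperps i q G)"
proof (induction l arbitrary: F G)
  case (Cons n l)
  then show ?case
    unfolding sum_lsplits_Cons by (simp add: hperp_mult hperps_sum)
qed simp

lemma hperps_hsf: "hperps i l (hsf i m) = (if sum_list l \<le> m then hsf i (m - sum_list l) else 0)"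
  by (induction l arbitrary: m) (auto simp: hperp_hsf)

lemma hperp_hprod: "hperp i n (hprod i l) = (\<Sum>(p, q)\<in>lsplits l. if sum_list p = n then hprod i q else 0 :: ('i, 'a::comm_ring_1) msym)"
proof (induction l arbitrary: n)
  case Nil
  then show ?case by (simp add: hperp_free)
next
  case (Cons m l)
  let ?h = "\<lambda>l. hprod i l :: ('i, 'a) msym"
  have "hperp i n (?h (m # l)) = (\<Sum>k\<le>n. if k \<le> m then
      (\<Sum>(p, q)\<in>lsplits l. if sum_list p = n - k then hsf i (m - k) * ?h q else 0) else 0)"
    by (auto simp: hperp_mult hperp_hsf Cons.IH sum_distrib_left case_prod_unfold intro!: sum.cong)
  also have "\<dots> = (\<Sum>k\<le>m. if k \<le> n then
      (\<Sum>(p, q)\<in>lsplits l. if sum_list p = n - k then hsf i (m - k) * ?h q else 0) else 0)"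
    by (simp add: sum.If_cases Int_commute atMost_def)
  also have "\<dots> = (\<Sum>k\<le>m. \<Sum>(p, q)\<in>lsplits l. if k + sum_list p = n then hsf i (m - k) * ?h q else 0)"
    by (intro sum.cong refl) (auto intro!: sum.cong sum.neutral[symmetric])
  finally show ?case by (simp only: sum_lsplits_Cons sum_list.Cons list.map prod_list.Cons)
qed

lemma drop_hprod: "drop_node i (hprod i l) = (if set l \<subseteq> {0} then 1 else 0)"
  by (induction l) (auto simp: drop_node_mult)

lemma hperps_1: "hperps i l 1 = (if set l \<subseteq> {0} then 1 else 0)"
  by (induction l) (auto simp: hperp_free)

text \<open>Both sides count the matrices of natural numbers with row sums \<open>l\<close> and column sums \<open>l'\<close>. The first
  row is split off the matrix by \<open>hperp_hprod\<close> on the left and by \<open>hperps_mult\<close> on the right.\<close>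

lemma gram_symmetric:
  "drop_node i (hperps i l (hprod i l')) = (drop_node i (hperps i l' (hprod i l)) :: ('i, 'a::comm_ring_1) msym)"
proof (induction l arbitrary: l')
  case Nil
  then show ?case by (simp add: drop_hprod hperps_1)
next
  case (Cons n l)
  let ?N = "\<lambda>l l'. drop_node i (hperps i l (hprod i l')) :: ('i, 'a) msym"
  have "?N (n # l) l' = (\<Sum>(p, q)\<in>lsplits l'. if sum_list p = n then ?N l q else 0)"
    by (auto simp: hperp_hprod hperps_sum drop_node_sum case_prod_unfold intro!: sum.cong)
  also have "\<dots> = (\<Sum>(p, q)\<in>lsplits l'. if sum_list p = n then ?N q l else 0)"
    by (simp only: Cons.IH)
  also have "\<dots> = ?N l' (n # l)"
    by (auto simp: hperps_mult hperps_hsf drop_node_sum drop_node_mult case_prod_unfold intro!: sum.cong)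
  finally show ?case .
qed

text \<open>A list of pairs \<open>(C, l)\<close> represents \<open>\<Sum> C h\<^sub>l\<close> with coefficients \<open>C\<close> free of \<open>i\<close>. The index \<open>0\<close> is
  excluded because the duality that defines the Hall inner product concerns partitions.\<close>

definition valid_rep :: "'i \<Rightarrow> (('i, 'a::comm_ring_1) msym \<times> nat list) list \<Rightarrow> bool" where
  "valid_rep i R \<longleftrightarrow> (\<forall>(C, l)\<in>set R. free_of i C \<and> 0 \<notin> set l)"

definition rep_val :: "'i \<Rightarrow> (('i, 'a::comm_ring_1) msym \<times> nat list) list \<Rightarrow> ('i, 'a) msym" where
  "rep_val i R = (\<Sum>(C, l)\<leftarrow>R. C * hprod i l)"

text \<open>The inner product of the represented element with \<open>G\<close>: pairing with \<open>h\<^sub>l\<close> extracts the coefficient of \<open>m\<^sub>l\<close>.\<close>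

definition rep_act :: "'i \<Rightarrow> (('i, 'a::comm_ring_1) msym \<times> nat list) list \<Rightarrow> ('i, 'a) msym \<Rightarrow> ('i, 'a) msym" where
  "rep_act i R G = (\<Sum>(C, l)\<leftarrow>R. C * drop_node i (hperps i l G))"

lemma rep_act_add: "rep_act i R (F + G) = rep_act i R F + rep_act i R G"
  by (induction R) (auto simp: rep_act_def hperps_add drop_node_add algebra_simps)

lemma rep_act_0 [simp]: "rep_act i R 0 = 0"
  by (induction R) (auto simp: rep_act_def)

lemma rep_act_free_mult: "free_of i C \<Longrightarrow> rep_act i R (C * F) = C * rep_act i R F"
  by (induction R) (auto simp: rep_act_def hperps_free_mult drop_node_mult drop_node_free algebra_simps)

lemma ex_rep: "\<exists>R. valid_rep i R \<and> rep_val i R = F"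
  using hspan_all[of i F]
proof (induction rule: hspan.induct)
  case (free C)
  then show ?case by (intro exI[of _ "[(C, [])]"]) (simp add: valid_rep_def rep_val_def)
next
  case (add F G)
  then obtain R S where "valid_rep i R" "rep_val i R = F" "valid_rep i S" "rep_val i S = G" by blast
  then show ?case by (intro exI[of _ "R @ S"]) (auto simp: valid_rep_def rep_val_def)
next
  case (hsf F n)
  then obtain R where R: "valid_rep i R" "rep_val i R = F" by blast
  show ?case
  proof (cases "n = 0")
    case True
    then show ?thesis using R by auto
  next
    case False
    have "rep_val i (map (\<lambda>(C, l). (C, n # l)) R) = hsf i n * rep_val i R"
      by (induction R) (auto simp: rep_val_def algebra_simps)
    moreover have "valid_rep i (map (\<lambda>(C, l). (C, n # l)) R)"
      using R(1) False by (auto simp: valid_rep_def)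
    ultimately show ?thesis using R(2) by blast
  qed
qed

lemma rep_act_rep_val:
  assumes "valid_rep i R" "valid_rep i S"
  shows "rep_act i R (rep_val i S) = rep_act i S (rep_val i R)"
proof -
  have sum0: "rep_act i R (\<Sum>x\<leftarrow>xs. f x) = (\<Sum>x\<leftarrow>xs. rep_act i R (f x))"
    for R and xs :: "(('a, 'b) msym \<times> nat list) list" and f
    by (induction xs) (auto simp: rep_act_add)
  have "rep_act i R (rep_val i S) = (\<Sum>(D, k)\<leftarrow>S. \<Sum>(C, l)\<leftarrow>R. C * D * drop_node i (hperps i l (hprod i k)))"
    if "valid_rep i S" for R S :: "(('a, 'b) msym \<times> nat list) list"
  proof -
    have "rep_act i R (D * hprod i k) = (\<Sum>(C, l)\<leftarrow>R. C * D * drop_node i (hperps i l (hprod i k)))"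
      if "(D, k) \<in> set S" for D k
    proof -
      have "free_of i D" using that \<open>valid_rep i S\<close> by (auto simp: valid_rep_def)
      then have "rep_act i R (D * hprod i k) = D * rep_act i R (hprod i k)"
        by (rule rep_act_free_mult)
      also have "\<dots> = (\<Sum>(C, l)\<leftarrow>R. C * D * drop_node i (hperps i l (hprod i k)))"
        by (induction R) (auto simp: rep_act_def algebra_simps)
      finally show ?thesis .
    qed
    then show ?thesis unfolding rep_val_def sum0 by (intro arg_cong[of _ _ sum_list] map_cong) auto
  qed
  note * = this
  have swap: "(\<Sum>x\<leftarrow>xs. \<Sum>y\<leftarrow>ys. f x y) = (\<Sum>y\<leftarrow>ys. \<Sum>x\<leftarrow>xs. f x y)"
    for xs ys :: "(('a, 'b) msym \<times> nat list) list" and f :: "_ \<Rightarrow> _ \<Rightarrow> ('a, 'b) msym"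
    by (induction xs) (auto simp: sum_list_addf)
  show ?thesis
    unfolding *[OF assms(1)] *[OF assms(2)] case_prod_unfold
    by (subst swap) (simp add: gram_symmetric mult.commute)
qed

text \<open>By the symmetry of the Gram matrix, \<open>R\<close> acts on the value of \<open>T\<close> as \<open>T\<close> acts on the value of \<open>R\<close>. Since
  every \<open>G\<close> is the value of some \<open>T\<close>, the action of \<open>R\<close> only depends on the value of \<open>R\<close>.\<close>

lemma rep_act_cong:
  assumes "valid_rep i R" "valid_rep i S" "rep_val i R = rep_val i S"
  shows "rep_act i R G = rep_act i S G"
proof -
  obtain T where T: "valid_rep i T" "rep_val i T = G" using ex_rep[of i G] by blast
  show ?thesis
    using rep_act_rep_val[OF assms(1) T(1)] rep_act_rep_val[OF assms(2) T(1)] assms(3) T(2) by simp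
qed

definition hall_form :: "'i \<Rightarrow> ('i, 'a::comm_ring_1) msym \<Rightarrow> ('i, 'a) msym \<Rightarrow> ('i, 'a) msym" where
  "hall_form i F = rep_act i (SOME R. valid_rep i R \<and> rep_val i R = F)"

lemma hall_form_eq:
  assumes "valid_rep i R" "rep_val i R = F"
  shows "hall_form i F G = rep_act i R G"
proof -
  have "valid_rep i (SOME R. valid_rep i R \<and> rep_val i R = F) \<and>
      rep_val i (SOME R. valid_rep i R \<and> rep_val i R = F) = F"
    by (rule someI_ex) (rule ex_rep)
  then show ?thesis unfolding hall_form_def using assms by (intro rep_act_cong) auto
qed

lemma hall_form_hprod:
  "0 \<notin> set l \<Longrightarrow> hall_form i (hprod i l) G = drop_node i (hperps i l G)"
  by (subst hall_form_eq[of i "[(1, l)]"]) (simp_all add: valid_rep_def rep_val_def rep_act_def)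

lemma prod_mset_hsf: "(\<Prod>k\<in>#l. hsf i k) = hprod i (sorted_list_of_multiset l)"
  by (metis mset_map mset_sorted_list_of_multiset prod_mset_prod_list)

lemma is_hall_hall_form: "is_hall i (hall_form i :: ('i, 'a::comm_ring_1) msym \<Rightarrow> _)"
  unfolding is_hall_def
proof (intro conjI allI impI)
  fix F F' G G' C :: "('i, 'a) msym"
  obtain R where R: "valid_rep i R" "rep_val i R = F" using ex_rep[of i F] by blast
  obtain R' where R': "valid_rep i R'" "rep_val i R' = F'" using ex_rep[of i F'] by blast
  have "valid_rep i (R @ R')" "rep_val i (R @ R') = F + F'" "rep_act i (R @ R') G = rep_act i R G + rep_act i R' G"
    using R R' by (auto simp: valid_rep_def rep_val_def rep_act_def)
  then show "hall_form i (F + F') G = hall_form i F G + hall_form i F' G"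
    using hall_form_eq R R' by metis
  show "hall_form i F (G + G') = hall_form i F G + hall_form i F G'"
    unfolding hall_form_eq[OF R] by (rule rep_act_add)
  assume C: "free_of i C"
  show "hall_form i F (C * G) = C * hall_form i F G"
    unfolding hall_form_eq[OF R] by (rule rep_act_free_mult[OF C])
  have "valid_rep i (map (\<lambda>(D, l). (C * D, l)) R)" using R(1) C by (auto simp: valid_rep_def free_of_mult)
  moreover have "rep_val i (map (\<lambda>(D, l). (C * D, l)) R) = C * F"
    unfolding R(2)[symmetric] by (induction R) (auto simp: rep_val_def algebra_simps)
  moreover have "rep_act i (map (\<lambda>(D, l). (C * D, l)) R) G = C * rep_act i R G"
    by (induction R) (auto simp: rep_act_def algebra_simps)
  ultimately show "hall_form i (C * F) G = C * hall_form i F G"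
    using hall_form_eq R by metis
next
  fix l l' :: "nat multiset"
  assume l: "0 \<notin># l" "0 \<notin># l'"
  then show "hall_form i (\<Prod>k\<in>#l. hsf i k) (msf i l') = (if l = l' then 1 else 0 :: ('i, 'a) msym)"
    by (simp add: prod_mset_hsf hall_form_hprod drop_hperps_msf)
qed

text \<open>Over the elements free of \<open>i\<close>, the first argument is a combination of products of complete
  symmetric functions, and the second one of monomial symmetric functions.\<close>

lemma is_hall_unique:
  fixes B B' :: "('i, 'a::comm_ring_1) msym \<Rightarrow> ('i, 'a) msym \<Rightarrow> ('i, 'a) msym"
  assumes "is_hall i B" "is_hall i B'"
  shows "B = B'"
proof (intro ext)
  fix F G :: "('i, 'a) msym"
  have add1: "B (F + F') G = B F G + B F' G" and add2: "B F (G + G') = B F G + B F G'"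
    and mult1: "free_of i C \<Longrightarrow> B (C * F) G = C * B F G" and mult2: "free_of i C \<Longrightarrow> B F (C * G) = C * B F G"
    and dual: "0 \<notin># l \<Longrightarrow> 0 \<notin># l' \<Longrightarrow> B (\<Prod>k\<in>#l. hsf i k) (msf i l') = (if l = l' then 1 else 0)"
    if "is_hall i B" for F F' G G' C l l' and B :: "('i, 'a) msym \<Rightarrow> ('i, 'a) msym \<Rightarrow> ('i, 'a) msym"
    using that unfolding is_hall_def by blast+
  have zero: "B 0 G = 0" "B F 0 = 0" if "is_hall i B" for F G and B :: "('i, 'a) msym \<Rightarrow> ('i, 'a) msym \<Rightarrow> ('i, 'a) msym"
    using add1[OF that, of 0 0 G] add2[OF that, of F 0 0] by simp_all
  have sum2: "B F (\<Sum>x\<in>I. g x) = (\<Sum>x\<in>I. B F (g x))" if "is_hall i B" for F g and B :: "('i, 'a) msym \<Rightarrow> ('i, 'a) msym \<Rightarrow> ('i, 'a) msym" and I :: "nat multiset set"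
    by (induction I rule: infinite_finite_induct) (auto simp: zero[OF that] add2[OF that])
  have sum1: "B (\<Sum>x\<leftarrow>xs. f x) G = (\<Sum>x\<leftarrow>xs. B (f x) G)" if "is_hall i B" for G f and B :: "('i, 'a) msym \<Rightarrow> ('i, 'a) msym \<Rightarrow> ('i, 'a) msym"
    and xs :: "(('i, 'a) msym \<times> nat list) list"
    by (induction xs) (auto simp: zero[OF that] add1[OF that])
  obtain R where R: "valid_rep i R" "rep_val i R = F" using ex_rep[of i F] by blast
  obtain T where T: "\<And>l. l \<in> T \<Longrightarrow> 0 \<notin># l"
    and G: "G = (\<Sum>l\<in>T. drop_node i (hperps i (sorted_list_of_multiset l) G) * msf i l)"
    by (rule msf_expansion_finite[of G i]) (rule that)
  define D where "D l = drop_node i (hperps i (sorted_list_of_multiset l) G)" for l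
  have G: "G = (\<Sum>l\<in>T. D l * msf i l)" unfolding D_def by (rule G)
  have freeD: "free_of i (D l)" for l by (simp add: D_def free_of_drop_node)
  have *: "B F G = (\<Sum>(C, l)\<leftarrow>R. C * (\<Sum>k\<in>T. D k * (if mset l = k then 1 else 0)))" if "is_hall i B" for B :: "('i, 'a) msym \<Rightarrow> ('i, 'a) msym \<Rightarrow> ('i, 'a) msym"
  proof -
    have "B (C * hprod i l) G = C * (\<Sum>k\<in>T. D k * (if mset l = k then 1 else 0))" if "(C, l) \<in> set R" for C l
    proof -
      have C: "free_of i C" "0 \<notin># mset l" using that R(1) by (auto simp: valid_rep_def)
      have "(hprod i l :: ('i, 'a) msym) = (\<Prod>k\<in>#mset l. hsf i k)"
        by (simp flip: prod_mset_prod_list)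
      then have "B (hprod i l) (D k * msf i k) = D k * (if mset l = k then 1 else 0)" if "k \<in> T" for k
        using dual[OF \<open>is_hall i B\<close> C(2) T[OF that]] by (simp add: mult2[OF \<open>is_hall i B\<close> freeD])
      then have "B (hprod i l) G = (\<Sum>k\<in>T. D k * (if mset l = k then 1 else 0))"
        unfolding sum2[OF \<open>is_hall i B\<close>] by (subst G) (simp add: sum2[OF \<open>is_hall i B\<close>])
      then show ?thesis by (simp add: mult1[OF \<open>is_hall i B\<close> C(1)])
    qed
    then show ?thesis
      unfolding R(2)[symmetric] rep_val_def sum1[OF that] by (intro arg_cong[of _ _ sum_list] map_cong) auto
  qed
  show "B F G = B' F G" unfolding *[OF assms(1)] *[OF assms(2)] ..
qed

lemma hall_eq: "hall i = hall_form i"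
  unfolding hall_def by (rule the_equality) (auto intro: is_hall_hall_form is_hall_unique)

definition adjoint_of :: "'i \<Rightarrow> ('i, 'a::comm_ring_1) msym \<Rightarrow> (('i, 'a) msym \<Rightarrow> ('i, 'a) msym) \<Rightarrow> bool" where
  "adjoint_of i f T \<longleftrightarrow> (\<forall>K F. hall i K (T F) = hall i (f * K) F)"

text \<open>An adjoint is unique because pairing with the products \<open>h\<^sub>l\<close> determines all coefficients.\<close>

lemma perp_adjoint:
  assumes "adjoint_of i f T"
  shows "perp i f F = T F"
  unfolding perp_def
proof (rule the_equality)
  show "\<forall>K. hall i K (T F) = hall i (f * K) F" using assms by (simp add: adjoint_of_def)
  fix G assume G: "\<forall>K. hall i K G = hall i (f * K) F"
  show "G = T F"
  proof (rule msym_eq_hperps)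
    fix l :: "nat list" assume l: "0 \<notin> set l"
    have "hall i (hprod i l) G = hall i (hprod i l) (T F)"
      using G assms by (simp add: adjoint_of_def)
    then show "drop_node i (hperps i l G) = drop_node i (hperps i l (T F))"
      by (simp add: hall_eq hall_form_hprod[OF l])
  qed
qed

lemma hall_linear:
  shows "hall i (F + F') G = hall i F G + hall i F' G"
    and "hall i F (G + G') = hall i F G + hall i F G'"
    and "hall i (- F) G = - hall i F G"
    and "hall i F (- G) = - hall i F G"
    and "hall i 0 G = 0" and "hall i F 0 = 0"
proof -
  have add: "hall i (F + F') G = hall i F G + hall i F' G"
    "hall i F (G + G') = hall i F G + hall i F G'" for F F' G G'
    using is_hall_hall_form[of i] unfolding hall_eq is_hall_def by blast+
  show "hall i (F + F') G = hall i F G + hall i F' G"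
    "hall i F (G + G') = hall i F G + hall i F G'" by (rule add)+
  show 0: "hall i 0 G = 0" "hall i F 0 = 0" for F G
    using add(1)[of 0 0 G] add(2)[of F 0 0] by simp_all
  show "hall i (- F) G = - hall i F G" using add(1)[of F "- F" G] by (simp add: 0 eq_neg_iff_add_eq_0 add.commute)
  show "hall i F (- G) = - hall i F G" using add(2)[of F G "- G"] by (simp add: 0 eq_neg_iff_add_eq_0 add.commute)
qed

text \<open>Prefixing \<open>n\<close> to all index lists of a representation multiplies its value by \<open>h\<^sub>n\<close> and composes its
  action with \<open>hperp i n\<close>.\<close>

lemma adjoint_hsf: "adjoint_of i (hsf i n) (hperp i n)"
  unfolding adjoint_of_def
proof (intro allI)
  fix K F :: "('a, 'b) msym"
  show "hall i K (hperp i n F) = hall i (hsf i n * K) F"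
  proof (cases "n = 0")
    case False
    obtain R where R: "valid_rep i R" "rep_val i R = K" using ex_rep[of i K] by blast
    have "rep_val i (map (\<lambda>(C, l). (C, n # l)) R) = hsf i n * rep_val i R"
      by (induction R) (auto simp: rep_val_def algebra_simps)
    moreover have "valid_rep i (map (\<lambda>(C, l). (C, n # l)) R)"
      using R(1) False by (auto simp: valid_rep_def)
    moreover have "rep_act i (map (\<lambda>(C, l). (C, n # l)) R) F = rep_act i R (hperp i n F)"
      by (induction R) (auto simp: rep_act_def)
    ultimately show ?thesis unfolding hall_eq using hall_form_eq R by metis
  qed simp
qed

lemma adjoint_mult: "adjoint_of i f S \<Longrightarrow> adjoint_of i g T \<Longrightarrow> adjoint_of i (f * g) (\<lambda>F. S (T F))"
  by (simp add: adjoint_of_def mult_ac)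

lemma adjoint_uminus: "adjoint_of i f S \<Longrightarrow> adjoint_of i (- f) (\<lambda>F. - S F)"
  by (simp add: adjoint_of_def hall_linear)

lemma adjoint_sum:
  assumes "\<And>x. x \<in> I \<Longrightarrow> adjoint_of i (f x) (T x)"
  shows "adjoint_of i (\<Sum>x\<in>I. f x) (\<lambda>F. \<Sum>x\<in>I. T x F)"
  using assms
proof (induction I rule: infinite_finite_induct)
  case (insert x I)
  then show ?case by (simp add: adjoint_of_def distrib_right hall_linear)
qed (auto simp: adjoint_of_def hall_linear)

section \<open>Adjoints of multiplication by elementary symmetric functions\<close>

text \<open>The coefficients of the inverse of the series \<open>\<Sum>\<^sub>n u\<^sup>n hperp i n\<close>, that is, of \<open>F[X\<^sup>(\<^sup>i\<^sup>) - u]\<close>. By the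
  recursion \<open>esf_rec\<close> they are the adjoints of multiplication by \<open>(-1)\<^sup>n e\<^sub>n\<close>.\<close>

context
  notes sum.cong [fundef_cong]
begin

fun eperp :: "'i \<Rightarrow> nat \<Rightarrow> ('i, 'a::comm_ring_1) msym \<Rightarrow> ('i, 'a) msym" where
  "eperp i n F = (if n = 0 then F else - (\<Sum>k<n. eperp i k (hperp i (n - k) F)))"

end

declare eperp.simps [simp del]

lemma eperp_0 [simp]: "eperp i 0 F = F"
  by (simp add: eperp.simps)

lemma eperp_rec: "(\<Sum>k\<le>n. eperp i k (hperp i (n - k) F)) = (if n = 0 then F else 0)"
  using eperp.simps[of i n F] by (simp add: lessThan_Suc_atMost[symmetric])

lemma adjoint_eperp: "adjoint_of i ((-1) ^ n * esf i n) (eperp i n)"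
proof (induction n rule: less_induct)
  case (less n)
  show ?case
  proof (cases "n = 0")
    case True
    have "eperp i 0 = (\<lambda>F. F)" by (rule ext) simp
    with True show ?thesis by (simp add: adjoint_of_def)
  next
    case False
    then have e: "eperp i n = (\<lambda>F. - (\<Sum>k<n. eperp i k (hperp i (n - k) F)))"
      by (intro ext) (simp add: eperp.simps[of i n])
    show ?thesis
      unfolding e using False
      by (subst esf_rec, simp only: neq0_conv)
        (rule adjoint_uminus, rule adjoint_sum, rule adjoint_mult[OF less adjoint_hsf], simp)
  qed
qed

lemma perp_hsf: "perp i (hsf i n) F = hperp i n F"
  by (rule perp_adjoint[OF adjoint_hsf])

lemma perp_esf: "const ((-1) ^ n) * perp i (esf i n) F = eperp i n F"
proof -
  have sgn: "(const ((-1) ^ n) :: ('a, 'b) msym) = (-1) ^ n"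
  proof -
    have "(const (-1) :: ('a, 'b) msym) = - 1"
      using const_add[of 1 "-1 :: 'b", where ?'a = 'a] by (simp add: const_1 eq_neg_iff_add_eq_0 add.commute)
    then show ?thesis by (simp add: const_power)
  qed
  have s: "(-1) ^ n * ((-1) ^ n * F) = F" for F :: "('a, 'b) msym"
    by (simp flip: mult.assoc power_mult_distrib)
  have move: "hall i K ((-1) ^ n * G) = hall i ((-1) ^ n * K) G" for K G :: "('a, 'b) msym"
    by (cases "even n") (simp_all add: hall_linear)
  have "adjoint_of i (esf i n) (\<lambda>F :: ('a, 'b) msym. (-1) ^ n * eperp i n F)"
    unfolding adjoint_of_def
  proof (intro allI)
    fix K F :: "('a, 'b) msym"
    have "hall i K ((-1) ^ n * eperp i n F) = hall i ((-1) ^ n * esf i n * ((-1) ^ n * K)) F"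
      unfolding move by (rule adjoint_eperp[unfolded adjoint_of_def, rule_format])
    also have "(-1) ^ n * esf i n * ((-1) ^ n * K) = (-1) ^ n * ((-1) ^ n * (esf i n * K))"
      by (simp only: mult.assoc mult.left_commute)
    finally show "hall i K ((-1) ^ n * eperp i n F) = hall i (esf i n * K) F" by (simp only: s)
  qed
  from perp_adjoint[OF this] show ?thesis by (simp only: sgn s)
qed

section \<open>Linearity of the adjoint operators\<close>

lemma eperp_add: "eperp i n (F + G) = eperp i n F + eperp i n G"
proof (induction n arbitrary: F G rule: less_induct)
  case (less n)
  then show ?case
    by (cases "n = 0") (simp_all add: eperp.simps[of i n] hperp_add sum.distrib)
qed

lemma eperp_zero [simp]: "eperp i n 0 = 0"
  using eperp_add[of i n 0 0] by simp

lemma eperp_sum: "eperp i n (\<Sum>x\<in>I. F x) = (\<Sum>x\<in>I. eperp i n (F x))"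
  by (induction I rule: infinite_finite_induct) (auto simp: eperp_add)

lemma eperp_free_mult: "free_of i C \<Longrightarrow> eperp i n (C * F) = C * eperp i n F"
proof (induction n arbitrary: F rule: less_induct)
  case (less n)
  then show ?case
    by (cases "n = 0") (simp_all add: eperp.simps[of i n] hperp_free_mult sum_distrib_left)
qed

lemma degb_eperp: "degb d F \<Longrightarrow> degb (d - int n) (eperp i n F)"
proof (induction n arbitrary: F d rule: less_induct)
  case (less n)
  show ?case
  proof (cases "n = 0")
    case False
    have "degb (d - int n) (eperp i k (hperp i (n - k) F))" if "k < n" for k
    proof -
      have "d - int (n - k) - int k = d - int n" using that by simp
      then show ?thesis using less.IH[OF that degb_hperp[OF less.prems, of "n - k"]] by metis
    qed
    with False show ?thesis
      by (simp add: eperp.simps[of i n]) (intro degb_uminus degb_sum, simp)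
  qed (use less.prems in simp)
qed

lemma free_of_hperp: "free_of i F \<Longrightarrow> free_of i (hperp j n F)"
  for F :: "('i, 'a::comm_ring_1) msym"
  unfolding free_of_def[of i "hperp j n F"]
proof (intro allI impI)
  fix m :: "'i mon"
  assume F: "free_of i F" and nz: "coef (hperp j n F) m \<noteq> 0"
  obtain k where k: "(j, k) \<notin> keys m" using ex_fresh[of j m] ..
  have "i \<notin> fst ` keys (m + single (j, k) n)"
    using F nz unfolding coef_hperp[OF k] free_of_def by simp
  then show "i \<notin> fst ` keys m" by (simp add: keys_add_nat image_Un)
qed

text \<open>The coefficient of \<open>z\<^sup>-\<^sup>n\<close> in \<open>\<Omega>[-z\<^sup>-\<^sup>1 (X\<^sup>(\<^sup>i\<^sup>) - t X\<^sup>(\<^sup>j\<^sup>))]\<^sup>\<bottom> F\<close>, which is \<open>F\<close> with \<open>1/z\<close> subtracted from \<open>X\<^sup>(\<^sup>i\<^sup>)\<close> and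
  \<open>t/z\<close> added to \<open>X\<^sup>(\<^sup>j\<^sup>)\<close>.\<close>

definition vperp :: "'a \<Rightarrow> 'i \<Rightarrow> 'i \<Rightarrow> nat \<Rightarrow> ('i, 'a::comm_ring_1) msym \<Rightarrow> ('i, 'a) msym" where
  "vperp t i j n F = (\<Sum>p\<le>n. eperp i p (const (t ^ (n - p)) * hperp j (n - p) F))"

lemma vperp_add: "vperp t i j n (F + G) = vperp t i j n F + vperp t i j n G"
  by (simp add: vperp_def hperp_add distrib_left eperp_add sum.distrib)

lemma vperp_zero [simp]: "vperp t i j n 0 = 0"
  by (simp add: vperp_def)

lemma degb_const_mult: "degb d F \<Longrightarrow> degb d (const c * F)"
  using degb_mult[OF degb_const] by fastforce

lemma degb_vperp: "degb d F \<Longrightarrow> degb (d - int n) (vperp t i j n F)"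
  unfolding vperp_def
proof (rule degb_sum)
  fix p assume F: "degb d F" and p: "p \<in> {..n}"
  have "degb (d - int (n - p) - int p) (eperp i p (const (t ^ (n - p)) * hperp j (n - p) F))"
    by (intro degb_eperp degb_const_mult degb_hperp F)
  moreover have "d - int (n - p) - int p = d - int n" using p by simp
  ultimately show "degb (d - int n) (eperp i p (const (t ^ (n - p)) * hperp j (n - p) F))" by simp
qed

section \<open>Products of series in one variable each\<close>

definition univariate :: "nat \<Rightarrow> 'm::comm_monoid_add opseries \<Rightarrow> bool" where
  "univariate k A \<longleftrightarrow> (\<forall>\<beta> F. \<beta> \<notin> range (single k) \<longrightarrow> A \<beta> F = 0) \<and> (\<forall>\<beta>. A \<beta> 0 = 0)"

lemma Sum_any_single: "(\<And>x. x \<noteq> c \<Longrightarrow> f x = 0) \<Longrightarrow> Sum_any f = f c"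
  by (subst Sum_any.expand_superset[of "{c}"]) auto

text \<open>Each factor is a series in a variable of its own, so an exponent vector prescribes the exponent to
  be taken from every factor, and the convolutions have a single term.\<close>

lemma foldr_op_mult:
  assumes "distinct ks" "\<And>k. k \<in> set ks \<Longrightarrow> univariate k (A k)"
  shows "foldr (\<lambda>k. op_mult (A k)) ks op_one \<beta> F = (if keys \<beta> \<subseteq> set ks
    then foldr (\<lambda>k. A k (single k (lookup \<beta> k))) ks F else 0)"
  using assms
proof (induction ks arbitrary: \<beta>)
  case Nil
  then show ?case by (simp add: op_one_def)
next
  case (Cons k ks)
  let ?B = "foldr (\<lambda>k. op_mult (A k)) ks op_one"
  let ?\<gamma> = "single k (lookup \<beta> k)"
  have IH: "?B \<beta> F = (if keys \<beta> \<subseteq> set ks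
      then foldr (\<lambda>k. A k (single k (lookup \<beta> k))) ks F else 0)" for \<beta>
    using Cons.prems by (intro Cons.IH) auto
  have u: "univariate k (A k)" and k: "k \<notin> set ks" using Cons.prems by auto
  have "A k \<gamma> (?B (\<beta> - \<gamma>) F) = 0" if "\<gamma> \<noteq> ?\<gamma>" for \<gamma>
  proof (cases "\<gamma> \<in> range (single k)")
    case True
    then obtain e where e: "\<gamma> = single k e" by blast
    with that have "lookup (\<beta> - \<gamma>) k \<noteq> 0" by (auto simp: lookup_minus)
    then have "\<not> keys (\<beta> - \<gamma>) \<subseteq> set ks" using k by (auto simp: in_keys_iff)
    then have "?B (\<beta> - \<gamma>) F = 0" by (simp add: IH)
    then show ?thesis using u by (simp add: univariate_def)
  qed (use u in \<open>simp add: univariate_def\<close>)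
  then have "op_mult (A k) ?B \<beta> F = A k ?\<gamma> (?B (\<beta> - ?\<gamma>) F)"
    unfolding op_mult_def by (rule Sum_any_single)
  moreover have "keys (\<beta> - ?\<gamma>) \<subseteq> set ks \<longleftrightarrow> keys \<beta> \<subseteq> set (k # ks)"
  proof -
    have "keys (\<beta> - ?\<gamma>) = keys \<beta> - {k}"
      by (auto simp: in_keys_iff lookup_minus lookup_single when_def split: if_splits)
    then show ?thesis by auto
  qed
  moreover have "foldr (\<lambda>l. A l (single l (lookup (\<beta> - ?\<gamma>) l))) ks F =
      foldr (\<lambda>l. A l (single l (lookup \<beta> l))) ks F"
    using k by (intro foldr_cong) (auto simp: lookup_minus lookup_single when_def)
  ultimately show ?case using u by (auto simp: IH univariate_def)
qed

lemma foldr_eq_0: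
  assumes "k \<in> set ks" "\<And>F. T k F = 0" "\<And>k. T k 0 = 0"
  shows "foldr T ks F = 0"
  using assms(1) by (induction ks) (auto simp: assms(2,3))

lemma foldr_mult: "foldr (\<lambda>k. (*) (f k)) [0..<a] G = (\<Prod>k<a. f k) * G" for G :: "'m::comm_monoid_mult"
  by (induction a arbitrary: G) (auto simp: mult.assoc)

lemma up_series_single: "up_series k c (single k e) F = (if e < 0 then 0 else c (nat e) F)"
proof -
  have "{n. single k (int n) = single k e} = (if e < 0 then {} else {nat e})"
    by (auto dest: injD[OF inj_single])
  then show ?thesis by (simp add: up_series_def)
qed

lemma up_series_other: "\<beta> \<notin> range (single k) \<Longrightarrow> up_series k c \<beta> F = 0"
  unfolding up_series_def by (rule sum.neutral) auto

lemma down_series_single: "down_series k c (single k e) F = (if e > 0 then 0 else c (nat (- e)) F)"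
proof -
  have "{n. single k (- int n) = single k e} = (if e > 0 then {} else {nat (- e)})"
    by (auto dest: injD[OF inj_single])
  then show ?thesis by (simp add: down_series_def)
qed

lemma down_series_other: "\<beta> \<notin> range (single k) \<Longrightarrow> down_series k c \<beta> F = 0"
  unfolding down_series_def by (rule sum.neutral) auto

lemma op_prod_Omega: "op_prod a (Omega i) \<kappa> F = seq_mon a (hsf i) \<kappa> * F"
  for F :: "('i, 'a::comm_ring_1) msym"
proof -
  have u: "univariate k (Omega i k :: ('i, 'a) msym opseries)" for k
    by (auto simp: univariate_def Omega_def up_series_other) (simp add: up_series_def)
  have "Omega i k (single k e) = (*) (int_nth (hsf i) e :: ('i, 'a) msym)" for k e
    by (auto simp: Omega_def up_series_single int_nth_def)
  then show ?thesis
    unfolding op_prod_def foldr_op_mult[of "[0..<a]" "Omega i", OF distinct_upt u]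
    by (simp add: foldr_mult seq_mon_def atLeast0LessThan)
qed

lemma Omega_perp_single:
  "Omega_perp t i j k (single k e) F = (if e > 0 then 0 else vperp t i j (nat (- e)) F)"
proof -
  let ?s = "single k :: int \<Rightarrow> expo"
  let ?t = "\<lambda>\<gamma>. down_series k (eperp i) \<gamma>
    (down_series k (\<lambda>n F. const (t ^ n) * hperp j n F) (?s e - \<gamma>) F)"
  have z: "down_series k (eperp i) \<gamma> 0 = 0" for \<gamma>
    by (simp add: down_series_def)
  have t: "?t (?s x) = (if x > 0 \<or> e > x then 0 else eperp i (nat (- x)) (const (t ^ nat (x - e)) * hperp j (nat (x - e)) F))" for x
    by (simp add: down_series_single flip: single_diff)
  have eq: "Omega_perp t i j k (?s e) F = Sum_any ?t"
    by (simp add: Omega_perp_def op_mult_def perp_esf perp_hsf)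
  show ?thesis
  proof (cases "e > 0")
    case True
    have "?t \<gamma> = 0" for \<gamma>
      using t True by (cases "\<gamma> \<in> range ?s") (auto simp: down_series_other)
    then show ?thesis using True by (simp add: eq)
  next
    case False
    have "Sum_any ?t = (\<Sum>\<gamma>\<in>(\<lambda>p. ?s (- int p)) ` {..nat (- e)}. ?t \<gamma>)"
    proof (rule Sum_any.expand_superset)
      show "{\<gamma>. ?t \<gamma> \<noteq> 0} \<subseteq> (\<lambda>p. ?s (- int p)) ` {..nat (- e)}"
      proof
        fix \<gamma> assume "\<gamma> \<in> {\<gamma>. ?t \<gamma> \<noteq> 0}"
        then have nz: "?t \<gamma> \<noteq> 0" by simp
        then obtain x where x: "\<gamma> = ?s x" using down_series_other by blast
        then have "x \<le> 0" "e \<le> x" using nz t[of x] by (auto split: if_splits)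
        then show "\<gamma> \<in> (\<lambda>p. ?s (- int p)) ` {..nat (- e)}"
          by (intro image_eqI[of _ _ "nat (- x)"]) (auto simp: x)
      qed
    qed simp
    also have "\<dots> = (\<Sum>p\<le>nat (- e). ?t (?s (- int p)))"
      by (rule sum.reindex_cong[of "\<lambda>p. ?s (- int p)"])
        (auto intro!: inj_onI dest: injD[OF inj_single])
    also have "\<dots> = vperp t i j (nat (- e)) F"
      unfolding vperp_def t
    proof (intro sum.cong refl)
      fix p assume "p \<in> {..nat (- e)}"
      then have "nat (- int p - e) = nat (- e) - p" "\<not> (- int p > 0 \<or> e > - int p)"
        using False by auto
      then show "(if - int p > 0 \<or> e > - int p then 0 else eperp i (nat (- (- int p)))
          (const (t ^ nat (- int p - e)) * hperp j (nat (- int p - e)) F)) =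
          eperp i p (const (t ^ (nat (- e) - p)) * hperp j (nat (- e) - p) F)" by simp
    qed
    finally show ?thesis using False by (simp add: eq)
  qed
qed

lemma Omega_perp_univariate: "univariate k (Omega_perp t i j k)"
proof -
  let ?s = "single k :: int \<Rightarrow> expo"
  have z: "down_series k (eperp i) \<gamma> 0 = 0" for \<gamma>
    by (simp add: down_series_def)
  have "down_series k (eperp i) \<gamma> (down_series k (\<lambda>n F. const (t ^ n) * hperp j n F) (\<beta> - \<gamma>) F) = 0"
    if "\<beta> \<notin> range ?s" for \<beta> \<gamma> F
  proof (cases "\<gamma> \<in> range ?s \<and> \<beta> - \<gamma> \<in> range ?s")
    case True
    then obtain x y where "\<gamma> = ?s x" "\<beta> - \<gamma> = ?s y" by blast
    then have "\<beta> = ?s (x + y)" by (simp add: single_add algebra_simps)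
    with that show ?thesis by blast
  next
    case False
    then show ?thesis by (auto simp: down_series_other z)
  qed
  moreover have "Omega_perp t i j k \<beta> 0 = 0" for \<beta>
    by (simp add: Omega_perp_def op_mult_def perp_esf perp_hsf down_series_def)
  ultimately show ?thesis
    by (simp add: univariate_def Omega_perp_def op_mult_def perp_esf perp_hsf)
qed

definition vperps :: "'a \<Rightarrow> 'i \<Rightarrow> 'i \<Rightarrow> nat \<Rightarrow> expo \<Rightarrow> ('i, 'a::comm_ring_1) msym \<Rightarrow> ('i, 'a) msym" where
  "vperps t i j a \<delta> F = (if keys \<delta> \<subseteq> {..<a} \<and> (\<forall>k. 0 \<le> lookup \<delta> k)
    then foldr (\<lambda>k. vperp t i j (nat (lookup \<delta> k))) [0..<a] F else 0)"

lemma op_prod_Omega_perp: "op_prod a (Omega_perp t i j) (- \<delta>) F = vperps t i j a \<delta> F"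
proof (cases "keys \<delta> \<subseteq> {..<a}")
  case True
  let ?T = "\<lambda>k F. if lookup \<delta> k < 0 then 0 else vperp t i j (nat (lookup \<delta> k)) F"
  have T: "Omega_perp t i j k (single k (lookup (- \<delta>) k)) = ?T k" for k
    by (rule ext) (simp add: Omega_perp_single)
  have "op_prod a (Omega_perp t i j) (- \<delta>) F =
      foldr (\<lambda>k. Omega_perp t i j k (single k (lookup (- \<delta>) k))) [0..<a] F"
    using True unfolding op_prod_def
    by (subst foldr_op_mult) (auto simp: Omega_perp_univariate atLeast0LessThan)
  also have "\<dots> = foldr ?T [0..<a] F" unfolding T ..
  also have "\<dots> = vperps t i j a \<delta> F"
  proof (cases "\<forall>k. 0 \<le> lookup \<delta> k")
    case nonneg: True
    then have "?T k = vperp t i j (nat (lookup \<delta> k))" for k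
      by (rule_tac ext) (simp add: not_less[symmetric])
    then show ?thesis using True nonneg by (simp add: vperps_def)
  next
    case False
    then obtain k where k: "lookup \<delta> k < 0" by (auto simp: not_le)
    then have "k \<in> keys \<delta>" by (simp add: in_keys_iff)
    then have "k \<in> set [0..<a]" using True by auto
    then have "foldr ?T [0..<a] F = 0" using k by (intro foldr_eq_0[of k]) auto
    moreover have "vperps t i j a \<delta> F = 0" using False by (auto simp: vperps_def)
    ultimately show ?thesis by simp
  qed
  finally show ?thesis .
next
  case False
  then have "\<not> keys (- \<delta>) \<subseteq> set [0..<a]" by (auto simp: in_keys_iff)
  with False show ?thesis unfolding op_prod_def
    by (subst foldr_op_mult) (auto simp: Omega_perp_univariate vperps_def)
qed

lemma vperps_add: "vperps t i j a \<delta> (F + G) = vperps t i j a \<delta> F + vperps t i j a \<delta> G"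
proof -
  have "foldr (\<lambda>k. vperp t i j (f k)) ks (F + G) =
      foldr (\<lambda>k. vperp t i j (f k)) ks F + foldr (\<lambda>k. vperp t i j (f k)) ks G" for f :: "nat \<Rightarrow> nat" and ks
    by (induction ks) (auto simp: vperp_add)
  then show ?thesis by (simp add: vperps_def)
qed

text \<open>The operators lower the degree, so no entry of \<open>\<delta>\<close> can exceed the degree of \<open>F\<close>.\<close>

lemma finite_vperps: "finite {\<delta>. vperps t i j a \<delta> F \<noteq> 0}"
proof -
  obtain d where d: "degb d F" using ex_degb by blast
  have *: "degb d (foldr (\<lambda>k. vperp t i j (f k)) ks F) \<and>
      ((\<exists>k\<in>set ks. int (f k) > d) \<longrightarrow> foldr (\<lambda>k. vperp t i j (f k)) ks F = 0)" for f :: "nat \<Rightarrow> nat" and ks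
  proof (induction ks)
    case (Cons k ks)
    let ?G = "foldr (\<lambda>k. vperp t i j (f k)) ks F"
    have "degb (d - int (f k)) (vperp t i j (f k) ?G)" using Cons by (intro degb_vperp) simp
    then have "degb d (vperp t i j (f k) ?G)" "int (f k) > d \<Longrightarrow> vperp t i j (f k) ?G = 0"
      by (auto intro: degb_mono degb_neg)
    then show ?case using Cons by auto
  qed (use d in simp)
  show ?thesis
  proof (rule finite_subset[OF _ finite_expo_box[of a "\<lambda>_. max d 0"]], rule subsetI)
    fix \<delta> assume "\<delta> \<in> {\<delta>. vperps t i j a \<delta> F \<noteq> 0}"
    then have nz: "keys \<delta> \<subseteq> {..<a}" "\<And>k. 0 \<le> lookup \<delta> k"
      "foldr (\<lambda>k. vperp t i j (nat (lookup \<delta> k))) [0..<a] F \<noteq> 0"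
      by (auto simp: vperps_def split: if_splits)
    have "lookup \<delta> k \<le> max d 0" for k
    proof (cases "k < a")
      case True
      then have "k \<in> set [0..<a]" by simp
      then have "int (nat (lookup \<delta> k)) \<le> d"
        using nz(3) *[of "\<lambda>k. nat (lookup \<delta> k)" "[0..<a]"] by (metis not_le)
      then show ?thesis by linarith
    next
      case False
      then have "k \<notin> keys \<delta>" using nz(1) by auto
      then show ?thesis by (simp add: in_keys_iff)
    qed
    with nz show "\<delta> \<in> {\<kappa>. keys \<kappa> \<subseteq> {..<a} \<and>
        (\<forall>k. 0 \<le> lookup \<kappa> k \<and> lookup \<kappa> k \<le> max d 0)}" by simp
  qed
qed

text \<open>The root product and the product of the series \<open>\<Omega>[z\<^sub>k X\<^sup>(\<^sup>i\<^sup>)]\<close> combine to Jacobi-Trudi determinants. The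
  sum is indexed by the negated exponents \<open>\<delta>\<close> of the adjoint operators.\<close>

lemma Hop_eq: "Hop t i j a \<beta> F = Sum_any (\<lambda>\<delta>. schur a (hsf i) (Poly_Mapping.nth \<beta> + \<delta>) * vperps t i j a \<delta> F)"
proof -
  let ?\<beta> = "Poly_Mapping.nth \<beta>" and ?c = "root_prod a"
  let ?V = "\<lambda>\<delta>. vperps t i j a \<delta> F"
  have in1: "op_mult (op_prod a (Omega i)) (op_prod a (Omega_perp t i j)) (?\<beta> - \<gamma>) F =
      Sum_any (\<lambda>\<delta>. seq_mon a (hsf i) (?\<beta> + \<delta> - \<gamma>) * ?V \<delta>)" for \<gamma>
  proof -
    have "op_mult (op_prod a (Omega i)) (op_prod a (Omega_perp t i j)) (?\<beta> - \<gamma>) F =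
        Sum_any (\<lambda>\<kappa>. seq_mon a (hsf i) \<kappa> * ?V (\<kappa> - (?\<beta> - \<gamma>)))"
    proof -
      have "op_prod a (Omega_perp t i j) (?\<beta> - \<gamma> - \<kappa>) F = ?V (\<kappa> - (?\<beta> - \<gamma>))" for \<kappa>
        using op_prod_Omega_perp[of a t i j "\<kappa> - (?\<beta> - \<gamma>)" F] by simp
      then show ?thesis by (simp add: op_mult_def op_prod_Omega)
    qed
    also have "\<dots> = Sum_any (\<lambda>\<delta>. seq_mon a (hsf i) (\<delta> + (?\<beta> - \<gamma>)) * ?V \<delta>)"
      by (subst Sum_any_shift[of _ "?\<beta> - \<gamma>", symmetric]) simp
    also have "\<dots> = Sum_any (\<lambda>\<delta>. seq_mon a (hsf i) (?\<beta> + \<delta> - \<gamma>) * ?V \<delta>)"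
      by (simp add: add.commute add_diff_eq)
    finally show ?thesis .
  qed
  have "Hop t i j a \<beta> F = Sum_any (\<lambda>\<gamma>. of_int (lookup ?c \<gamma>) *
      Sum_any (\<lambda>\<delta>. seq_mon a (hsf i) (?\<beta> + \<delta> - \<gamma>) * ?V \<delta>))"
    unfolding Hop_def op_mult_def[of "root_series a"] in1 by (simp only: root_series_def)
  also have "\<dots> = lin_ext (\<lambda>\<gamma>. Sum_any (\<lambda>\<delta>. seq_mon a (hsf i) (?\<beta> + \<delta> - \<gamma>) * ?V \<delta>)) ?c"
    unfolding lin_ext_def by (rule Sum_any.expand_superset) (auto simp: in_keys_iff)
  also have "\<dots> = Sum_any (\<lambda>\<delta>. schur a (hsf i) (?\<beta> + \<delta>) * ?V \<delta>)"
    unfolding schur_def lin_ext_times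
    by (rule Sum_any_lin_ext[symmetric], rule finite_support_mult, rule finite_vperps)
  finally show ?thesis .
qed

lemma Hop_add: "Hop t i j a \<beta> (F + G) = Hop t i j a \<beta> F + Hop t i j a \<beta> G"
  unfolding Hop_eq vperps_add distrib_left
  by (rule Sum_any.distrib) (intro finite_support_mult finite_vperps)+

lemma Hop_0 [simp]: "Hop t i j a \<beta> 0 = 0"
  using Hop_add[of t i j a \<beta> 0 0] by simp

lemma Hop_sum: "Hop t i j a \<beta> (\<Sum>x\<in>I. F x) = (\<Sum>x\<in>I. Hop t i j a \<beta> (F x))"
  by (induction I rule: infinite_finite_induct) (auto simp: Hop_add)

section \<open>Translating one alphabet\<close>

text \<open>The coefficient of \<open>z\<^sup>-\<^sup>n\<close> in \<open>F[X\<^sup>(\<^sup>j\<^sup>) + t/z]\<close>.\<close>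

definition sperp :: "'a \<Rightarrow> 'i \<Rightarrow> nat \<Rightarrow> ('i, 'a::comm_ring_1) msym \<Rightarrow> ('i, 'a) msym" where
  "sperp t j n F = const (t ^ n) * hperp j n F"

lemma sperp_mult: "sperp t j n (F * G) = (\<Sum>k\<le>n. sperp t j k F * sperp t j (n - k) G)"
proof -
  have "sperp t j k F * sperp t j (n - k) G = const (t ^ n) * (hperp j k F * hperp j (n - k) G)" if "k \<le> n" for k
  proof -
    have "t ^ n = t ^ k * t ^ (n - k)" using that by (simp flip: power_add)
    then show ?thesis by (simp add: sperp_def const_mult mult_ac)
  qed
  then show ?thesis by (simp add: sperp_def hperp_mult sum_distrib_left)
qed

lemma sperp_add: "sperp t j n (F + G) = sperp t j n F + sperp t j n G"
  by (simp add: sperp_def hperp_add distrib_left)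

lemma sperp_0 [simp]: "sperp t j n 0 = 0"
  by (simp add: sperp_def)

lemma sperp_sum: "sperp t j n (\<Sum>x\<in>I. F x) = (\<Sum>x\<in>I. sperp t j n (F x))"
  by (induction I rule: infinite_finite_induct) (auto simp: sperp_add)

lemma sperp_1: "sperp t j n 1 = (if n = 0 then 1 else 0)"
  by (simp add: sperp_def hperp_free const_1)

lemma free_of_sum: "(\<And>x. x \<in> I \<Longrightarrow> free_of i (F x)) \<Longrightarrow> free_of i (\<Sum>x\<in>I. F x)"
  by (induction I rule: infinite_finite_induct) (auto intro: free_of_add)

lemma free_of_prod: "(\<And>x. x \<in> I \<Longrightarrow> free_of i (F x)) \<Longrightarrow> free_of i (\<Prod>x\<in>I. F x)"
  by (induction I rule: infinite_finite_induct) (auto intro: free_of_mult)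

lemma free_of_of_nat: "free_of i (of_nat n)"
  by (induction n) (auto intro: free_of_add)

lemma free_of_of_int: "free_of i (of_int c)"
  by (cases c) (auto intro: free_of_of_nat free_of_uminus simp del: of_nat_Suc)

lemma sperp_of_int_mult: "sperp t j n (of_int c * F) = of_int c * sperp t j n F"
  by (simp add: sperp_def hperp_free_mult[OF free_of_of_int] mult.left_commute)

lemma sperp_const_mult: "sperp t j n (const c * F) = const c * sperp t j n F"
  by (simp add: sperp_def hperp_free_mult[OF free_of_const] mult.left_commute)

lemma free_of_lin_ext: "(\<And>\<gamma>. free_of i (u \<gamma>)) \<Longrightarrow> free_of i (lin_ext u f)"
  unfolding lin_ext_def by (intro free_of_sum free_of_mult free_of_of_int)

lemma free_of_seq_mon: "(\<And>m. free_of i (q m)) \<Longrightarrow> free_of i (seq_mon a q \<kappa>)"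
  by (auto simp: seq_mon_def int_nth_def intro!: free_of_prod)

lemma sperp_prod:
  "sperp t j n (\<Prod>k<a. g k) = fps_nth (\<Prod>k<a. Abs_fps (\<lambda>n. sperp t j n (g k))) n" for a :: nat
proof (induction a arbitrary: n)
  case (Suc a)
  show ?case
    by (simp add: sperp_mult Suc fps_mult_nth atMost_atLeast0 mult.commute[of _ "g a"]
        mult.commute[of _ "Abs_fps _"])
qed (simp add: sperp_1)

lemma fps_prod_scale:
  fixes f :: "nat \<Rightarrow> nat \<Rightarrow> 'r::comm_ring_1" and a :: nat
  shows "fps_nth (\<Prod>k<a. Abs_fps (\<lambda>n. Y ^ n * f k n)) n = Y ^ n * fps_nth (\<Prod>k<a. Abs_fps (f k)) n"
proof (induction a arbitrary: n)
  case (Suc a)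
  have "Y ^ i * x * (Y ^ (n - i) * y) = Y ^ n * (x * y)" if "i \<le> n" for i and x y :: 'r
  proof -
    have "Y ^ n = Y ^ i * Y ^ (n - i)" using that by (simp flip: power_add)
    then show ?thesis by (simp add: mult_ac)
  qed
  then show ?case by (simp add: fps_mult_nth Suc sum_distrib_left)
qed simp

text \<open>The hypothesis on \<open>q\<close> says that the translation by \<open>t/z\<close> multiplies \<open>\<Sum>\<^sub>m q\<^sub>m w\<^sup>m\<close> by \<open>1/(1 - Y w/z)\<close>,
  as if \<open>Y/z\<close> were added to the alphabet of \<open>q\<close>.\<close>

context
  fixes t :: "'a::comm_ring_1" and j :: 'i and q :: "nat \<Rightarrow> ('i, 'a) msym" and Y :: "('i, 'a) msym"
  assumes shift: "\<And>n m. sperp t j n (q m) = (if n \<le> m then Y ^ n * q (m - n) else 0)"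
begin

lemma sperp_seq_mon:
  "sperp t j n (seq_mon a q \<mu>) = Y ^ n * lin_ext (\<lambda>\<gamma>. seq_mon a q (\<mu> - \<gamma>)) (complete_sym a n)"
proof -
  have s: "sperp t j n (int_nth q e) = Y ^ n * int_nth q (e - int n)" for n e
    by (auto simp: int_nth_def shift nat_diff_distrib)
  show ?thesis
  proof (cases "keys \<mu> \<subseteq> {..<a}")
    case True
    then have "seq_mon a q \<mu> = (\<Prod>k<a. int_nth q (lookup \<mu> k))"
      by (simp add: seq_mon_def)
    then show ?thesis
      unfolding lin_ext_complete_sym by (simp add: True sperp_prod s fps_prod_scale)
  next
    case False
    then have "seq_mon a q \<mu> = 0" by (simp add: seq_mon_def)
    with False show ?thesis unfolding lin_ext_complete_sym by simp
  qed
qed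

lemma sperp_lin_ext:
  "sperp t j n (lin_ext (\<lambda>\<gamma>. seq_mon a q (\<nu> - \<gamma>)) f) =
    Y ^ n * lin_ext (\<lambda>\<gamma>. seq_mon a q (\<nu> - \<gamma>)) (f * complete_sym a n)"
proof -
  have "sperp t j n (lin_ext (\<lambda>\<gamma>. seq_mon a q (\<nu> - \<gamma>)) f) =
      Y ^ n * lin_ext (\<lambda>\<gamma>. lin_ext (\<lambda>\<kappa>. seq_mon a q (\<nu> - \<gamma> - \<kappa>)) (complete_sym a n)) f"
    by (simp add: lin_ext_def[of _ f] sperp_sum sperp_of_int_mult sperp_seq_mon sum_distrib_left mult_ac)
  then show ?thesis by (simp add: lin_ext_mult diff_diff_add)
qed

end

lemma sum_triangle:
  "(\<Sum>p\<le>n. \<Sum>l\<le>n - p. f p l) = (\<Sum>l\<le>n. \<Sum>p\<le>n - l. f p l)" for f :: "nat \<Rightarrow> nat \<Rightarrow> 'b::comm_monoid_add"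
  unfolding sum.Sigma[OF finite_atMost ballI[OF finite_atMost]]
  by (rule sum.reindex_bij_witness[of _ prod.swap prod.swap]) auto

text \<open>The translation fixes \<open>G\<close>, and of its two parts only the one in \<open>X\<^sup>(\<^sup>j\<^sup>)\<close> affects \<open>S\<close>.\<close>

lemma vperp_split:
  assumes S: "free_of i S" and G: "\<And>n. vperp t i j n G = (if n = 0 then G else 0)"
  shows "vperp t i j n (S * G) = sperp t j n S * G"
proof -
  have free: "free_of i (sperp t j l S)" for l
    unfolding sperp_def by (intro free_of_mult free_of_const free_of_hperp S)
  have "vperp t i j n (S * G) = (\<Sum>p\<le>n. eperp i p (sperp t j (n - p) (S * G)))"
    by (simp add: vperp_def sperp_def)
  also have "\<dots> = (\<Sum>p\<le>n. \<Sum>l\<le>n - p. sperp t j l S * eperp i p (sperp t j (n - p - l) G))"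
    by (simp add: sperp_mult eperp_sum eperp_free_mult[OF free])
  also have "\<dots> = (\<Sum>l\<le>n. \<Sum>p\<le>n - l. sperp t j l S * eperp i p (sperp t j (n - p - l) G))"
    by (rule sum_triangle)
  also have "\<dots> = (\<Sum>l\<le>n. sperp t j l S * vperp t i j (n - l) G)"
    by (simp add: vperp_def sperp_def sum_distrib_left add.commute)
  also have "\<dots> = (\<Sum>l\<le>n. if l = n then sperp t j l S * G else 0)"
    by (intro sum.cong refl) (auto simp: G)
  finally show ?thesis by simp
qed

lemma vperps_split:
  assumes shift: "\<And>n m. sperp t j n (q m) = (if n \<le> m then const y ^ n * q (m - n) else 0)"
    and q: "\<And>m. free_of i (q m)"
    and G: "\<And>n. vperp t i j n G = (if n = 0 then G else 0)"
    and \<delta>: "keys \<delta> \<subseteq> {..<a}" "\<And>k. 0 \<le> lookup \<delta> k"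
  shows "vperps t i j a \<delta> (lin_ext (\<lambda>\<gamma>. seq_mon a q (\<nu> - \<gamma>)) f * G) =
    (\<Prod>k<a. const y ^ nat (lookup \<delta> k)) *
      lin_ext (\<lambda>\<gamma>. seq_mon a q (\<nu> - \<gamma>)) (f * seq_mon a (complete_sym a) \<delta>) * G"
proof -
  let ?L = "lin_ext (\<lambda>\<gamma>. seq_mon a q (\<nu> - \<gamma>))"
  have *: "foldr (\<lambda>k. vperp t i j (d k)) [0..<b] (const c * ?L f * G) =
      const c * (\<Prod>k<b. const y ^ d k) * ?L (f * (\<Prod>k<b. complete_sym a (d k))) * G"
    for b c f and d :: "nat \<Rightarrow> nat"
  proof (induction b arbitrary: c f)
    case (Suc b)
    have "vperp t i j (d b) (const c * ?L f * G) = sperp t j (d b) (const c * ?L f) * G"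
      by (intro vperp_split G free_of_mult free_of_const free_of_lin_ext free_of_seq_mon q)
    also have "\<dots> = const (c * y ^ d b) * ?L (f * complete_sym a (d b)) * G"
      by (simp add: sperp_const_mult sperp_lin_ext[OF shift] const_mult const_power mult.assoc)
    finally have "foldr (\<lambda>k. vperp t i j (d k)) [0..<Suc b] (const c * ?L f * G) =
        foldr (\<lambda>k. vperp t i j (d k)) [0..<b] (const (c * y ^ d b) * ?L (f * complete_sym a (d b)) * G)"
      by simp
    then show ?case unfolding Suc by (simp add: const_mult const_power mult_ac)
  qed simp
  show ?thesis
    using *[of "\<lambda>k. nat (lookup \<delta> k)" a 1 f] \<delta>
    by (simp add: vperps_def const_1 seq_mon_def int_nth_def not_less[symmetric])
qed

text \<open>The determinant is homogeneous: the exponents in the root product have sum zero.\<close>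

lemma schur_scale:
  fixes Y :: "'r::comm_ring_1"
  assumes \<delta>: "keys \<delta> \<subseteq> {..<a}" "\<And>k. 0 \<le> lookup \<delta> k"
  shows "schur a (\<lambda>n. Y ^ n * h n) \<delta> = (\<Prod>k<a. Y ^ nat (lookup \<delta> k)) * schur a h \<delta>"
proof -
  have "seq_mon a (\<lambda>n. Y ^ n * h n) (\<delta> - expo_of a (\<lambda>i. int i - int (\<tau> i))) =
      (\<Prod>k<a. Y ^ nat (lookup \<delta> k)) * seq_mon a h (\<delta> - expo_of a (\<lambda>i. int i - int (\<tau> i)))"
    if \<tau>: "\<tau> permutes {0..<a}" for \<tau>
  proof -
    let ?\<kappa> = "\<delta> - expo_of a (\<lambda>i. int i - int (\<tau> i))"
    have lk: "lookup ?\<kappa> k = lookup \<delta> k - (int k - int (\<tau> k))" if "k < a" for k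
      using that by (simp add: lookup_minus lookup_expo_of)
    show ?thesis
    proof (cases "\<forall>k<a. 0 \<le> lookup ?\<kappa> k")
      case True
      have "int (\<Sum>k<a. nat (lookup ?\<kappa> k)) = (\<Sum>k<a. lookup ?\<kappa> k)"
        using True by (simp add: of_nat_sum)
      also have "\<dots> = (\<Sum>k<a. lookup \<delta> k) - ((\<Sum>k<a. int k) - (\<Sum>k<a. int (\<tau> k)))"
        by (simp add: lk sum_subtractf)
      also have "(\<Sum>k<a. int (\<tau> k)) = (\<Sum>k<a. int k)"
        using sum.permute[OF \<tau>, of int] by (simp add: comp_def atLeast0LessThan)
      also have "(\<Sum>k<a. lookup \<delta> k) - ((\<Sum>k<a. int k) - (\<Sum>k<a. int k)) =
          int (\<Sum>k<a. nat (lookup \<delta> k))"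
        using \<delta>(2) by (simp add: of_nat_sum)
      finally have "(\<Sum>k<a. nat (lookup ?\<kappa> k)) = (\<Sum>k<a. nat (lookup \<delta> k))"
        by (simp only: of_nat_eq_iff)
      then have "(\<Prod>k<a. Y ^ nat (lookup ?\<kappa> k)) = (\<Prod>k<a. Y ^ nat (lookup \<delta> k))"
        by (simp only: power_sum[symmetric])
      moreover have "(\<Prod>k<a. int_nth (\<lambda>n. Y ^ n * h n) (lookup ?\<kappa> k)) =
          (\<Prod>k<a. Y ^ nat (lookup ?\<kappa> k)) * (\<Prod>k<a. int_nth h (lookup ?\<kappa> k))"
        unfolding prod.distrib[symmetric] using True by (intro prod.cong refl) (auto simp: int_nth_def)
      ultimately show ?thesis by (simp add: seq_mon_def)
    next
      case False
      then obtain k where "\<not> 0 \<le> lookup ?\<kappa> k" by blast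
      then have "seq_mon a g ?\<kappa> = 0" for g :: "nat \<Rightarrow> 'r" using seq_mon_nonzeroD(2) by metis
      then show ?thesis by simp
    qed
  qed
  then show ?thesis
    by (simp add: schur_def lin_ext_root_prod sum_distrib_left mult.left_commute)
qed

text \<open>The translation moves the determinant only: it adds \<open>y/z\<^sub>1 + \<dots> + y/z\<^sub>a\<close> to the alphabet of \<open>q\<close>. In the
  sum against the determinants in \<open>h\<^sub>n[X\<^sup>(\<^sup>i\<^sup>)]\<close>, the Cauchy identity trades these variables for the
  alphabet \<open>y X\<^sup>(\<^sup>i\<^sup>)\<close>.\<close>

lemma Hop_schur:
  fixes q :: "nat \<Rightarrow> ('i, 'a::comm_ring_1) msym"
  assumes shift: "\<And>n m. sperp t j n (q m) = (if n \<le> m then const y ^ n * q (m - n) else 0)"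
    and q: "\<And>m. free_of i (q m)"
    and y: "y * y' = 1"
    and G: "\<And>n. vperp t i j n G = (if n = 0 then G else 0)"
    and \<beta>: "Poly_Mapping.nth \<beta> = 0"
  shows "Hop t i j a \<beta> (schur a q \<nu> * G) = schur a (seq_conv (\<lambda>n. const y ^ n * hsf i n) q) \<nu> * G"
proof -
  let ?L = "lin_ext (\<lambda>\<gamma>. seq_mon a q (\<nu> - \<gamma>))" and ?c = "root_prod a"
  let ?Z = "\<lambda>\<delta>. ?L (?c * seq_mon a (complete_sym a) \<delta>)"
  let ?Y = "\<lambda>\<delta>. \<Prod>k<a. const y ^ nat (lookup \<delta> k)"
  have Z0: "?Z \<delta> = 0" if "\<not> (keys \<delta> \<subseteq> {..<a} \<and> (\<forall>k. 0 \<le> lookup \<delta> k))" for \<delta>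
  proof -
    have "seq_mon a (complete_sym a) \<delta> = 0"
      using that seq_mon_nonzeroD[of a "complete_sym a" \<delta>] by blast
    then show ?thesis by simp
  qed
  have V: "vperps t i j a \<delta> (schur a q \<nu> * H) = ?Y \<delta> * ?Z \<delta> * H"
    if H: "\<And>n. vperp t i j n H = (if n = 0 then H else 0)" for \<delta> H
  proof (cases "keys \<delta> \<subseteq> {..<a} \<and> (\<forall>k. 0 \<le> lookup \<delta> k)")
    case True
    then show ?thesis
      unfolding schur_def by (intro vperps_split shift q H) auto
  next
    case False
    then have "vperps t i j a \<delta> (schur a q \<nu> * H) = 0" by (auto simp: vperps_def)
    then show ?thesis using Z0[OF False] by simp
  qed
  have one: "vperp t i j n 1 = (if n = 0 then 1 else 0 :: ('i, 'a) msym)" for n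
  proof -
    have "vperp t i j n 1 = (\<Sum>p\<le>n. eperp i p (if p = n then 1 else 0))"
      unfolding vperp_def by (intro sum.cong refl) (auto simp: hperp_free const_1)
    also have "\<dots> = eperp i n 1"
      by (simp add: if_distrib[of "eperp i _"] cong: if_cong)
    also have "\<dots> = (if n = 0 then 1 else 0)"
    proof (induction n rule: less_induct)
      case (less n)
      show ?case
      proof (cases "n = 0")
        case False
        have "eperp i k (hperp i (n - k) 1) = (0 :: ('i, 'a) msym)" if "k < n" for k
          using that by (simp add: hperp_1)
        then show ?thesis using False by (simp add: eperp.simps[of i n])
      qed simp
    qed
    finally show ?thesis .
  qed
  have yinv: "const y * const y' = (1 :: ('i, 'a) msym)"
    using y by (simp add: const_1 flip: const_mult)
  \<comment> \<open>The sum over \<open>\<delta>\<close> is finite because the operators lower degrees; the inverse of \<open>y\<close> removes the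
    powers of \<open>y\<close> that they contribute.\<close>
  have finZ: "finite {\<delta>. ?Z \<delta> \<noteq> 0}"
  proof (rule finite_subset[OF _ finite_vperps[of t i j a "schur a q \<nu>"]], rule subsetI)
    fix \<delta> assume "\<delta> \<in> {\<delta>. ?Z \<delta> \<noteq> 0}"
    moreover have "(\<Prod>k<a. const y' ^ nat (lookup \<delta> k)) * vperps t i j a \<delta> (schur a q \<nu>) = ?Z \<delta>"
    proof -
      have "(\<Prod>k<a. const y' ^ nat (lookup \<delta> k)) * ?Y \<delta> = (1 :: ('i, 'a) msym)"
        unfolding prod.distrib[symmetric] power_mult_distrib[symmetric] mult.commute[of "const y'"] yinv by simp
      then show ?thesis using V[OF one, of \<delta>] by (simp flip: mult.assoc)
    qed
    ultimately show "\<delta> \<in> {\<delta>. vperps t i j a \<delta> (schur a q \<nu>) \<noteq> 0}" by auto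
  qed
  have "Hop t i j a \<beta> (schur a q \<nu> * G) = Sum_any (\<lambda>\<delta>. schur a (hsf i) \<delta> * (?Y \<delta> * ?Z \<delta> * G))"
    unfolding Hop_eq \<beta> V[OF G] by simp
  also have "\<dots> = Sum_any (\<lambda>\<delta>. schur a (\<lambda>n. const y ^ n * hsf i n) \<delta> * ?Z \<delta> * G)"
  proof (rule Sum_any.cong)
    fix \<delta>
    show "schur a (hsf i) \<delta> * (?Y \<delta> * ?Z \<delta> * G) = schur a (\<lambda>n. const y ^ n * hsf i n) \<delta> * ?Z \<delta> * G"
    proof (cases "keys \<delta> \<subseteq> {..<a} \<and> (\<forall>k. 0 \<le> lookup \<delta> k)")
      case True
      then show ?thesis by (subst schur_scale) (auto simp: mult_ac)
    qed (simp add: Z0)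
  qed
  also have "\<dots> = Sum_any (\<lambda>\<delta>. schur a (\<lambda>n. const y ^ n * hsf i n) \<delta> * ?Z \<delta>) * G"
    by (rule Sum_any_left_distrib[symmetric]) (rule finite_support_mult[OF finZ])
  also have "\<dots> = schur a (seq_conv (\<lambda>n. const y ^ n * hsf i n) q) \<nu> * G"
    by (subst schur_cauchy[OF finZ]) simp
  finally show ?thesis .
qed

section \<open>Newton's identities\<close>

lemma msym_eq_hperp:
  assumes "drop_node i F = drop_node i G" "\<And>j. j > 0 \<Longrightarrow> hperp i j F = hperp i j G"
  shows "F = G"
proof (rule msym_eq_hperps)
  fix l :: "nat list" assume "0 \<notin> set l"
  then show "drop_node i (hperps i l F) = drop_node i (hperps i l G)"
    by (cases l) (simp_all add: assms)
qed

lemma hperp_psf: "n > 0 \<Longrightarrow> hperp i n (psf i k) = (if n = k then 1 else 0)"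
  by (simp add: psf_def hperp_msf)

text \<open>The two sides agree after \<open>X = 0\<close>, and their coefficients in \<open>X + u\<close> agree by induction, because
  \<open>p\<^sub>k[X + u] = p\<^sub>k[X] + u\<^sup>k\<close>.\<close>

lemma newton_hsf:
  "of_nat n * hsf i n = (\<Sum>k<n. psf i (Suc k) * hsf i (n - Suc k) :: ('i, 'a::comm_ring_1) msym)"
proof (induction n rule: less_induct)
  case (less n)
  let ?h = "\<lambda>m. hsf i m :: ('i, 'a) msym" and ?p = "\<lambda>m. psf i m :: ('i, 'a) msym"
  show ?case
  proof (rule msym_eq_hperp)
    have "drop_node i (?p (Suc k)) = 0" for k by (simp add: psf_def drop_node_msf)
    then show "drop_node i (of_nat n * ?h n) = drop_node i (\<Sum>k<n. ?p (Suc k) * ?h (n - Suc k))"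
      by (simp add: drop_node_mult drop_node_sum)
    fix j :: nat assume j: "j > 0"
    have prod: "hperp i j (?p (Suc k) * ?h m) =
        ?p (Suc k) * hperp i j (?h m) + (if Suc k \<le> j then hperp i (j - Suc k) (?h m) else 0)" for k m
    proof -
      have "hperp i j (?p (Suc k) * ?h m) =
          (\<Sum>l\<in>{..j} \<inter> {0, Suc k}. hperp i l (?p (Suc k)) * hperp i (j - l) (?h m))"
        unfolding hperp_mult
        by (rule sum.mono_neutral_right) (auto simp: hperp_psf)
      also have "{..j} \<inter> {0, Suc k} = (if Suc k \<le> j then {0, Suc k} else {0})" by auto
      finally show ?thesis by (simp add: hperp_psf)
    qed
    have left: "hperp i j (of_nat n * ?h n) = of_nat n * (if j \<le> n then ?h (n - j) else 0)"
      by (simp add: hperp_free_mult[OF free_of_of_nat] hperp_hsf)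
    have "hperp i j (\<Sum>k<n. ?p (Suc k) * ?h (n - Suc k)) =
        (\<Sum>k<n. ?p (Suc k) * hperp i j (?h (n - Suc k))) +
        (\<Sum>k<n. if Suc k \<le> j then hperp i (j - Suc k) (?h (n - Suc k)) else 0)"
      by (simp add: hperp_sum prod sum.distrib)
    also have "(\<Sum>k<n. ?p (Suc k) * hperp i j (?h (n - Suc k))) = (if j \<le> n then of_nat (n - j) * ?h (n - j) else 0)"
    proof (cases "j \<le> n")
      case True
      have "(\<Sum>k<n. ?p (Suc k) * hperp i j (?h (n - Suc k))) = (\<Sum>k<n - j. ?p (Suc k) * ?h (n - j - Suc k))"
        using j by (intro sum.mono_neutral_cong_right) (auto simp: hperp_hsf add.commute)
      then show ?thesis using less[of "n - j"] j True by simp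
    next
      case False
      then show ?thesis by (auto simp: hperp_hsf intro!: sum.neutral)
    qed
    also have "(\<Sum>k<n. if Suc k \<le> j then hperp i (j - Suc k) (?h (n - Suc k)) else 0) =
        (if j \<le> n then of_nat j * ?h (n - j) else 0)"
    proof (cases "j \<le> n")
      case True
      have "(\<Sum>k<n. if Suc k \<le> j then hperp i (j - Suc k) (?h (n - Suc k)) else 0) = (\<Sum>k<j. ?h (n - j))"
        using True by (intro sum.mono_neutral_cong_right) (auto simp: hperp_hsf)
      with True show ?thesis by simp
    next
      case False
      then show ?thesis by (auto simp: hperp_hsf intro!: sum.neutral)
    qed
    also have "(if j \<le> n then of_nat (n - j) * ?h (n - j) else 0) + (if j \<le> n then of_nat j * ?h (n - j) else 0) =
        of_nat n * (if j \<le> n then ?h (n - j) else 0)"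
      by (auto simp: of_nat_diff algebra_simps)
    finally show "hperp i j (of_nat n * ?h n) = hperp i j (\<Sum>k<n. ?p (Suc k) * ?h (n - Suc k))"
      unfolding left ..
  qed
qed

text \<open>Newton's identities for the generating series \<open>P = \<Sum>\<^sub>k p\<^sub>k\<^sub>+\<^sub>1 x\<^sup>k\<close> of power sums and \<open>H\<close> of complete
  symmetric functions: \<open>P\<close> is the logarithmic derivative of \<open>H\<close>.\<close>

definition newton_pair :: "'r::comm_ring_1 fps \<Rightarrow> 'r fps \<Rightarrow> bool" where
  "newton_pair P H \<longleftrightarrow> fps_nth H 0 = 1 \<and> fps_deriv H = P * H"

lemma newton_pair_1: "newton_pair 0 1"
  by (simp add: newton_pair_def)

lemma newton_pair_mult: "newton_pair P H \<Longrightarrow> newton_pair P' H' \<Longrightarrow> newton_pair (P + P') (H * H')"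
  by (simp add: newton_pair_def algebra_simps)

lemma newton_pair_prod:
  "(\<And>x. x \<in> I \<Longrightarrow> newton_pair (P x) (H x)) \<Longrightarrow> newton_pair (\<Sum>x\<in>I. P x) (\<Prod>x\<in>I. H x)"
  by (induction I rule: infinite_finite_induct) (auto intro: newton_pair_1 newton_pair_mult)

lemma newton_pairI:
  assumes "h 0 = 1" "\<And>n. of_nat n * h n = (\<Sum>k<n. p (Suc k) * h (n - Suc k))"
  shows "newton_pair (Abs_fps (\<lambda>k. p (Suc k))) (Abs_fps h)"
proof -
  have "fps_deriv (Abs_fps h) = Abs_fps (\<lambda>k. p (Suc k)) * Abs_fps h"
  proof (rule fps_ext)
    fix n
    have "fps_nth (fps_deriv (Abs_fps h)) n = (\<Sum>k<Suc n. p (Suc k) * h (Suc n - Suc k))"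
      using assms(2)[of "Suc n"] by simp
    then show "fps_nth (fps_deriv (Abs_fps h)) n = fps_nth (Abs_fps (\<lambda>k. p (Suc k)) * Abs_fps h) n"
      by (simp add: fps_mult_nth atLeast0AtMost lessThan_Suc_atMost)
  qed
  with assms(1) show ?thesis by (simp add: newton_pair_def)
qed

lemma newton_pair_unique:
  fixes P :: "'r::comm_ring_1 fps"
  assumes tf: "\<And>n (x :: 'r). n > 0 \<Longrightarrow> of_nat n * x = 0 \<Longrightarrow> x = 0"
    and "newton_pair P H" "newton_pair P H'"
  shows "H = H'"
proof (rule fps_ext)
  fix n
  show "fps_nth H n = fps_nth H' n"
  proof (induction n rule: less_induct)
    case (less n)
    show ?case
    proof (cases n)
      case 0
      then show ?thesis using assms by (simp add: newton_pair_def)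
    next
      case (Suc m)
      have "of_nat (Suc m) * fps_nth G (Suc m) = (\<Sum>k=0..m. fps_nth P k * fps_nth G (m - k))"
        if "newton_pair P G" for G
      proof -
        have "fps_nth (fps_deriv G) m = fps_nth (P * G) m" using that by (simp add: newton_pair_def)
        then show ?thesis by (simp only: fps_deriv_nth fps_mult_nth Suc_eq_plus1)
      qed
      then have "of_nat (Suc m) * fps_nth H (Suc m) = of_nat (Suc m) * fps_nth H' (Suc m)"
        using assms(2,3) less[of "m - _"] by (simp add: Suc less_Suc_eq_le)
      then have "of_nat (Suc m) * (fps_nth H (Suc m) - fps_nth H' (Suc m)) = 0"
        by (simp only: right_diff_distrib diff_self)
      from tf[OF _ this] show ?thesis by (simp add: Suc)
    qed
  qed
qed

lemma coef_of_nat_mult: "coef (of_nat n * F) m = of_nat n * coef F m"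
  by (induction n) (simp_all add: zero_msym.rep_eq plus_msym.rep_eq distrib_right)

lemma laurent_torsion_free: "of_nat n * c = 0 \<Longrightarrow> n > 0 \<Longrightarrow> c = 0" for c :: laurent
proof -
  assume *: "of_nat n * c = 0" "n > 0"
  have "lookup (of_nat n * c) \<gamma> = int n * lookup c \<gamma>" for \<gamma>
    by (induction n) (simp_all add: distrib_right lookup_add)
  with * show ?thesis by (simp add: poly_mapping_eq_iff fun_eq_iff)
qed

lemma msym_torsion_free: "n > 0 \<Longrightarrow> of_nat n * F = 0 \<Longrightarrow> F = 0" for F :: "(nat, laurent) msym"
proof (rule msym_eqI)
  fix m
  assume "n > 0" "of_nat n * F = 0"
  moreover have "coef (of_nat n * F) m = of_nat n * coef F m" by (rule coef_of_nat_mult)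
  ultimately show "coef F m = coef 0 m"
    using laurent_torsion_free[of n "coef F m"] by (simp add: zero_msym.rep_eq)
qed

lemma newton_pair_hsf:
  fixes i :: 'i and c :: "'a::comm_ring_1"
  shows "newton_pair (Abs_fps (\<lambda>k. const (c ^ Suc k) * psf i (Suc k))) (Abs_fps (\<lambda>n. const c ^ n * hsf i n))"
proof (rule newton_pairI)
  fix n
  have "of_nat n * (const c ^ n * hsf i n) = const c ^ n * (\<Sum>k<n. psf i (Suc k) * hsf i (n - Suc k))"
    by (simp only: mult.left_commute[of "of_nat n"] newton_hsf)
  also have "\<dots> = (\<Sum>k<n. const (c ^ Suc k) * psf i (Suc k) * (const c ^ (n - Suc k) * hsf i (n - Suc k)))"
    unfolding sum_distrib_left
  proof (intro sum.cong refl)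
    fix k assume "k \<in> {..<n}"
    then have "(const c ^ n :: ('i, 'a) msym) = const (c ^ Suc k) * const c ^ (n - Suc k)"
      by (simp add: const_power flip: power_add power_Suc)
    then show "const c ^ n * (psf i (Suc k) * hsf i (n - Suc k)) =
        const (c ^ Suc k) * psf i (Suc k) * (const c ^ (n - Suc k) * hsf i (n - Suc k))"
      by (simp only: mult_ac)
  qed
  finally show "of_nat n * (const c ^ n * hsf i n) =
      (\<Sum>k<n. const (c ^ Suc k) * psf i (Suc k) * (const c ^ (n - Suc k) * hsf i (n - Suc k)))" .
qed simp

section \<open>The alphabets along a path\<close>

text \<open>The coefficient of \<open>X\<^sup>(\<^sup>i\<^sup>)\<close> in the alphabet \<open>Y\<close>.\<close>

definition path_wt :: "nat \<Rightarrow> nat \<Rightarrow> laurent" where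
  "path_wt r i = (\<Prod>j\<in>{i..<r - 1}. tvar j)"

definition loop_wt :: "nat \<Rightarrow> laurent" where
  "loop_wt r = (\<Prod>i<r. tvar i)"

lemma path_wt_last [simp]: "path_wt r (r - 1) = 1"
  by (simp add: path_wt_def)

lemma path_wt_step: "Suc i < r \<Longrightarrow> tvar i * path_wt r (Suc i) = path_wt r i"
  unfolding path_wt_def by (subst (2) prod.atLeast_Suc_lessThan) auto

lemma path_wt_loop: "r > 0 \<Longrightarrow> tvar (r - 1) * path_wt r 0 = loop_wt r"
  by (cases r) (simp_all add: path_wt_def loop_wt_def atLeast0LessThan mult.commute)

lemma path_wt_unit: "\<exists>y. path_wt r i * y = 1"
proof -
  have "path_wt r i * (\<Prod>j\<in>{i..<r - 1}. wvar_inv j) = (\<Prod>j\<in>{i..<r - 1}. wvar j * wvar_inv j)"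
    by (simp add: path_wt_def prod.distrib tvar_def lmon_def)
  then show ?thesis by (intro exI) simp
qed

text \<open>The complete symmetric function \<open>h\<^sub>n[\<Sum>\<^sub>j\<^sub>\<ge>\<^sub>i y\<^sub>j X\<^sup>(\<^sup>j\<^sup>)]\<close>, where \<open>y\<^sub>j\<close> is \<open>path_wt r j\<close>.\<close>

definition tail_hsf :: "nat \<Rightarrow> nat \<Rightarrow> nat \<Rightarrow> (nat, laurent) msym" where
  "tail_hsf r i n = fps_nth (\<Prod>j\<in>{i..<r}. Abs_fps (\<lambda>n. const (path_wt r j) ^ n * hsf j n)) n"

lemma tail_hsf_step:
  assumes "i < r"
  shows "tail_hsf r i = seq_conv (\<lambda>n. const (path_wt r i) ^ n * hsf i n) (tail_hsf r (Suc i))"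
proof
  fix n
  show "tail_hsf r i n = seq_conv (\<lambda>n. const (path_wt r i) ^ n * hsf i n) (tail_hsf r (Suc i)) n"
    unfolding tail_hsf_def seq_conv_def
    by (subst prod.atLeast_Suc_lessThan[OF assms]) (simp add: fps_mult_nth atLeast0AtMost)
qed

lemma tail_hsf_last: "r > 0 \<Longrightarrow> tail_hsf r (r - 1) = hsf (r - 1)"
proof -
  assume "r > 0"
  then have "{r - 1..<r} = {r - 1}" by auto
  then show ?thesis by (simp add: fun_eq_iff tail_hsf_def const_1 path_wt_def)
qed

lemma free_of_tail_hsf:
  assumes "l < i"
  shows "free_of l (tail_hsf r i n)"
proof -
  have "free_of l (fps_nth (\<Prod>j\<in>J. Abs_fps (\<lambda>n. const (path_wt r j) ^ n * hsf j n)) n)"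
    if "finite J" "l \<notin> J" for J n
    using that
  proof (induction J arbitrary: n rule: finite_induct)
    case (insert j J)
    then show ?case
      by (auto simp: fps_mult_nth const_power[symmetric]
          intro!: free_of_sum free_of_mult free_of_const free_of_hsf)
  qed simp
  then show ?thesis unfolding tail_hsf_def using assms by simp
qed

text \<open>Adding \<open>t\<^sub>i\<^sub>,\<^sub>i\<^sub>+\<^sub>1/z\<close> to \<open>X\<^sup>(\<^sup>i\<^sup>+\<^sup>1\<^sup>)\<close> adds \<open>y\<^sub>i/z\<close> to the alphabet, where \<open>y\<^sub>i\<close> is \<open>path_wt r i\<close>.\<close>

lemma sperp_tail_hsf:
  assumes "Suc i < r"
  shows "sperp (tvar i) (Suc i) n (tail_hsf r (Suc i) m) =
    (if n \<le> m then const (path_wt r i) ^ n * tail_hsf r (Suc i) (m - n) else 0)"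
proof -
  let ?y = "path_wt r (Suc i)" and ?Q = "tail_hsf r (Suc (Suc i))"
  have free: "free_of (Suc i) (const ?y ^ k * ?Q l)" for k l
    unfolding const_power[symmetric] by (intro free_of_mult free_of_const free_of_tail_hsf) simp
  have "tail_hsf r (Suc i) m = (\<Sum>k\<le>m. const ?y ^ k * ?Q (m - k) * hsf (Suc i) k)" for m
    unfolding tail_hsf_step[OF assms] seq_conv_def by (simp add: mult_ac)
  note * = this
  have "hperp (Suc i) n (tail_hsf r (Suc i) m) =
      (\<Sum>k\<le>m. const ?y ^ k * ?Q (m - k) * (if n \<le> k then hsf (Suc i) (k - n) else 0))"
    unfolding * hperp_sum by (simp add: hperp_free_mult[OF free] hperp_hsf)
  also have "\<dots> = (if n \<le> m then const ?y ^ n * tail_hsf r (Suc i) (m - n) else 0)"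
  proof (cases "n \<le> m")
    case True
    have "(\<Sum>k\<le>m. const ?y ^ k * ?Q (m - k) * (if n \<le> k then hsf (Suc i) (k - n) else 0)) =
        (\<Sum>k\<in>{n..m}. const ?y ^ k * ?Q (m - k) * hsf (Suc i) (k - n))"
      by (rule sum.mono_neutral_cong_right) auto
    also have "\<dots> = (\<Sum>k\<le>m - n. const ?y ^ (k + n) * ?Q (m - n - k) * hsf (Suc i) k)"
      using True
      by (intro sum.reindex_bij_witness[of _ "\<lambda>k. k + n" "\<lambda>k. k - n"]) (auto simp: algebra_simps)
    also have "\<dots> = const ?y ^ n * tail_hsf r (Suc i) (m - n)"
      unfolding * by (simp add: sum_distrib_left power_add mult_ac)
    finally show ?thesis using True by simp
  next
    case False
    then show ?thesis by (auto intro!: sum.neutral)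
  qed
  finally show ?thesis
    by (simp add: sperp_def const_power[symmetric] const_mult[symmetric] mult.assoc[symmetric]
        power_mult_distrib[symmetric] path_wt_step[OF assms])
qed

section \<open>The plethystic substitution\<close>

definition eval_poly :: "'r \<Rightarrow> int poly \<Rightarrow> 'r::comm_ring_1" where
  "eval_poly x p = poly (map_poly of_int p) x"

lemma eval_poly_pCons: "eval_poly x (pCons a p) = of_int a + x * eval_poly x p"
  by (simp add: eval_poly_def map_poly_pCons)

lemma eval_poly_0 [simp]: "eval_poly x 0 = 0"
  by (simp add: eval_poly_def)

lemma eval_poly_add: "eval_poly x (p + q) = eval_poly x p + eval_poly x q"
  by (induction p q rule: poly_induct2) (simp_all add: eval_poly_pCons algebra_simps)

lemma eval_poly_smult: "eval_poly x (Polynomial.smult a p) = of_int a * eval_poly x p"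
  by (induction p) (simp_all add: eval_poly_pCons algebra_simps)

lemma eval_poly_mult: "eval_poly x (p * q) = eval_poly x p * eval_poly x q"
  by (induction p) (simp_all add: eval_poly_pCons eval_poly_add eval_poly_smult algebra_simps)

lemma eval_poly_1 [simp]: "eval_poly x 1 = 1"
  using eval_poly_pCons[of x 1 0] by (simp add: one_pCons)

lemma eval_poly_sum: "eval_poly x (\<Sum>i\<in>I. f i) = (\<Sum>i\<in>I. eval_poly x (f i))"
  by (induction I rule: infinite_finite_induct) (auto simp: eval_poly_add)

text \<open>A symmetric function is evaluated at \<open>Y\<close> by listing the variables of the \<open>r\<close> alphabets in one
  sequence and scaling those of the node \<open>i\<close> by \<open>y\<^sub>i\<close>. In this sequence the entry \<open>k * r + i\<close> is the
  \<open>k\<close>-th variable of the node \<open>i\<close>.\<close>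

definition node_map :: "nat \<Rightarrow> unit \<times> nat \<Rightarrow> nat \<times> nat" where
  "node_map r = (\<lambda>(_, n). (n mod r, n div r))"

lemma inj_node_map: "inj (node_map r)"
  by (rule inj_on_inverseI[of _ "\<lambda>(i, k). ((), k * r + i)"]) (auto simp: node_map_def)

lemma node_map_eq: "i < r \<Longrightarrow> node_map r ((), k * r + i) = (i, k)"
  by (simp add: node_map_def)

abbreviation pull :: "nat \<Rightarrow> nat mon \<Rightarrow> unit mon" where
  "pull r \<equiv> map_key (node_map r)"

definition push :: "nat \<Rightarrow> unit mon \<Rightarrow> nat mon" where
  "push r p = (\<Sum>x\<in>keys p. single (node_map r x) (lookup p x))"

abbreviation nodes_below :: "nat \<Rightarrow> nat mon \<Rightarrow> bool" where
  "nodes_below r m \<equiv> fst ` keys m \<subseteq> {..<r}"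

lemma lookup_pull: "lookup (pull r m) x = lookup m (node_map r x)"
  by (simp add: map_key.rep_eq inj_node_map)

lemma pull_add: "pull r (p + q) = pull r p + pull r q"
  by (rule map_key_plus[OF inj_node_map])

lemma lookup_push_node_map: "lookup (push r p) (node_map r x) = lookup p x"
proof -
  have "lookup (push r p) (node_map r x) =
      (\<Sum>y\<in>keys p. if y = x then lookup p x else 0)"
    unfolding push_def lookup_sum
    by (intro sum.cong refl) (auto simp: lookup_single when_def dest: injD[OF inj_node_map])
  then show ?thesis by (simp add: in_keys_iff)
qed

lemma pull_push: "pull r (push r p) = p"
  by (rule poly_mapping_eqI) (simp add: lookup_pull lookup_push_node_map)

lemma nodes_below_lookup: "nodes_below r m \<Longrightarrow> \<not> fst y < r \<Longrightarrow> lookup m y = 0"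
  by (metis image_subset_iff in_keys_iff lessThan_iff)

lemma nodes_below_eqI:
  assumes "nodes_below r m" "nodes_below r m'" "pull r m = pull r m'"
  shows "m = m'"
proof (rule poly_mapping_eqI)
  fix y :: "nat \<times> nat"
  obtain i k where y: "y = (i, k)" by (cases y)
  show "lookup m y = lookup m' y"
  proof (cases "i < r")
    case True
    then show ?thesis
      using arg_cong[OF assms(3), of "\<lambda>f. lookup f ((), k * r + i)"]
      by (simp add: y lookup_pull node_map_eq)
  qed (use assms in \<open>simp add: y nodes_below_lookup\<close>)
qed

lemma nodes_below_push:
  assumes "r > 0"
  shows "nodes_below r (push r p)"
proof -
  have "lookup (push r p) y = 0" if "\<not> fst y < r" for y
  proof -
    have "node_map r x \<noteq> y" for x using that assms by (auto simp: node_map_def split: prod.splits)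
    then show ?thesis by (simp add: push_def lookup_sum lookup_single when_def)
  qed
  then show ?thesis by (auto simp: in_keys_iff)
qed

lemma push_pull: "r > 0 \<Longrightarrow> nodes_below r m \<Longrightarrow> push r (pull r m) = m"
  by (rule nodes_below_eqI[where r = r]) (simp_all add: nodes_below_push pull_push)

lemma keys_push: "keys (push r p) = node_map r ` keys p"
proof
  show "node_map r ` keys p \<subseteq> keys (push r p)"
    by (auto simp: in_keys_iff lookup_push_node_map)
  show "keys (push r p) \<subseteq> node_map r ` keys p"
  proof
    fix y assume "y \<in> keys (push r p)"
    then have "(\<Sum>x\<in>keys p. lookup (single (node_map r x) (lookup p x)) y) \<noteq> 0"
      by (simp add: in_keys_iff push_def lookup_sum)
    then obtain x where "x \<in> keys p"
      "lookup (single (node_map r x) (lookup p x)) y \<noteq> 0"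
      by (rule sum.not_neutral_contains_not_neutral)
    then show "y \<in> node_map r ` keys p"
      by (auto simp: lookup_single when_def split: if_splits)
  qed
qed

lemma exponents_push: "exponents (push r p) = exponents p"
proof -
  have "mset_set (keys (push r p)) = image_mset (node_map r) (mset_set (keys p))"
    unfolding keys_push by (rule image_mset_mset_set[symmetric]) (rule inj_on_subset[OF inj_node_map], simp)
  then show ?thesis
    by (simp add: exponents_def image_mset.compositionality comp_def lookup_push_node_map)
qed

lemma exponents_pull: "r > 0 \<Longrightarrow> nodes_below r m \<Longrightarrow> exponents (pull r m) = exponents m"
  using exponents_push[of r "pull r m"] by (simp add: push_pull)

lemma coef_unit_exponents:
  fixes f :: "(unit, 'a::comm_ring_1) msym"
  assumes "exponents m = exponents m'"
  shows "coef f m = coef f m'"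
proof -
  obtain l where l: "mset l = exponents m" using ex_mset by blast
  have "coef (hperps () l f) 0 = coef f (0 + m)" by (rule coef_hperps[OF l]) auto
  moreover have "coef (hperps () l f) 0 = coef f (0 + m')"
    by (rule coef_hperps) (use l assms in auto)
  ultimately show ?thesis by simp
qed

text \<open>The effect of the scaling on a monomial.\<close>

definition mon_wt :: "nat \<Rightarrow> nat mon \<Rightarrow> laurent" where
  "mon_wt r m = (\<Prod>x\<in>keys m. path_wt r (fst x) ^ lookup m x)"

lemma mon_wt_superset:
  "finite A \<Longrightarrow> keys m \<subseteq> A \<Longrightarrow> mon_wt r m = (\<Prod>x\<in>A. path_wt r (fst x) ^ lookup m x)"
  unfolding mon_wt_def by (rule prod.mono_neutral_left) (auto simp: in_keys_iff)

lemma mon_wt_add: "mon_wt r (p + q) = mon_wt r p * mon_wt r q"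
proof -
  let ?A = "keys p \<union> keys q"
  have "mon_wt r (p + q) = (\<Prod>x\<in>?A. path_wt r (fst x) ^ lookup (p + q) x)"
    by (rule mon_wt_superset) (auto simp: keys_add_nat)
  also have "\<dots> = mon_wt r p * mon_wt r q"
    by (subst (1 2) mon_wt_superset[of ?A]) (auto simp: lookup_add power_add prod.distrib)
  finally show ?thesis .
qed

lemma mon_wt_single: "mon_wt r (single x n) = path_wt r (fst x) ^ n"
  by (simp add: mon_wt_def)

lemma mon_wt_0 [simp]: "mon_wt r 0 = 1"
  by (simp add: mon_wt_def)

lemma mon_wt_map_key:
  assumes "bij \<pi>"
  shows "mon_wt r (map_key (at_node i \<pi>) m) = mon_wt r m"
proof -
  let ?m' = "map_key (at_node i \<pi>) m"
  have keys: "keys m = at_node i \<pi> ` keys ?m'"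
  proof
    show "at_node i \<pi> ` keys ?m' \<subseteq> keys m"
      using in_keys_map_key_at_node[OF assms, of _ i m] by auto
    show "keys m \<subseteq> at_node i \<pi> ` keys ?m'"
    proof
      fix x assume "x \<in> keys m"
      then have "at_node i (inv_into UNIV \<pi>) x \<in> keys ?m'"
        by (simp add: in_keys_map_key_at_node[OF assms] at_node_inv(1)[OF assms])
      then show "x \<in> at_node i \<pi> ` keys ?m'"
        using at_node_inv(1)[OF assms, of i x] by (metis image_eqI)
    qed
  qed
  show ?thesis
    unfolding mon_wt_def[of r m] keys
    by (subst prod.reindex[OF inj_on_subset[OF inj_at_node[OF assms] subset_UNIV]])
      (simp add: mon_wt_def fst_at_node lookup_map_key_at_node[OF assms])
qed

definition subst_fun :: "nat \<Rightarrow> (unit, int poly) msym \<Rightarrow> nat mon \<Rightarrow> laurent" where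
  "subst_fun r f m = (if nodes_below r m then mon_wt r m * eval_poly (loop_wt r) (coef f (pull r m)) else 0)"

text \<open>A permutation of one alphabet permutes the listed variables, which the coefficients of \<open>f\<close> do not
  notice: they depend on the exponents alone.\<close>

lemma is_msym_subst_fun:
  assumes r: "r > 0"
  shows "is_msym (subst_fun r f)"
proof -
  obtain d where d: "degb d f" using ex_degb by blast
  have nz: "nodes_below r m \<and> coef f (pull r m) \<noteq> 0" if "subst_fun r f m \<noteq> 0" for m
    using that by (auto simp: subst_fun_def split: if_splits)
  show ?thesis
    unfolding is_msym_def
  proof (intro conjI exI[of _ "nat d"] exI[of _ "{..<r}"] allI impI)
    fix m assume m: "subst_fun r f m \<noteq> 0"
    have "mdeg m = mdeg (pull r m)"
      using nz[OF m] by (simp add: mdeg_exponents exponents_pull[OF r])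
    then show "mdeg m \<le> nat d" using degbD[OF d, of "pull r m"] nz[OF m] by simp
    show "nodes_below r m" using nz[OF m] by simp
  next
    fix i and \<pi> :: "nat \<Rightarrow> nat" and m :: "nat mon"
    assume \<pi>: "bij \<pi>"
    have "coef f (pull r (map_key (at_node i \<pi>) m)) = coef f (pull r m)" if "nodes_below r m"
      using that by (intro coef_unit_exponents) (simp add: exponents_pull[OF r] map_key_at_node[OF \<pi>])
    then show "subst_fun r f (map_key (at_node i \<pi>) m) = subst_fun r f m"
      by (simp add: subst_fun_def map_key_at_node[OF \<pi>] mon_wt_map_key[OF \<pi>])
  qed simp
qed

definition subst_msym :: "nat \<Rightarrow> (unit, int poly) msym \<Rightarrow> (nat, laurent) msym" where
  "subst_msym r f = Abs_msym (subst_fun r f)"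

lemma coef_subst: "r > 0 \<Longrightarrow> coef (subst_msym r f) m = subst_fun r f m"
  by (simp add: subst_msym_def Abs_msym_inverse is_msym_subst_fun)

lemma coef_const_mult: "coef (const c * F) m = c * coef F m"
proof -
  have "coef (const c * F) m = (\<Sum>z\<in>splits m. if z = (0, m) then c * coef F m else 0)"
    unfolding coef_mult by (intro sum.cong refl) (auto simp: coef_const splits_def split: if_splits)
  then show ?thesis by (simp add: finite_splits) (simp add: splits_def)
qed

lemma subst_add: "r > 0 \<Longrightarrow> subst_msym r (f + g) = subst_msym r f + subst_msym r g"
  by (rule msym_eqI) (simp add: coef_subst plus_msym.rep_eq subst_fun_def eval_poly_add distrib_left)

text \<open>The splittings of a monomial correspond to those of its image under the listing of the variables.\<close>

lemma subst_mult:
  assumes r: "r > 0"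
  shows "subst_msym r (f * g) = subst_msym r f * subst_msym r g"
proof (rule msym_eqI)
  fix m
  show "coef (subst_msym r (f * g)) m = coef (subst_msym r f * subst_msym r g) m"
  proof (cases "nodes_below r m")
    case False
    have "subst_fun r f p * subst_fun r g q = 0" if "(p, q) \<in> splits m" for p q
    proof -
      have "m = p + q" using that by (simp add: splits_def)
      then have "\<not> nodes_below r p \<or> \<not> nodes_below r q"
        using False by (simp add: keys_add_nat image_Un)
      then show ?thesis by (auto simp: subst_fun_def)
    qed
    then show ?thesis
      using False by (simp add: coef_mult coef_subst[OF r] subst_fun_def[of r "f * g"] case_prod_unfold sum.neutral)
  next
    case True
    have below: "nodes_below r p \<and> nodes_below r q" if "(p, q) \<in> splits m" for p q
      using splits_keys[OF that] True by (meson image_mono order_trans)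
    have "(\<Sum>(p, q)\<in>splits (pull r m). coef f p * coef g q) =
        (\<Sum>(p, q)\<in>splits m. coef f (pull r p) * coef g (pull r q))"
    proof (rule sum.reindex_bij_witness[of _ "map_prod (pull r) (pull r)" "map_prod (push r) (push r)"])
      fix z assume "z \<in> splits (pull r m)"
      then obtain p q where z: "z = (p, q)" "p + q = pull r m" by (auto simp: splits_def)
      show "map_prod (pull r) (pull r) (map_prod (push r) (push r) z) = z"
        by (simp add: z pull_push)
      have "push r p + push r q = m"
      proof (rule nodes_below_eqI[where r = r])
        show "nodes_below r (push r p + push r q)"
          using nodes_below_push[OF r] by (simp add: keys_add_nat image_Un)
        show "pull r (push r p + push r q) = pull r m" by (simp add: pull_add pull_push z)
      qed (rule True)
      then show "map_prod (push r) (push r) z \<in> splits m" by (simp add: z splits_def)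
      show "(case map_prod (push r) (push r) z of (p, q) \<Rightarrow> coef f (pull r p) * coef g (pull r q)) =
          (case z of (p, q) \<Rightarrow> coef f p * coef g q)"
        by (simp add: z pull_push)
    next
      fix z assume z': "z \<in> splits m"
      then obtain p q where z: "z = (p, q)" "p + q = m" by (auto simp: splits_def)
      show "map_prod (push r) (push r) (map_prod (pull r) (pull r) z) = z"
        using below[of p q] z' by (simp add: z push_pull[OF r])
      show "map_prod (pull r) (pull r) z \<in> splits (pull r m)"
        by (simp add: z splits_def flip: pull_add)
    qed
    then have "coef (subst_msym r (f * g)) m =
        mon_wt r m * eval_poly (loop_wt r) (\<Sum>(p, q)\<in>splits m. coef f (pull r p) * coef g (pull r q))"
      using True by (simp add: coef_subst[OF r] subst_fun_def coef_mult)
    also have "\<dots> = (\<Sum>(p, q)\<in>splits m. mon_wt r m *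
        (eval_poly (loop_wt r) (coef f (pull r p)) * eval_poly (loop_wt r) (coef g (pull r q))))"
      by (simp add: eval_poly_sum eval_poly_mult sum_distrib_left case_prod_unfold)
    also have "\<dots> = (\<Sum>(p, q)\<in>splits m. subst_fun r f p * subst_fun r g q)"
    proof (intro sum.cong refl, clarify)
      fix p q assume pq: "(p, q) \<in> splits m"
      then have m: "m = p + q" by (simp add: splits_def)
      show "mon_wt r m * (eval_poly (loop_wt r) (coef f (pull r p)) * eval_poly (loop_wt r) (coef g (pull r q))) =
          subst_fun r f p * subst_fun r g q"
        using below[OF pq] by (simp add: subst_fun_def m mon_wt_add mult_ac)
    qed
    also have "\<dots> = coef (subst_msym r f * subst_msym r g) m"
      by (simp add: coef_mult coef_subst[OF r])
    finally show ?thesis .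
  qed
qed

lemma pull_eq_0_iff: "nodes_below r m \<Longrightarrow> pull r m = 0 \<longleftrightarrow> m = 0"
  using nodes_below_eqI[where r = r and m = m and m' = 0] by (auto simp: map_key_zero inj_node_map)

lemma subst_const:
  assumes r: "r > 0"
  shows "subst_msym r (const p) = const (eval_poly (loop_wt r) p)"
proof (rule msym_eqI)
  fix m
  show "coef (subst_msym r (const p)) m = coef (const (eval_poly (loop_wt r) p)) m"
  proof (cases "nodes_below r m")
    case True
    then show ?thesis using pull_eq_0_iff[OF True] by (simp add: coef_subst[OF r] subst_fun_def coef_const)
  next
    case False
    then have "m \<noteq> 0" by auto
    with False show ?thesis by (simp add: coef_subst[OF r] subst_fun_def coef_const)
  qed
qed

lemma subst_1: "r > 0 \<Longrightarrow> subst_msym r 1 = 1"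
  using subst_const[of r 1] by (simp add: const_1)

lemma subst_psf:
  assumes r: "r > 0" and k: "k > 0"
  shows "subst_msym r (psf () k) = (\<Sum>i<r. const (path_wt r i ^ k) * psf i k)"
proof (rule msym_eqI)
  fix m
  have u: "coef (psf () k :: (unit, int poly) msym) p = (if exponents p = {#k#} then 1 else 0)" for p
    unfolding psf_def msf.rep_eq by (auto intro: image_subsetI)
  show "coef (subst_msym r (psf () k)) m = coef (\<Sum>i<r. const (path_wt r i ^ k) * psf i k) m"
  proof (cases "exponents m = {#k#}")
    case True
    have "card (keys m) = 1"
      using arg_cong[OF True, of size] by (simp only: exponents_def size_image_mset size_mset_set size_single)
    then obtain x where x: "keys m = {x}" by (rule card_1_singletonE)
    then have lx: "lookup m x = k" using True by (simp add: exponents_def)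
    have "coef (\<Sum>i<r. const (path_wt r i ^ k) * psf i k) m = (\<Sum>i<r. if fst x = i then path_wt r i ^ k else 0)"
      by (simp add: coef_sum coef_const_mult psf_def msf.rep_eq True x if_distrib[of "\<lambda>z. _ * z"] cong: if_cong)
    also have "\<dots> = (if fst x < r then path_wt r (fst x) ^ k else 0)"
      by (simp add: sum.delta')
    also have "\<dots> = coef (subst_msym r (psf () k)) m"
      using exponents_pull[OF r, of m]
      by (simp add: coef_subst[OF r] subst_fun_def u x lx True mon_wt_def)
    finally show ?thesis ..
  next
    case False
    then show ?thesis
      using exponents_pull[OF r, of m]
      by (simp add: coef_subst[OF r] subst_fun_def u psf_def[of "_ :: nat"] msf.rep_eq coef_sum coef_const_mult)
  qed
qed

lemma is_subst_subst:
  assumes "r > 0"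
  shows "is_subst r (subst_msym r)"
  unfolding is_subst_def
  using subst_const[OF assms, of "[:0, 1:]"] subst_psf[OF assms]
  by (auto simp: subst_1 subst_add subst_mult assms eval_poly_pCons loop_wt_def path_wt_def)

lemma free_of_unit_const:
  fixes C :: "(unit, 'a::comm_ring_1) msym"
  assumes "free_of () C"
  shows "C = const (coef C 0)"
proof (rule msym_eqI)
  fix m
  show "coef C m = coef (const (coef C 0)) m"
  proof (cases "m = 0")
    case False
    then obtain x where "x \<in> keys m" by (metis ex_in_conv keys_eq_empty)
    then have "() \<in> fst ` keys m" by (intro image_eqI[of _ _ x]) auto
    then have "coef C m = 0" using assms by (auto simp: free_of_def)
    with False show ?thesis by (simp add: coef_const)
  qed (simp add: coef_const)
qed

text \<open>The scalars are the integer polynomials in \<open>t\<close>, so the image of \<open>t\<close> decides.\<close>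

lemma is_subst_const:
  assumes "is_subst r \<phi>"
  shows "\<phi> (const p) = const (eval_poly (loop_wt r) p)"
proof -
  have add: "\<phi> (f + g) = \<phi> f + \<phi> g" and mult: "\<phi> (f * g) = \<phi> f * \<phi> g" and one: "\<phi> 1 = 1"
    and X: "\<phi> (const [:0, 1:]) = const (loop_wt r)" for f g
    using assms by (simp_all add: is_subst_def loop_wt_def)
  have zero: "\<phi> 0 = 0" using add[of 0 0] by simp
  have nat: "\<phi> (of_nat n) = of_nat n" for n by (induction n) (simp_all add: add one zero)
  have uminus: "\<phi> (- f) = - \<phi> f" for f using add[of f "- f"] by (simp add: zero eq_neg_iff_add_eq_0 add.commute)
  have int: "\<phi> (of_int n) = of_int n" for n
    by (cases n) (simp_all add: nat uminus del: of_nat_Suc)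
  have const_nat: "const (of_nat n) = (of_nat n :: ('i, 'b::comm_ring_1) msym)" for n
    by (induction n) (simp_all add: const_add const_1)
  have const_uminus: "const (- c) = (- const c :: ('i, 'b::comm_ring_1) msym)" for c
    using const_add[of c "- c", where ?'a = 'i] by (simp add: eq_neg_iff_add_eq_0 add.commute)
  have const_int: "const (of_int n) = (of_int n :: ('i, 'b::comm_ring_1) msym)" for n
    by (cases n) (simp_all add: const_nat const_uminus del: of_nat_Suc)
  show ?thesis
  proof (induction p)
    case 0
    then show ?case by (simp add: zero)
  next
    case (pCons a p)
    have "pCons a p = of_int a + [:0, 1:] * p" by (simp add: of_int_poly)
    then have "\<phi> (const (pCons a p)) = of_int a + const (loop_wt r) * \<phi> (const p)"
      by (simp only: const_add const_mult const_int add mult int X)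
    then show ?case by (simp add: pCons eval_poly_pCons const_add const_mult const_int)
  qed
qed

text \<open>Both sides satisfy Newton's identities for the substituted power sums, and these determine them
  since the target ring is torsion-free.\<close>

lemma is_subst_hsf:
  assumes "is_subst r \<phi>"
  shows "\<phi> (hsf () n) = tail_hsf r 0 n"
proof -
  let ?P = "Abs_fps (\<lambda>k. \<phi> (psf () (Suc k)))"
  have add: "\<phi> (f + g) = \<phi> f + \<phi> g" and mult: "\<phi> (f * g) = \<phi> f * \<phi> g" and one: "\<phi> 1 = 1"
    and psf: "k \<ge> 1 \<Longrightarrow> \<phi> (psf () k) = (\<Sum>i<r. const (path_wt r i ^ k) * psf i k)" for f g k
    using assms by (simp_all add: is_subst_def path_wt_def)
  have zero: "\<phi> 0 = 0" using add[of 0 0] by simp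
  have nat: "\<phi> (of_nat n) = of_nat n" for n by (induction n) (simp_all add: add one zero)
  have sum: "\<phi> (\<Sum>x\<in>I. f x) = (\<Sum>x\<in>I. \<phi> (f x))" for f and I :: "nat set"
    by (induction I rule: infinite_finite_induct) (auto simp: add zero)
  have "newton_pair ?P (Abs_fps (\<lambda>n. \<phi> (hsf () n)))"
  proof (rule newton_pairI)
    fix n
    show "of_nat n * \<phi> (hsf () n) = (\<Sum>k<n. \<phi> (psf () (Suc k)) * \<phi> (hsf () (n - Suc k)))"
      using arg_cong[OF newton_hsf[of n "()"], of \<phi>] by (simp only: mult nat sum)
  qed (simp add: one)
  moreover have "newton_pair ?P (Abs_fps (tail_hsf r 0))"
  proof -
    have P: "?P = (\<Sum>j\<in>{0..<r}. Abs_fps (\<lambda>k. const (path_wt r j ^ Suc k) * psf j (Suc k)))"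
      by (rule fps_ext) (simp add: fps_sum_nth psf atLeast0LessThan)
    have T: "Abs_fps (tail_hsf r 0) = (\<Prod>j\<in>{0..<r}. Abs_fps (\<lambda>n. const (path_wt r j) ^ n * hsf j n))"
      by (rule fps_ext) (simp add: tail_hsf_def)
    show ?thesis unfolding P T by (rule newton_pair_prod[OF newton_pair_hsf])
  qed
  ultimately have "Abs_fps (\<lambda>n. \<phi> (hsf () n)) = Abs_fps (tail_hsf r 0)"
    by (rule newton_pair_unique[rotated]) (rule msym_torsion_free)
  from arg_cong[OF this, of "\<lambda>F. fps_nth F n"] show ?thesis by simp
qed

text \<open>Scalars and complete symmetric functions generate, and both have prescribed images.\<close>

lemma is_subst_unique:
  assumes "is_subst r \<phi>" "is_subst r \<psi>"
  shows "\<phi> = \<psi>"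
proof
  fix f
  have add: "\<phi> (f + g) = \<phi> f + \<phi> g" "\<psi> (f + g) = \<psi> f + \<psi> g"
    and mult: "\<phi> (f * g) = \<phi> f * \<phi> g" "\<psi> (f * g) = \<psi> f * \<psi> g" for f g
    using assms by (simp_all add: is_subst_def)
  from hspan_all[of "()" f] show "\<phi> f = \<psi> f"
  proof (induction rule: hspan.induct)
    case (free C)
    have c: "\<chi> C = const (eval_poly (loop_wt r) (coef C 0))" if "is_subst r \<chi>" for \<chi>
      using arg_cong[OF free_of_unit_const[OF free], of \<chi>] by (simp only: is_subst_const[OF that])
    show ?case unfolding c[OF assms(1)] c[OF assms(2)] ..
  qed (simp_all add: add mult is_subst_hsf[OF assms(1)] is_subst_hsf[OF assms(2)])
qed

lemma plethysm_eq:
  assumes "r > 0"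
  shows "plethysm r = subst_msym r"
  unfolding plethysm_def
proof (rule the_equality)
  show "is_subst r (subst_msym r)" by (rule is_subst_subst[OF assms])
  show "\<phi> = subst_msym r" if "is_subst r \<phi>" for \<phi>
    by (rule is_subst_unique[OF that is_subst_subst[OF assms]])
qed

section \<open>Substitution and adjoints\<close>

lemma subst_0: "r > 0 \<Longrightarrow> subst_msym r 0 = 0"
  using subst_add[of r 0 0] by simp

lemma subst_uminus: "r > 0 \<Longrightarrow> subst_msym r (- f) = - subst_msym r f"
  using subst_add[of r f "- f"] by (simp add: subst_0 eq_neg_iff_add_eq_0 add.commute)

lemma subst_sum: "r > 0 \<Longrightarrow> subst_msym r (\<Sum>x\<in>I. f x) = (\<Sum>x\<in>I. subst_msym r (f x))"
  by (induction I rule: infinite_finite_induct) (auto simp: subst_add subst_0)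

lemma subst_prod: "r > 0 \<Longrightarrow> subst_msym r (\<Prod>x\<in>I. f x) = (\<Prod>x\<in>I. subst_msym r (f x))"
  by (induction I rule: infinite_finite_induct) (auto simp: subst_mult subst_1)

lemma subst_power: "r > 0 \<Longrightarrow> subst_msym r (f ^ n) = subst_msym r f ^ n"
  by (induction n) (simp_all add: subst_1 subst_mult)

text \<open>Adding \<open>u\<close> to \<open>X\<^sup>(\<^sup>i\<^sup>)\<close> adds \<open>y\<^sub>i u\<close> to \<open>Y\<close>.\<close>

lemma hperp_subst:
  assumes r: "r > 0" and i: "i < r"
  shows "hperp i n (subst_msym r f) = const (path_wt r i ^ n) * subst_msym r (hperp () n f)"
proof (rule msym_eqI)
  fix m :: "nat mon"
  obtain k where k: "(i, k) \<notin> keys m" using ex_fresh[of i m] ..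
  have below: "nodes_below r (m + single (i, k) n) \<longleftrightarrow> nodes_below r m"
    using i by (simp add: keys_add_nat image_Un)
  have pull: "pull r (m + single (i, k) n) = pull r m + single ((), k * r + i) n"
    using map_key_single[OF inj_node_map, of r "((), k * r + i)" n] by (simp add: pull_add node_map_eq[OF i])
  have fresh: "((), k * r + i) \<notin> keys (pull r m)"
    using k by (simp add: in_keys_iff lookup_pull node_map_eq[OF i])
  show "coef (hperp i n (subst_msym r f)) m = coef (const (path_wt r i ^ n) * subst_msym r (hperp () n f)) m"
    by (simp add: coef_hperp[OF k] coef_const_mult coef_subst[OF r] subst_fun_def below pull
        coef_hperp[OF fresh] mon_wt_add mon_wt_single mult_ac)
qed

lemma eperp_subst:
  assumes r: "r > 0" and i: "i < r"
  shows "eperp i n (subst_msym r f) = const (path_wt r i ^ n) * subst_msym r (eperp () n f)"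
proof (induction n arbitrary: f rule: less_induct)
  case (less n)
  show ?case
  proof (cases "n = 0")
    case False
    have "eperp i k (hperp i (n - k) (subst_msym r f)) =
        const (path_wt r i ^ n) * subst_msym r (eperp () k (hperp () (n - k) f))" if "k < n" for k
    proof -
      have "path_wt r i ^ n = path_wt r i ^ (n - k) * path_wt r i ^ k" using that by (simp flip: power_add)
      then show ?thesis
        by (simp add: hperp_subst[OF r i] eperp_free_mult less[OF that] const_mult mult.assoc)
    qed
    with False show ?thesis
      by (simp add: eperp.simps[of i n] eperp.simps[of "()" n] subst_uminus[OF r] subst_sum[OF r] sum_distrib_left)
  qed (simp add: const_1)
qed

lemma vperp_subst:
  assumes r: "r > 0" and i: "i < r" and j: "j < r"
  shows "vperp t i j n (subst_msym r f) =
    (\<Sum>p\<le>n. const ((t * path_wt r j) ^ (n - p) * path_wt r i ^ p) * subst_msym r (eperp () p (hperp () (n - p) f)))"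
  unfolding vperp_def
proof (intro sum.cong refl)
  fix p
  have "const (t ^ (n - p)) * hperp j (n - p) (subst_msym r f) =
      const ((t * path_wt r j) ^ (n - p)) * subst_msym r (hperp () (n - p) f)"
    by (simp add: hperp_subst[OF r j] power_mult_distrib const_mult mult.assoc)
  then show "eperp i p (const (t ^ (n - p)) * hperp j (n - p) (subst_msym r f)) =
      const ((t * path_wt r j) ^ (n - p) * path_wt r i ^ p) * subst_msym r (eperp () p (hperp () (n - p) f))"
    by (simp add: eperp_free_mult eperp_subst[OF r i] const_mult mult.assoc)
qed

text \<open>The translation changes \<open>Y\<close> by \<open>(t\<^sub>i\<^sub>,\<^sub>i\<^sub>+\<^sub>1 y\<^sub>i\<^sub>+\<^sub>1 - y\<^sub>i)/z = 0\<close>.\<close>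

lemma vperp_subst_inner:
  assumes "Suc i < r"
  shows "vperp (tvar i) i (Suc i) n (subst_msym r f) = (if n = 0 then subst_msym r f else 0)"
proof -
  have r: "r > 0" using assms by simp
  have "vperp (tvar i) i (Suc i) n (subst_msym r f) =
      (\<Sum>p\<le>n. const (path_wt r i ^ n) * subst_msym r (eperp () p (hperp () (n - p) f)))"
  proof -
    have "(tvar i * path_wt r (Suc i)) ^ (n - p) * path_wt r i ^ p = path_wt r i ^ n" if "p \<le> n" for p
      using that by (simp add: path_wt_step[OF assms] flip: power_add)
    then show ?thesis using assms by (subst vperp_subst[OF r]) auto
  qed
  also have "\<dots> = const (path_wt r i ^ n) * subst_msym r (if n = 0 then f else 0)"
    by (simp only: sum_distrib_left[symmetric] subst_sum[OF r, symmetric] eperp_rec)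
  finally show ?thesis by (simp add: const_1 subst_0[OF r])
qed

text \<open>The translation changes \<open>Y\<close> by \<open>(t\<^sub>r\<^sub>-\<^sub>1\<^sub>,\<^sub>0 y\<^sub>0 - 1)/z\<close>, which is the change of the single alphabet under the
  loop with the substituted weight.\<close>

lemma vperp_subst_last:
  assumes r: "r > 0"
  shows "vperp (tvar (r - 1)) (r - 1) 0 n (subst_msym r f) = subst_msym r (vperp [:0, 1:] () () n f)"
proof -
  have "vperp (tvar (r - 1)) (r - 1) 0 n (subst_msym r f) =
      (\<Sum>p\<le>n. const (loop_wt r ^ (n - p)) * subst_msym r (eperp () p (hperp () (n - p) f)))"
    using r vperp_subst[OF r, of "r - 1" 0] by (simp only: path_wt_loop[OF r] path_wt_last) simp
  also have "\<dots> = subst_msym r (vperp [:0, 1:] () () n f)"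
  proof -
    have "subst_msym r (const ([:0, 1:] ^ l)) = const (loop_wt r ^ l)" for l
      by (simp only: const_power subst_power[OF r] subst_const[OF r]) (simp add: eval_poly_pCons)
    then show ?thesis
      unfolding vperp_def subst_sum[OF r] eperp_free_mult[OF free_of_const] subst_mult[OF r] by simp
  qed
  finally show ?thesis .
qed

section \<open>One pass around the quiver\<close>

lemma vperps_subst_last:
  assumes r: "r > 0"
  shows "vperps (tvar (r - 1)) (r - 1) 0 a \<delta> (subst_msym r f) = subst_msym r (vperps [:0, 1:] () () a \<delta> f)"
proof -
  have "foldr (\<lambda>k. vperp (tvar (r - 1)) (r - 1) 0 (d k)) ks (subst_msym r f) =
      subst_msym r (foldr (\<lambda>k. vperp [:0, 1:] () () (d k)) ks f)" for ks and d :: "nat \<Rightarrow> nat"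
    by (induction ks) (simp_all only: foldr.simps id_apply comp_apply vperp_subst_last[OF r])
  then show ?thesis by (simp only: vperps_def subst_0[OF r] if_distrib[of "subst_msym r"])
qed

lemma subst_of_int_mult: "r > 0 \<Longrightarrow> subst_msym r (of_int c * f) = of_int c * subst_msym r f"
proof -
  assume r: "r > 0"
  have "subst_msym r (of_nat n) = of_nat n" for n
    by (induction n) (simp_all add: subst_add[OF r] subst_1[OF r] subst_0[OF r])
  then have "subst_msym r (of_int c) = of_int c"
    by (cases c) (simp_all add: subst_uminus[OF r] del: of_nat_Suc)
  then show ?thesis by (simp add: subst_mult[OF r])
qed

lemma subst_schur:
  assumes r: "r > 0"
  shows "subst_msym r (schur a (hsf ()) \<nu>) = schur a (tail_hsf r 0) \<nu>"
proof -
  have "subst_msym r (int_nth (hsf ()) n) = int_nth (tail_hsf r 0) n" for n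
    by (simp add: int_nth_def subst_0[OF r] is_subst_hsf[OF is_subst_subst[OF r]])
  then have "subst_msym r (seq_mon a (hsf ()) \<kappa>) = seq_mon a (tail_hsf r 0) \<kappa>" for \<kappa>
    by (simp add: seq_mon_def subst_0[OF r] subst_prod[OF r])
  then show ?thesis
    by (simp add: schur_def lin_ext_def subst_sum[OF r] subst_of_int_mult[OF r])
qed

lemma nth_replicate_0: "Poly_Mapping.nth (replicate a 0) = (0 :: expo)"
  by (rule poly_mapping_eqI) (simp add: nth.rep_eq nth_default_def)

text \<open>The factors \<open>g \<delta>\<close> in the alphabet \<open>Y\<close> are invariant, and each operator enlarges the alphabet of
  the determinants by one node.\<close>

lemma Hop_pass:
  assumes m: "Suc m \<le> r"
  shows "foldr (\<lambda>i. Hop (tvar i) i ((i + 1) mod r) a (replicate a 0)) [0..<m]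
      (\<Sum>\<delta>\<in>D. schur a (tail_hsf r m) (\<nu> \<delta>) * subst_msym r (g \<delta>)) =
    (\<Sum>\<delta>\<in>D. schur a (tail_hsf r 0) (\<nu> \<delta>) * subst_msym r (g \<delta>))"
  using m
proof (induction m)
  case (Suc m)
  then have m: "Suc m < r" by simp
  have md: "(m + 1) mod r = Suc m" using m by simp
  obtain y where y: "path_wt r m * y = 1" using path_wt_unit by blast
  have step: "Hop (tvar m) m (Suc m) a (replicate a 0) (schur a (tail_hsf r (Suc m)) \<nu> * subst_msym r f) =
      schur a (tail_hsf r m) \<nu> * subst_msym r f" for \<nu> f
  proof -
    have "tail_hsf r m = seq_conv (\<lambda>n. const (path_wt r m) ^ n * hsf m n) (tail_hsf r (Suc m))"
      using m by (intro tail_hsf_step) simp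
    then show ?thesis
      by (simp only:) (rule Hop_schur[OF sperp_tail_hsf[OF m] free_of_tail_hsf y vperp_subst_inner[OF m]], simp_all add: nth_replicate_0)
  qed
  have "foldr (\<lambda>i. Hop (tvar i) i ((i + 1) mod r) a (replicate a 0)) [0..<Suc m]
      (\<Sum>\<delta>\<in>D. schur a (tail_hsf r (Suc m)) (\<nu> \<delta>) * subst_msym r (g \<delta>)) =
    foldr (\<lambda>i. Hop (tvar i) i ((i + 1) mod r) a (replicate a 0)) [0..<m]
      (\<Sum>\<delta>\<in>D. schur a (tail_hsf r m) (\<nu> \<delta>) * subst_msym r (g \<delta>))"
    by (simp only: upt_Suc_append[OF le0] foldr_append foldr.simps comp_apply id_apply md Hop_sum step)
  then show ?case using Suc by simp
qed simp

text \<open>The node \<open>r - 1\<close> acts first and performs the translation of the loop; the other nodes then extend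
  the determinants from \<open>X\<^sup>(\<^sup>r\<^sup>-\<^sup>1\<^sup>)\<close> to \<open>Y\<close>.\<close>

lemma quiver_pass:
  assumes r: "r > 0"
  shows "foldr (\<lambda>i. Hop (tvar i) i ((i + 1) mod r) a (replicate a (if i = r - 1 then b else 0))) [0..<r]
      (subst_msym r f) = subst_msym r (Hop [:0, 1:] () () a (replicate a b) f)"
proof -
  let ?\<beta> = "Poly_Mapping.nth (replicate a b)"
  let ?L = "\<lambda>\<delta>. vperps [:0, 1:] () () a \<delta> f"
  let ?D = "{\<delta>. ?L \<delta> \<noteq> 0}"
  have fin: "finite ?D" by (rule finite_vperps)
  have last: "Hop (tvar (r - 1)) (r - 1) ((r - 1 + 1) mod r) a (replicate a b) (subst_msym r f) =
      (\<Sum>\<delta>\<in>?D. schur a (tail_hsf r (r - 1)) (?\<beta> + \<delta>) * subst_msym r (?L \<delta>))"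
  proof -
    have md: "(r - 1 + 1) mod r = 0" using r by simp
    show ?thesis
      unfolding md Hop_eq vperps_subst_last[OF r] tail_hsf_last[OF r]
      by (rule Sum_any.expand_superset[OF fin]) (auto simp: subst_0[OF r])
  qed
  have "[0..<r] = [0..<r - 1] @ [r - 1]"
    using r by (metis Suc_diff_1 le0 upt_Suc_append)
  then have "foldr (\<lambda>i. Hop (tvar i) i ((i + 1) mod r) a (replicate a (if i = r - 1 then b else 0))) [0..<r]
      (subst_msym r f) =
    foldr (\<lambda>i. Hop (tvar i) i ((i + 1) mod r) a (replicate a (if i = r - 1 then b else 0))) [0..<r - 1]
      (\<Sum>\<delta>\<in>?D. schur a (tail_hsf r (r - 1)) (?\<beta> + \<delta>) * subst_msym r (?L \<delta>))"
    by (simp only: foldr_append foldr.simps comp_apply id_apply simp_thms if_True last)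
  also have "\<dots> = foldr (\<lambda>i. Hop (tvar i) i ((i + 1) mod r) a (replicate a 0)) [0..<r - 1]
      (\<Sum>\<delta>\<in>?D. schur a (tail_hsf r (r - 1)) (?\<beta> + \<delta>) * subst_msym r (?L \<delta>))"
    by (rule foldr_cong) auto
  also have "\<dots> = (\<Sum>\<delta>\<in>?D. schur a (tail_hsf r 0) (?\<beta> + \<delta>) * subst_msym r (?L \<delta>))"
    by (rule Hop_pass) (use r in simp)
  also have "\<dots> = subst_msym r (\<Sum>\<delta>\<in>?D. schur a (hsf ()) (?\<beta> + \<delta>) * ?L \<delta>)"
    by (simp only: subst_sum[OF r] subst_mult[OF r] subst_schur[OF r])
  also have "(\<Sum>\<delta>\<in>?D. schur a (hsf ()) (?\<beta> + \<delta>) * ?L \<delta>) = Hop [:0, 1:] () () a (replicate a b) f"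
    unfolding Hop_eq by (rule Sum_any.expand_superset[OF fin, symmetric]) auto
  finally show ?thesis .
qed

lemma foldr_concat: "foldr f (concat xss) z = foldr (\<lambda>xs. foldr f xs) xss z"
  by (induction xss) auto

theorem corollary8:
  fixes r s :: nat and \<mu> \<eta> :: "nat list"
  assumes "r \<ge> 1" and "s \<ge> 1"
    and "length \<mu> = s" and "sorted_wrt (\<ge>) \<mu>"
    and "length \<eta> = s" and "\<forall>k<s. \<eta> ! k > 0"
  shows "quiver_HL r \<mu> \<eta> = plethysm r (loop_HL \<mu> \<eta>)"
proof -
  have r: "r > 0" using assms(1) by simp
  let ?P = "\<lambda>k. foldr (\<lambda>i. Hop (tvar i) i ((i + 1) mod r) (\<eta> ! k)
    (replicate (\<eta> ! k) (if i = r - 1 then int (\<mu> ! k) else 0))) [0..<r]"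
  have "foldr ?P ks (subst_msym r f) =
      subst_msym r (foldr (\<lambda>k. Hop [:0, 1:] () () (\<eta> ! k) (replicate (\<eta> ! k) (int (\<mu> ! k)))) ks f)" for ks f
    by (induction ks) (simp_all only: foldr.simps id_apply comp_apply quiver_pass[OF r])
  from this[of "[0..<length \<eta>]" 1]
  have "foldr ?P [0..<length \<eta>] 1 = plethysm r (loop_HL \<mu> \<eta>)"
    by (simp only: loop_HL_def plethysm_eq[OF r] subst_1[OF r])
  moreover have "foldr (\<lambda>(i, a, \<beta>). Hop (tvar i) i ((i + 1) mod r) a \<beta>)
      (map (\<lambda>i. (i, \<eta> ! k, replicate (\<eta> ! k) (if i = r - 1 then int (\<mu> ! k) else 0))) [0..<r]) = ?P k" for k
    by (rule ext) (simp only: foldr_map comp_def prod.case)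
  ultimately show ?thesis
    unfolding quiver_HL_def quiver_seq_def foldr_concat
    by (simp only: foldr_map comp_def)
qed

end
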